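(* Let $\mathcal{A}$ be a finite-dimensional algebra over an algebraically closed field $\mathbb{F}$. Let $\Delta$ be a fine group (respectively, abelian group) grading on $\mathcal{A}$ and let $\Gamma$ be a coarsening of $\Delta$. Then $\Gamma$ is almost fine if and only if the kernel of the quotient map $U_{\mathrm{ab}}(\Delta)\to U_{\mathrm{ab}}(\Gamma)$ is finite and $\mathrm{tor.rank}(\Gamma)=\mathrm{tor.rank}(\Delta)$.
   Context: An algebra is a vector space equipped with any number of multilinear operations. A grading on $\mathcal{A}$ is a set of nonzero subspaces $\Gamma=\{\mathcal{A}_s\}_{s\in S}$ with $\mathcal{A}=\bigoplus_{s\in S}\mathcal{A}_s$ such that for any $n$-ary operation $\varphi$ and any $s_1,\ldots,s_n\in S$ there is $s\in S$ with $\varphi(\mathcal{A}_{s_1},\ldots,\mathcal{A}_{s_n})\subset\mathcal{A}_s$; $S$ is its support. The universal group $U(\Gamma)$ is the group generated by $S$ subject to the relations $s_1\cdots s_n=s$ whenever $0\neq\varphi(\mathcal{A}_{s_1},\ldots,\mathcal{A}_{s_n})\subset\mathcal{A}_s$ for an $n$-ary operation $\varphi$; $U_{\mathrm{ab}}(\Gamma)$ is its abelianization. $\Gamma$ is a group grading (respectively, abelian group grading) if the canonical map $S\to U(\Gamma)$ (respectively, $S\to U_{\mathrm{ab}}(\Gamma)$) is injective. A grading $\Gamma=\{\mathcal{A}_s\}_{s\in S}$ is a refinement of $\Gamma'=\{\mathcal{A}'_t\}_{t\in T}$ (and $\Gamma'$ a coarsening of $\Gamma$) if for any $s\in S$ there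 is $t\in T$ with $\mathcal{A}_s\subset\mathcal{A}'_t$; it is proper if some inclusion is proper. Sending $s$ to $t$ induces the surjective quotient map $U_{\mathrm{ab}}(\Gamma)\to U_{\mathrm{ab}}(\Gamma')$. A group (respectively, abelian group) grading is fine if it has no proper refinement that is itself a group (respectively, abelian group) grading. $\mathrm{Stab}(\Gamma)$ is the algebraic group of automorphisms of $\mathcal{A}$ mapping each component of $\Gamma$ to itself; the toral rank $\mathrm{tor.rank}(\Gamma)$ is the dimension of its maximal tori. $\Gamma$ is almost fine if the (free) rank of the finitely generated abelian group $U_{\mathrm{ab}}(\Gamma)$ equals $\mathrm{tor.rank}(\Gamma)$. *)

theory Defs
  imports
    "HOL-Algebra.Generated_Groups"
    "HOL-Algebra.FiniteProduct"
    "HOL-Computational_Algebra.Polynomial"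
begin

section \<open>Groups given by generators and relations\<close>

text \<open>Words over the letters \<open>x\<close> (written \<open>(True, x)\<close>) and \<open>x\<close> inverse (written \<open>(False, x)\<close>).
  A relation is a pair of words in the generators only (no inverses).\<close>

type_synonym 'x word = "(bool \<times> 'x) list"

abbreviation pos_word :: "'x list \<Rightarrow> 'x word" where
  "pos_word xs \<equiv> map (Pair True) xs"

inductive word_eq :: "'x set \<Rightarrow> ('x list \<times> 'x list) set \<Rightarrow> 'x word \<Rightarrow> 'x word \<Rightarrow> bool"
  for S :: "'x set" and R :: "('x list \<times> 'x list) set"
where
  word_refl: "w \<in> lists (UNIV \<times> S) \<Longrightarrow> word_eq S R w w"
| word_sym: "word_eq S R v w \<Longrightarrow> word_eq S R w v"
| word_trans: "word_eq S R u v \<Longrightarrow> word_eq S R v w \<Longrightarrow> word_eq S R u w"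
| word_cong: "word_eq S R u u' \<Longrightarrow> word_eq S R v v' \<Longrightarrow> word_eq S R (u @ v) (u' @ v')"
| word_cancel: "x \<in> S \<Longrightarrow> word_eq S R [(b, x), (\<not> b, x)] []"
| word_relator: "(l, r) \<in> R \<Longrightarrow> set l \<subseteq> S \<Longrightarrow> set r \<subseteq> S \<Longrightarrow> word_eq S R (pos_word l) (pos_word r)"

definition word_class :: "'x set \<Rightarrow> ('x list \<times> 'x list) set \<Rightarrow> 'x word \<Rightarrow> 'x word set" where
  "word_class S R w = {v. word_eq S R w v}"

definition presented_group :: "'x set \<Rightarrow> ('x list \<times> 'x list) set \<Rightarrow> 'x word set monoid" where
  "presented_group S R =
     \<lparr>carrier = word_class S R ` lists (UNIV \<times> S),
      monoid.mult = (\<lambda>C D. {w. \<exists>u\<in>C. \<exists>v\<in>D. word_eq S R (u @ v) w}),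
      one = word_class S R []\<rparr>"

lemma word_eq_letters:
  "word_eq S R v w \<Longrightarrow> v \<in> lists (UNIV \<times> S) \<and> w \<in> lists (UNIV \<times> S)"
  by (induction rule: word_eq.induct) (auto simp: in_lists_conv_set)

lemma word_class_eq_iff:
  assumes "v \<in> lists (UNIV \<times> S)"
  shows "word_class S R v = word_class S R w \<longleftrightarrow> word_eq S R v w"
proof
  assume "word_class S R v = word_class S R w"
  moreover have "v \<in> word_class S R v"
    using assms by (simp add: word_class_def word_eq.word_refl)
  ultimately show "word_eq S R v w"
    by (simp add: word_class_def word_eq.word_sym)
next
  assume "word_eq S R v w"
  then show "word_class S R v = word_class S R w"
    unfolding word_class_def by (blast intro: word_eq.word_sym word_eq.word_trans)
qed

lemma presented_group_mult:
  assumes "v \<in> lists (UNIV \<times> S)" "w \<in> lists (UNIV \<times> S)"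
  shows "word_class S R v \<otimes>\<^bsub>presented_group S R\<^esub> word_class S R w = word_class S R (v @ w)"
proof -
  have "word_eq S R v v" "word_eq S R w w"
    using assms by (auto intro: word_eq.word_refl)
  then show ?thesis
    unfolding presented_group_def word_class_def
    by (auto intro: word_eq.word_cong word_eq.word_trans)
qed

lemma inverse_word:
  assumes "w \<in> lists (UNIV \<times> S)"
  obtains v where "v \<in> lists (UNIV \<times> S)" "word_eq S R (v @ w) []"
proof -
  have "\<exists>v \<in> lists (UNIV \<times> S). word_eq S R (v @ w) []"
    using assms
  proof (induction w)
    case Nil
    then show ?case by (auto intro!: bexI[of _ "[]"] word_eq.word_refl)
  next
    case (Cons a w)
    obtain b x where a: "a = (b, x)" "x \<in> S"
      using Cons.hyps by (cases a) auto
    obtain v where v: "v \<in> lists (UNIV \<times> S)" "word_eq S R (v @ w) []"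
      using Cons by auto
    have w: "w \<in> lists (UNIV \<times> S)" using Cons.hyps by auto
    have "word_eq S R ([(\<not> b, x), (\<not> \<not> b, x)] @ w) ([] @ w)"
      using a w by (intro word_eq.word_cong word_eq.word_cancel word_eq.word_refl)
    then have "word_eq S R (v @ ([(\<not> b, x), a] @ w)) (v @ w)"
      using v(1) a by (intro word_eq.word_cong word_eq.word_refl) auto
    then have "word_eq S R ((v @ [(\<not> b, x)]) @ a # w) []"
      using v(2) by (auto intro: word_eq.word_trans)
    moreover have "v @ [(\<not> b, x)] \<in> lists (UNIV \<times> S)"
      using v(1) a by auto
    ultimately show ?case by blast
  qed
  then show ?thesis using that by blast
qed

lemma group_presented_group: "group (presented_group S R)"
proof (rule groupI)
  let ?G = "presented_group S R"
  have car: "C \<in> carrier ?G \<longleftrightarrow> (\<exists>w \<in> lists (UNIV \<times> S). C = word_class S R w)" for C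
    by (auto simp: presented_group_def)
  have one: "\<one>\<^bsub>?G\<^esub> = word_class S R []"
    by (simp add: presented_group_def)
  show "\<one>\<^bsub>?G\<^esub> \<in> carrier ?G"
    unfolding car one by blast
  show "C \<otimes>\<^bsub>?G\<^esub> D \<in> carrier ?G" if CD: "C \<in> carrier ?G" "D \<in> carrier ?G" for C D
  proof -
    obtain v w where "v \<in> lists (UNIV \<times> S)" "w \<in> lists (UNIV \<times> S)"
      "C = word_class S R v" "D = word_class S R w"
      using CD car by auto
    then show ?thesis
      unfolding car by (auto simp: presented_group_mult intro!: bexI[of _ "v @ w"])
  qed
  show "C \<otimes>\<^bsub>?G\<^esub> D \<otimes>\<^bsub>?G\<^esub> E = C \<otimes>\<^bsub>?G\<^esub> (D \<otimes>\<^bsub>?G\<^esub> E)"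
    if CDE: "C \<in> carrier ?G" "D \<in> carrier ?G" "E \<in> carrier ?G" for C D E
  proof -
    obtain u v w where
      uvw: "u \<in> lists (UNIV \<times> S)" "v \<in> lists (UNIV \<times> S)" "w \<in> lists (UNIV \<times> S)"
        "C = word_class S R u" "D = word_class S R v" "E = word_class S R w"
      using CDE unfolding car by blast
    then have "u @ v \<in> lists (UNIV \<times> S)" "v @ w \<in> lists (UNIV \<times> S)" by auto
    with uvw show ?thesis by (simp only: presented_group_mult append_assoc)
  qed
  show "\<one>\<^bsub>?G\<^esub> \<otimes>\<^bsub>?G\<^esub> C = C" if C: "C \<in> carrier ?G" for C
  proof -
    obtain w where w: "w \<in> lists (UNIV \<times> S)" "C = word_class S R w"
      using C car by blast
    with presented_group_mult[OF lists.Nil w(1)] show ?thesis by (simp add: one)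
  qed
  show "\<exists>D\<in>carrier ?G. D \<otimes>\<^bsub>?G\<^esub> C = \<one>\<^bsub>?G\<^esub>" if C: "C \<in> carrier ?G" for C
  proof -
    obtain w where w: "w \<in> lists (UNIV \<times> S)" "C = word_class S R w"
      using C car by auto
    obtain v where v: "v \<in> lists (UNIV \<times> S)" "word_eq S R (v @ w) []"
      using inverse_word[OF w(1)] by blast
    have "word_class S R v \<otimes>\<^bsub>?G\<^esub> C = \<one>\<^bsub>?G\<^esub>"
      using v w by (simp add: one presented_group_mult word_class_eq_iff append_in_lists_conv)
    then show ?thesis using v(1) car by blast
  qed
qed

lemma presented_group_universal:
  assumes H: "group H" and f: "f ` S \<subseteq> carrier H"
    and rel: "\<And>l r. (l, r) \<in> R \<Longrightarrow> set l \<subseteq> S \<Longrightarrow> set r \<subseteq> S \<Longrightarrow>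
      foldr (\<lambda>x y. f x \<otimes>\<^bsub>H\<^esub> y) l \<one>\<^bsub>H\<^esub> = foldr (\<lambda>x y. f x \<otimes>\<^bsub>H\<^esub> y) r \<one>\<^bsub>H\<^esub>"
  obtains h where "h \<in> hom (presented_group S R) H"
    "\<And>x. x \<in> S \<Longrightarrow> h (word_class S R (pos_word [x])) = f x"
proof -
  interpret H: group H by fact
  define ev where
    "ev = (\<lambda>w. foldr (\<lambda>(b, x) y. (if b then f x else inv\<^bsub>H\<^esub> f x) \<otimes>\<^bsub>H\<^esub> y) w \<one>\<^bsub>H\<^esub>)"
  have ev_simps [simp]: "ev [] = \<one>\<^bsub>H\<^esub>"
    "\<And>b x w. ev ((b, x) # w) = (if b then f x else inv\<^bsub>H\<^esub> f x) \<otimes>\<^bsub>H\<^esub> ev w"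
    by (auto simp: ev_def)
  have ev_closed: "ev w \<in> carrier H" if "w \<in> lists (UNIV \<times> S)" for w
    using that f by (induction w) auto
  have ev_append: "ev (v @ w) = ev v \<otimes>\<^bsub>H\<^esub> ev w"
    if "v \<in> lists (UNIV \<times> S)" "w \<in> lists (UNIV \<times> S)" for v w
    using that
  proof (induction v)
    case Nil
    then show ?case by (simp add: ev_closed)
  next
    case (Cons a v)
    obtain b x where "a = (b, x)" "f x \<in> carrier H"
      using Cons.hyps f by (cases a) auto
    moreover have "ev v \<in> carrier H" "ev w \<in> carrier H"
      using Cons ev_closed by blast+
    ultimately show ?case using Cons by (simp add: H.m_assoc)
  qed
  have ev_pos: "ev (pos_word l) = foldr (\<lambda>x y. f x \<otimes>\<^bsub>H\<^esub> y) l \<one>\<^bsub>H\<^esub>" for l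
    by (induction l) auto
  have ev_eq: "ev v = ev w" if "word_eq S R v w" for v w
    using that
  proof (induction rule: word_eq.induct)
    case (word_cong u u' v v')
    then show ?case using word_eq_letters ev_append by metis
  next
    case (word_cancel x b)
    then have "f x \<in> carrier H" using f by auto
    then show ?case by (cases b) auto
  next
    case (word_relator l r)
    then show ?case by (simp add: ev_pos rel)
  qed auto
  define h where "h = (\<lambda>C. ev (SOME w. w \<in> C))"
  have h: "h (word_class S R w) = ev w" if "w \<in> lists (UNIV \<times> S)" for w
  proof -
    have "w \<in> word_class S R w"
      using that by (simp add: word_class_def word_eq.word_refl)
    then have "(SOME w'. w' \<in> word_class S R w) \<in> word_class S R w"
      by (rule someI)
    then show ?thesis
      using ev_eq by (simp add: h_def word_class_def)
  qed
  show thesis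
  proof
    show "h \<in> hom (presented_group S R) H"
    proof (rule homI)
      show "h C \<in> carrier H" if C: "C \<in> carrier (presented_group S R)" for C
      proof -
        obtain w where w: "w \<in> lists (UNIV \<times> S)" "C = word_class S R w"
          using C by (auto simp: presented_group_def)
        with h[OF w(1)] ev_closed[OF w(1)] show ?thesis by (simp only:)
      qed
      show "h (C \<otimes>\<^bsub>presented_group S R\<^esub> D) = h C \<otimes>\<^bsub>H\<^esub> h D"
        if CD: "C \<in> carrier (presented_group S R)" "D \<in> carrier (presented_group S R)" for C D
      proof -
        obtain v w where "v \<in> lists (UNIV \<times> S)" "w \<in> lists (UNIV \<times> S)"
          "C = word_class S R v" "D = word_class S R w"
          using CD by (auto simp: presented_group_def)
        then show ?thesis
          by (simp add: presented_group_mult h ev_append append_in_lists_conv)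
      qed
    qed
    show "h (word_class S R (pos_word [x])) = f x" if x: "x \<in> S" for x
    proof -
      have "f x \<in> carrier H" using x f by auto
      then show ?thesis using x by (simp add: h)
    qed
  qed
qed

definition abelianization :: "('a, 'b) monoid_scheme \<Rightarrow> 'a set monoid" where
  "abelianization G = G Mod derived G (carrier G)"

lemma abelianization_universal:
  assumes G: "group G" and H: "comm_group H" and h: "h \<in> hom G H"
  obtains g where "g \<in> hom (abelianization G) H"
    "\<And>x. x \<in> carrier G \<Longrightarrow> g (derived G (carrier G) #>\<^bsub>G\<^esub> x) = h x"
proof -
  interpret G: group G by fact
  interpret H: comm_group H by fact
  interpret h: group_hom G H h
    using h by unfold_locales
  have "derived_set G (carrier G) \<subseteq> kernel G H h"
  proof (clarsimp simp: kernel_def)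
    fix x y assume "x \<in> carrier G" "y \<in> carrier G"
    then show "h x \<otimes>\<^bsub>H\<^esub> h y \<otimes>\<^bsub>H\<^esub> inv\<^bsub>H\<^esub> h x \<otimes>\<^bsub>H\<^esub> inv\<^bsub>H\<^esub> h y = \<one>\<^bsub>H\<^esub>"
      by (metis H.inv_closed H.m_assoc H.m_closed H.m_comm H.r_inv H.r_one h.hom_closed)
  qed
  then have ker: "derived G (carrier G) \<subseteq> kernel G H h"
    unfolding derived_def using G.generate_subgroup_incl h.subgroup_kernel by blast
  have "h x = h y"
    if xy: "x \<in> carrier G" "y \<in> carrier G"
      "derived G (carrier G) #>\<^bsub>G\<^esub> x = derived G (carrier G) #>\<^bsub>G\<^esub> y" for x y
  proof -
    have "x \<in> derived G (carrier G) #>\<^bsub>G\<^esub> y"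
      using xy G.rcos_self[OF xy(1)] G.derived_is_subgroup[OF subset_refl] by auto
    then obtain d where "d \<in> derived G (carrier G)" "x = d \<otimes>\<^bsub>G\<^esub> y"
      by (auto simp: r_coset_def)
    then show ?thesis
      using ker xy(2) by (auto simp: kernel_def)
  qed
  then obtain g where "g \<in> hom (G Mod derived G (carrier G)) H"
    "\<And>x. x \<in> carrier G \<Longrightarrow> g (derived G (carrier G) #>\<^bsub>G\<^esub> x) = h x"
    using FactGroup_universal[OF h G.derived_self_is_normal] by blast
  then show thesis
    using that by (auto simp: abelianization_def)
qed


section \<open>Rank of an abelian group\<close>

text \<open>The maximal size of a \<open>\<int>\<close>-linearly independent set (torsion-free rank).  For a finitely
  generated abelian group it is the number of infinite cyclic summands.\<close>

definition int_independent :: "('a, 'b) monoid_scheme \<Rightarrow> 'a set \<Rightarrow> bool" where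
  "int_independent G B \<longleftrightarrow>
     (\<forall>c :: 'a \<Rightarrow> int.
        finprod G (\<lambda>b. b [^]\<^bsub>G\<^esub> c b) B = \<one>\<^bsub>G\<^esub> \<longrightarrow> (\<forall>b\<in>B. c b = 0))"

definition free_rank :: "('a, 'b) monoid_scheme \<Rightarrow> nat" where
  "free_rank G = Max {card B | B. finite B \<and> B \<subseteq> carrier G \<and> int_independent G B}"


section \<open>Regular functions and regular maps\<close>

text \<open>The algebra of functions generated by \<open>E\<close>: polynomial expressions in the members of \<open>E\<close>.\<close>

inductive_set fun_algebra :: "('x \<Rightarrow> 'f::field) set \<Rightarrow> ('x \<Rightarrow> 'f) set"
  for E :: "('x \<Rightarrow> 'f) set"
where
  fun_algebra_gen: "e \<in> E \<Longrightarrow> e \<in> fun_algebra E"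
| fun_algebra_const: "(\<lambda>_. c) \<in> fun_algebra E"
| fun_algebra_add: "p \<in> fun_algebra E \<Longrightarrow> q \<in> fun_algebra E \<Longrightarrow> (\<lambda>x. p x + q x) \<in> fun_algebra E"
| fun_algebra_mult: "p \<in> fun_algebra E \<Longrightarrow> q \<in> fun_algebra E \<Longrightarrow> (\<lambda>x. p x * q x) \<in> fun_algebra E"

text \<open>Here \<open>P\<close> and \<open>Q\<close> are coordinate rings of ambient affine varieties; the regular functions on
  closed subsets \<open>X\<close> and \<open>Y\<close> are the restrictions of their members.\<close>

definition regular_map ::
  "'x set \<Rightarrow> ('x \<Rightarrow> 'f) set \<Rightarrow> 'y set \<Rightarrow> ('y \<Rightarrow> 'f) set \<Rightarrow> ('x \<Rightarrow> 'y) \<Rightarrow> bool" where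
  "regular_map X P Y Q \<theta> \<longleftrightarrow>
     \<theta> ` X \<subseteq> Y \<and> (\<forall>q\<in>Q. \<exists>p\<in>P. \<forall>x\<in>X. q (\<theta> x) = p x)"

text \<open>The \<open>n\<close>-th power of the multiplicative group of the field, with the Laurent polynomials in
  the coordinates as its coordinate ring.\<close>

definition mult_torus :: "nat \<Rightarrow> (nat \<Rightarrow> 'f::field) monoid" where
  "mult_torus n =
     \<lparr>carrier = {..<n} \<rightarrow>\<^sub>E (UNIV - {0}),
      monoid.mult = (\<lambda>s t. \<lambda>k\<in>{..<n}. s k * t k),
      one = (\<lambda>k\<in>{..<n}. 1)\<rparr>"

definition mult_torus_regular :: "nat \<Rightarrow> ((nat \<Rightarrow> 'f::field) \<Rightarrow> 'f) set" where
  "mult_torus_regular n =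
     fun_algebra ({\<lambda>t. t k | k. k < n} \<union> {\<lambda>t. inverse (t k) | k. k < n})"


section \<open>Algebraic subgroups and tori in the general linear group\<close>

definition GL ::
  "('f::field \<Rightarrow> 'v::ab_group_add \<Rightarrow> 'v) \<Rightarrow> ('v \<Rightarrow> 'v) monoid" where
  "GL scale = \<lparr>carrier = {g. Vector_Spaces.linear scale scale g \<and> bij g},
         monoid.mult = (\<circ>), one = id\<rparr>"

text \<open>For a finite-dimensional space, the matrix entries of \<open>g\<close> and of its inverse generate the
  same algebra as the matrix entries of \<open>g\<close> and the inverse of the determinant.\<close>

definition GL_regular ::
  "('f::field \<Rightarrow> 'v::ab_group_add \<Rightarrow> 'v) \<Rightarrow> (('v \<Rightarrow> 'v) \<Rightarrow> 'f) set" where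
  "GL_regular scale =
     fun_algebra
       ({\<lambda>g. l (g v) | l v. Vector_Spaces.linear scale (*) l} \<union>
        {\<lambda>g. l (inv_into UNIV g v) | l v. Vector_Spaces.linear scale (*) l})"

definition closed_in_GL ::
  "('f::field \<Rightarrow> 'v::ab_group_add \<Rightarrow> 'v) \<Rightarrow> ('v \<Rightarrow> 'v) set \<Rightarrow> bool" where
  "closed_in_GL scale X \<longleftrightarrow>
     (\<exists>P \<subseteq> GL_regular scale. X = {g \<in> carrier (GL scale). \<forall>p\<in>P. p g = 0})"

definition algebraic_subgroup ::
  "('f::field \<Rightarrow> 'v::ab_group_add \<Rightarrow> 'v) \<Rightarrow> ('v \<Rightarrow> 'v) set \<Rightarrow> bool" where
  "algebraic_subgroup scale H \<longleftrightarrow> subgroup H (GL scale) \<and> closed_in_GL scale H"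

text \<open>A torus of dimension \<open>n\<close> is an algebraic group isomorphic (as an algebraic group) to the
  \<open>n\<close>-th power of the multiplicative group.\<close>

definition torus_of_dim ::
  "('f::field \<Rightarrow> 'v::ab_group_add \<Rightarrow> 'v) \<Rightarrow> nat \<Rightarrow> ('v \<Rightarrow> 'v) set \<Rightarrow> bool" where
  "torus_of_dim scale n T \<longleftrightarrow>
     algebraic_subgroup scale T \<and>
     (\<exists>\<theta> \<in> iso (mult_torus n :: (nat \<Rightarrow> 'f) monoid) (GL scale\<lparr>carrier := T\<rparr>).
        regular_map (carrier (mult_torus n)) (mult_torus_regular n) T (GL_regular scale) \<theta> \<and>
        regular_map T (GL_regular scale) (carrier (mult_torus n)) (mult_torus_regular n)
          (inv_into (carrier (mult_torus n)) \<theta>))"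

definition torus ::
  "('f::field \<Rightarrow> 'v::ab_group_add \<Rightarrow> 'v) \<Rightarrow> ('v \<Rightarrow> 'v) set \<Rightarrow> bool" where
  "torus scale T \<longleftrightarrow> (\<exists>n. torus_of_dim scale n T)"

definition maximal_torus ::
  "('f::field \<Rightarrow> 'v::ab_group_add \<Rightarrow> 'v) \<Rightarrow> ('v \<Rightarrow> 'v) set \<Rightarrow> ('v \<Rightarrow> 'v) set \<Rightarrow> bool" where
  "maximal_torus scale H T \<longleftrightarrow>
     torus scale T \<and> T \<subseteq> H \<and> (\<forall>T'. torus scale T' \<and> T' \<subseteq> H \<and> T \<subseteq> T' \<longrightarrow> T' = T)"

text \<open>All maximal tori of an algebraic group \<open>H\<close> are conjugate, so the set below has exactly one
  element; \<open>Max\<close> merely selects it (algebraically closed field, finite dimension).\<close>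

definition max_torus_dim ::
  "('f::field \<Rightarrow> 'v::ab_group_add \<Rightarrow> 'v) \<Rightarrow> ('v \<Rightarrow> 'v) set \<Rightarrow> nat" where
  "max_torus_dim scale H = Max {n. \<exists>T. maximal_torus scale H T \<and> torus_of_dim scale n T}"


section \<open>Direct sum decompositions\<close>

definition direct_sum_decomposition ::
  "('f::field \<Rightarrow> 'v::ab_group_add \<Rightarrow> 'v) \<Rightarrow> 'v set set \<Rightarrow> bool" where
  "direct_sum_decomposition scale \<Gamma> \<longleftrightarrow>
     (\<forall>X\<in>\<Gamma>. module.subspace scale X) \<and>
     (\<forall>v. \<exists>!f. (\<forall>X\<in>\<Gamma>. f X \<in> X) \<and> (\<forall>X. X \<notin> \<Gamma> \<longrightarrow> f X = 0) \<and>
               finite {X. f X \<noteq> 0} \<and> v = (\<Sum>X | f X \<noteq> 0. f X))"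


section \<open>Algebras with multilinear operations and their gradings\<close>

text \<open>The operations are indexed by \<open>I\<close>; the operation \<open>opn i\<close> takes lists of length \<open>ar i\<close> as
  arguments and is unconstrained on other lists.  Arity \<open>0\<close> (a distinguished element) is allowed.\<close>

locale multilinear_algebra = vector_space scale
  for scale :: "'f::field \<Rightarrow> 'v::ab_group_add \<Rightarrow> 'v"
    and I :: "'i set"
    and ar :: "'i \<Rightarrow> nat"
    and opn :: "'i \<Rightarrow> 'v list \<Rightarrow> 'v" +
  assumes multilinear:
    "i \<in> I \<Longrightarrow> length xs + 1 + length ys = ar i \<Longrightarrow>
       Vector_Spaces.linear scale scale (\<lambda>x. opn i (xs @ x # ys))"
begin

text \<open>A grading is a set of subspaces, so the components themselves serve as the support.\<close>

definition grading :: "'v set set \<Rightarrow> bool" where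
  "grading \<Gamma> \<longleftrightarrow>
     direct_sum_decomposition scale \<Gamma> \<and> (\<forall>X\<in>\<Gamma>. X \<noteq> {0}) \<and>
     (\<forall>i\<in>I. \<forall>Xs. set Xs \<subseteq> \<Gamma> \<and> length Xs = ar i \<longrightarrow> (\<exists>X\<in>\<Gamma>. opn i ` listset Xs \<subseteq> X))"

definition univ_relations :: "'v set set \<Rightarrow> ('v set list \<times> 'v set list) set" where
  "univ_relations \<Gamma> =
     {(Xs, [X]) | Xs X. set Xs \<subseteq> \<Gamma> \<and> X \<in> \<Gamma> \<and>
        (\<exists>i\<in>I. length Xs = ar i \<and> \<not> opn i ` listset Xs \<subseteq> {0} \<and> opn i ` listset Xs \<subseteq> X)}"

definition univ_group :: "'v set set \<Rightarrow> 'v set word set monoid" where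
  "univ_group \<Gamma> = presented_group \<Gamma> (univ_relations \<Gamma>)"

definition univ_map :: "'v set set \<Rightarrow> 'v set \<Rightarrow> 'v set word set" where
  "univ_map \<Gamma> X = word_class \<Gamma> (univ_relations \<Gamma>) (pos_word [X])"

definition univ_ab_group :: "'v set set \<Rightarrow> 'v set word set set monoid" where
  "univ_ab_group \<Gamma> = abelianization (univ_group \<Gamma>)"

definition univ_ab_map :: "'v set set \<Rightarrow> 'v set \<Rightarrow> 'v set word set set" where
  "univ_ab_map \<Gamma> X =
     derived (univ_group \<Gamma>) (carrier (univ_group \<Gamma>)) #>\<^bsub>univ_group \<Gamma>\<^esub> univ_map \<Gamma> X"

definition group_grading :: "'v set set \<Rightarrow> bool" where
  "group_grading \<Gamma> \<longleftrightarrow> grading \<Gamma> \<and> inj_on (univ_map \<Gamma>) \<Gamma>"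

definition abelian_group_grading :: "'v set set \<Rightarrow> bool" where
  "abelian_group_grading \<Gamma> \<longleftrightarrow> grading \<Gamma> \<and> inj_on (univ_ab_map \<Gamma>) \<Gamma>"

definition refinement :: "'v set set \<Rightarrow> 'v set set \<Rightarrow> bool" where
  "refinement \<Delta> \<Gamma> \<longleftrightarrow> grading \<Delta> \<and> grading \<Gamma> \<and> (\<forall>X\<in>\<Delta>. \<exists>Y\<in>\<Gamma>. X \<subseteq> Y)"

definition coarsening :: "'v set set \<Rightarrow> 'v set set \<Rightarrow> bool" where
  "coarsening \<Gamma> \<Delta> \<longleftrightarrow> refinement \<Delta> \<Gamma>"

definition proper_refinement :: "'v set set \<Rightarrow> 'v set set \<Rightarrow> bool" where
  "proper_refinement \<Delta> \<Gamma> \<longleftrightarrow> refinement \<Delta> \<Gamma> \<and> (\<exists>X\<in>\<Delta>. \<exists>Y\<in>\<Gamma>. X \<subset> Y)"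

definition fine_group_grading :: "'v set set \<Rightarrow> bool" where
  "fine_group_grading \<Gamma> \<longleftrightarrow>
     group_grading \<Gamma> \<and> \<not> (\<exists>\<Delta>. group_grading \<Delta> \<and> proper_refinement \<Delta> \<Gamma>)"

definition fine_abelian_group_grading :: "'v set set \<Rightarrow> bool" where
  "fine_abelian_group_grading \<Gamma> \<longleftrightarrow>
     abelian_group_grading \<Gamma> \<and> \<not> (\<exists>\<Delta>. abelian_group_grading \<Delta> \<and> proper_refinement \<Delta> \<Gamma>)"

definition is_quotient_map ::
  "'v set set \<Rightarrow> 'v set set \<Rightarrow> ('v set word set set \<Rightarrow> 'v set word set set) \<Rightarrow> bool" where
  "is_quotient_map \<Delta> \<Gamma> h \<longleftrightarrow>
     h \<in> hom (univ_ab_group \<Delta>) (univ_ab_group \<Gamma>) \<and>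
     (\<forall>X\<in>\<Delta>. \<forall>Y\<in>\<Gamma>. X \<subseteq> Y \<longrightarrow> h (univ_ab_map \<Delta> X) = univ_ab_map \<Gamma> Y)"

text \<open>On the carrier of \<open>univ_ab_group \<Delta>\<close>, which is generated by the image of \<open>univ_ab_map \<Delta>\<close>, the
  chosen homomorphism is determined by \<open>is_quotient_map\<close>.  Existence is
  \<open>is_quotient_map_quotient_map\<close> below.\<close>

definition quotient_map ::
  "'v set set \<Rightarrow> 'v set set \<Rightarrow> 'v set word set set \<Rightarrow> 'v set word set set" where
  "quotient_map \<Delta> \<Gamma> = (SOME h. is_quotient_map \<Delta> \<Gamma> h)"

lemma direct_sum_component_unique:
  assumes dec: "direct_sum_decomposition scale \<Gamma>"
    and mem: "Y \<in> \<Gamma>" "Z \<in> \<Gamma>" "v \<in> Y" "v \<in> Z" "v \<noteq> 0"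
  shows "Y = Z"
proof (rule ccontr)
  assume ne: "Y \<noteq> Z"
  let ?f = "\<lambda>W X. if X = W then v else 0"
  let ?P = "\<lambda>f. (\<forall>X\<in>\<Gamma>. f X \<in> X) \<and> (\<forall>X. X \<notin> \<Gamma> \<longrightarrow> f X = 0) \<and>
    finite {X. f X \<noteq> 0} \<and> v = (\<Sum>X | f X \<noteq> 0. f X)"
  have z: "0 \<in> X" if "X \<in> \<Gamma>" for X
    using dec that subspace_0 unfolding direct_sum_decomposition_def by blast
  have P: "?P (?f W)" if "W \<in> \<Gamma>" "v \<in> W" for W
    using that mem(5) z by auto
  have ex1: "\<exists>!f. ?P f"
    using dec unfolding direct_sum_decomposition_def by blast
  have "?f Y = ?f Z"
    by (rule trans[OF sym[OF the1_equality[of ?P, OF ex1 P[OF mem(1,3)]]]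
               the1_equality[of ?P, OF ex1 P[OF mem(2,4)]]])
  then have "?f Y Y = ?f Z Y" by (rule fun_cong)
  then show False using ne mem(5) by simp
qed

lemma refinement_relation:
  assumes ref: "refinement \<Delta> \<Gamma>"
    and p: "\<And>X. X \<in> \<Delta> \<Longrightarrow> p X \<in> \<Gamma> \<and> X \<subseteq> p X"
    and rel: "(Xs, Ys) \<in> univ_relations \<Delta>"
  shows "(map p Xs, map p Ys) \<in> univ_relations \<Gamma>"
proof -
  obtain X i where X: "Ys = [X]" "set Xs \<subseteq> \<Delta>" "X \<in> \<Delta>" "i \<in> I" "length Xs = ar i"
    "\<not> opn i ` listset Xs \<subseteq> {0}" "opn i ` listset Xs \<subseteq> X"
    using rel by (auto simp: univ_relations_def)
  have "listset Xs \<subseteq> listset (map p Xs)"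
    using X(2)
  proof (induction Xs)
    case (Cons Y Ys)
    then have "Y \<subseteq> p Y" "listset Ys \<subseteq> listset (map p Ys)"
      using p by auto
    then show ?case by (auto simp: set_Cons_def)
  qed simp
  then have sub: "opn i ` listset Xs \<subseteq> opn i ` listset (map p Xs)" by blast
  have dec: "direct_sum_decomposition scale \<Gamma>"
    using ref by (simp add: refinement_def grading_def)
  obtain Z where Z: "Z \<in> \<Gamma>" "opn i ` listset (map p Xs) \<subseteq> Z"
  proof -
    have "grading \<Gamma>" using ref by (simp add: refinement_def)
    moreover have "set (map p Xs) \<subseteq> \<Gamma>" using X(2) p by auto
    ultimately show thesis
      using that X(4,5) unfolding grading_def by (metis length_map)
  qed
  obtain v where v: "v \<in> opn i ` listset Xs" "v \<noteq> 0" using X(6) by blast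
  have "v \<in> Z" "v \<in> p X" using v sub Z X(3,7) p by blast+
  have "Z = p X"
    using direct_sum_component_unique[OF dec] Z(1) X(3) p v(2) \<open>v \<in> Z\<close> \<open>v \<in> p X\<close> by blast
  moreover have "set (map p Xs) \<subseteq> \<Gamma>" using X(2) p by auto
  moreover have "length (map p Xs) = ar i" using X(5) by simp
  moreover have "\<not> opn i ` listset (map p Xs) \<subseteq> {0}" using sub X(6) by blast
  ultimately have "\<exists>j\<in>I. length (map p Xs) = ar j \<and> \<not> opn j ` listset (map p Xs) \<subseteq> {0} \<and>
      opn j ` listset (map p Xs) \<subseteq> p X" "set (map p Xs) \<subseteq> \<Gamma>" "p X \<in> \<Gamma>"
    using X(4) Z by metis+
  then show ?thesis
    unfolding univ_relations_def X(1) list.map by blast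
qed

lemma ex_is_quotient_map:
  assumes "refinement \<Delta> \<Gamma>"
  shows "\<exists>h. is_quotient_map \<Delta> \<Gamma> h"
proof -
  let ?G = "univ_group \<Gamma>" and ?D = "univ_group \<Delta>"
  have grp: "group (univ_group E)" for E
    by (simp add: univ_group_def group_presented_group)
  interpret G: group ?G by (rule grp)
  interpret N: normal "derived ?G (carrier ?G)" ?G
    by (rule G.derived_self_is_normal)
  interpret A: comm_group "univ_ab_group \<Gamma>"
    unfolding univ_ab_group_def abelianization_def by (rule G.derived_quot_is_comm_group)
  define p where "p X = (SOME Y. Y \<in> \<Gamma> \<and> X \<subseteq> Y)" for X
  have p: "p X \<in> \<Gamma> \<and> X \<subseteq> p X" if "X \<in> \<Delta>" for X
    using assms that unfolding p_def refinement_def by (metis (mono_tags, lifting) someI_ex)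
  have carr: "univ_map E X \<in> carrier (univ_group E)" if "X \<in> E" for E X
    using that by (auto simp: univ_map_def univ_group_def presented_group_def)
  have mem_pos: "pos_word (map p l) \<in> lists (UNIV \<times> \<Gamma>)" if "set l \<subseteq> \<Delta>" for l
  proof -
    have "p x \<in> \<Gamma>" if "x \<in> set l" for x using that \<open>set l \<subseteq> \<Delta>\<close> p by blast
    then show ?thesis by auto
  qed
  have word: "foldr (\<lambda>x y. univ_map \<Gamma> (p x) \<otimes>\<^bsub>?G\<^esub> y) l \<one>\<^bsub>?G\<^esub> =
      word_class \<Gamma> (univ_relations \<Gamma>) (pos_word (map p l))" if "set l \<subseteq> \<Delta>" for l
    using that
  proof (induction l)
    case Nil
    then show ?case by (simp add: univ_group_def presented_group_def)
  next
    case (Cons x l)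
    have "[(True, p x)] \<in> lists (UNIV \<times> \<Gamma>)" "pos_word (map p l) \<in> lists (UNIV \<times> \<Gamma>)"
      using Cons.prems p[of x] mem_pos[of l] by simp_all
    from presented_group_mult[OF this] Cons show ?case
      by (simp add: univ_map_def univ_group_def)
  qed
  obtain h where h: "h \<in> hom ?D ?G"
    "\<And>X. X \<in> \<Delta> \<Longrightarrow> h (word_class \<Delta> (univ_relations \<Delta>) (pos_word [X])) = univ_map \<Gamma> (p X)"
  proof (rule presented_group_universal[OF grp[of \<Gamma>], of "\<lambda>X. univ_map \<Gamma> (p X)" \<Delta> "univ_relations \<Delta>"])
    show "(\<lambda>X. univ_map \<Gamma> (p X)) ` \<Delta> \<subseteq> carrier ?G"
      using carr p by blast
    show "foldr (\<lambda>x y. univ_map \<Gamma> (p x) \<otimes>\<^bsub>?G\<^esub> y) l \<one>\<^bsub>?G\<^esub> =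
        foldr (\<lambda>x y. univ_map \<Gamma> (p x) \<otimes>\<^bsub>?G\<^esub> y) r \<one>\<^bsub>?G\<^esub>"
      if lr: "(l, r) \<in> univ_relations \<Delta>" "set l \<subseteq> \<Delta>" "set r \<subseteq> \<Delta>" for l r
    proof -
      have "set (map p l) \<subseteq> \<Gamma>" "set (map p r) \<subseteq> \<Gamma>" using lr p by auto
      then have "word_eq \<Gamma> (univ_relations \<Gamma>) (pos_word (map p l)) (pos_word (map p r))"
        using refinement_relation[OF assms p lr(1)] by (intro word_eq.word_relator)
      then show ?thesis
        using word[OF lr(2)] word[OF lr(3)] word_class_eq_iff[OF mem_pos[OF lr(2)]] by metis
    qed
  qed (use that in \<open>simp add: univ_group_def\<close>)
  have "(\<lambda>x. derived ?G (carrier ?G) #>\<^bsub>?G\<^esub> x) \<in> hom ?G (univ_ab_group \<Gamma>)"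
    unfolding univ_ab_group_def abelianization_def by (rule N.r_coset_hom_Mod)
  then have "(\<lambda>x. derived ?G (carrier ?G) #>\<^bsub>?G\<^esub> x) \<circ> h \<in> hom ?D (univ_ab_group \<Gamma>)"
    using h(1) by (rule hom_compose[rotated])
  then obtain g where g: "g \<in> hom (abelianization ?D) (univ_ab_group \<Gamma>)"
    "\<And>x. x \<in> carrier ?D \<Longrightarrow> g (derived ?D (carrier ?D) #>\<^bsub>?D\<^esub> x) =
      ((\<lambda>x. derived ?G (carrier ?G) #>\<^bsub>?G\<^esub> x) \<circ> h) x"
    using abelianization_universal[OF grp A.comm_group_axioms] by blast
  have gp: "g (univ_ab_map \<Delta> X) = univ_ab_map \<Gamma> (p X)" if "X \<in> \<Delta>" for X
    using that g(2)[OF carr[OF that]] h(2)[OF that] by (simp add: univ_ab_map_def univ_map_def)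
  have "p X = Y" if "X \<in> \<Delta>" "Y \<in> \<Gamma>" "X \<subseteq> Y" for X Y
  proof -
    have gr: "direct_sum_decomposition scale \<Gamma>" "grading \<Delta>"
      using assms by (auto simp: refinement_def grading_def)
    then have "subspace X" "X \<noteq> {0}"
      using that(1) by (auto simp: grading_def direct_sum_decomposition_def)
    then have "0 \<in> X" "X \<noteq> {0}"
      using subspace_0 by auto
    then obtain v where "v \<in> X" "v \<noteq> 0" by blast
    then show ?thesis
      using direct_sum_component_unique[OF gr(1)] p that by blast
  qed
  then have "is_quotient_map \<Delta> \<Gamma> g"
    using g(1) gp unfolding is_quotient_map_def univ_ab_group_def by blast
  then show ?thesis by blast
qed

lemma is_quotient_map_quotient_map:
  "refinement \<Delta> \<Gamma> \<Longrightarrow> is_quotient_map \<Delta> \<Gamma> (quotient_map \<Delta> \<Gamma>)"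
  unfolding quotient_map_def by (rule someI_ex[OF ex_is_quotient_map])

definition Aut :: "('v \<Rightarrow> 'v) set" where
  "Aut = {g \<in> carrier (GL scale). \<forall>i\<in>I. \<forall>xs. length xs = ar i \<longrightarrow> g (opn i xs) = opn i (map g xs)}"

definition Stab :: "'v set set \<Rightarrow> ('v \<Rightarrow> 'v) set" where
  "Stab \<Gamma> = {g \<in> Aut. \<forall>X\<in>\<Gamma>. g ` X = X}"

definition tor_rank :: "'v set set \<Rightarrow> nat" where
  "tor_rank \<Gamma> = max_torus_dim scale (Stab \<Gamma>)"

definition almost_fine :: "'v set set \<Rightarrow> bool" where
  "almost_fine \<Gamma> \<longleftrightarrow> free_rank (univ_ab_group \<Gamma>) = tor_rank \<Gamma>"

end

end

theory Submission
  imports Defs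
begin

text \<open>Write \<open>r\<close> for the free rank of the abelian universal group and \<open>t\<close> for the toral rank of the
  stabilizer. The proof is the chain \<open>r \<Gamma> \<le> r \<Delta> = t \<Delta> \<le> t \<Gamma>\<close>: by definition \<open>\<Gamma>\<close> is almost fine
  when its two ends agree, that is, when both inequalities are equalities.

  The first inequality holds because the quotient map is surjective. It is an equality exactly when
  the kernel consists of torsion elements, and the torsion of a finitely generated abelian group is
  finite (\<open>free_rank_surjective_hom\<close>). The last inequality holds because an automorphism that
  stabilizes the components of \<open>\<Delta>\<close> stabilizes those of the coarsening \<open>\<Gamma>\<close>
  (\<open>Stab_mono_refinement\<close>), and every torus in a stabilizer lies in a maximal one
  (\<open>tor_rank_ge\<close>).

  The equality in the middle says that fine gradings are almost fine (\<open>fine_tor_rank\<close>). Coordinates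
  modulo torsion on the abelian universal group attach to every component of \<open>\<Delta>\<close> an integer vector
  \<open>a\<close> of length \<open>r = r \<Delta>\<close>. The \<open>r\<close>-fold power of the multiplicative group acts on that component
  by the monomial with exponent \<open>a\<close>, and this is a torus \<open>D\<close> of dimension \<open>r\<close> in the stabilizer
  (\<open>torus_diag_torus\<close>, \<open>ex_diagonal_torus\<close>). Conversely let \<open>T\<close> be a torus in the stabilizer.
  Intersecting the components of \<open>\<Delta>\<close> with the weight spaces of \<open>T\<close> gives a refinement. It is again
  a group grading (respectively, an abelian group grading), since its components are told apart by
  their degrees in the universal group of \<open>\<Delta>\<close> together with the characters of \<open>T\<close>. As \<open>\<Delta>\<close> is
  fine, the refinement is not proper, so \<open>T\<close> acts by scalars on every component
  (\<open>fine_imp_scalar\<close>). These scalars define a homomorphism on the abelian universal group which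
  kills its torsion because \<open>T\<close> is divisible, and this forces \<open>T \<subseteq> D\<close>. Hence \<open>D\<close> is the only
  maximal torus.

  Dimension and diagonalizability of tori are read off from their points of finite order prime to the
  characteristic. Their number determines the dimension (\<open>card_torus_torsion\<close>). They are Zariski dense
  (\<open>torus_torsion_dense\<close>), so nested tori of equal dimension coincide. They are commuting operators
  of finite order, hence simultaneously diagonalizable, and by density so is the torus
  (\<open>torus_eigenvectors_span\<close>). This bounds the dimension of a torus by that of the space.\<close>

section \<open>Bases of abelian groups modulo torsion\<close>

context comm_group
begin

definition int_comb :: "('k \<Rightarrow> int) \<Rightarrow> ('k \<Rightarrow> 'a) \<Rightarrow> 'k set \<Rightarrow> 'a" where
  "int_comb c x K = (\<Otimes>k\<in>K. x k [^] c k)"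

definition torsion :: "'a set" where
  "torsion = {u \<in> carrier G. \<exists>N::int. N \<noteq> 0 \<and> u [^] N = \<one>}"

definition spans_mod_torsion :: "('k \<Rightarrow> 'a) \<Rightarrow> 'k set \<Rightarrow> bool" where
  "spans_mod_torsion x K \<longleftrightarrow> finite K \<and> x ` K \<subseteq> carrier G \<and>
     (\<forall>u\<in>carrier G. \<exists>c. u \<otimes> inv (int_comb c x K) \<in> torsion)"

definition independent_family :: "('k \<Rightarrow> 'a) \<Rightarrow> 'k set \<Rightarrow> bool" where
  "independent_family x K \<longleftrightarrow> finite K \<and> x ` K \<subseteq> carrier G \<and>
     (\<forall>c. int_comb c x K = \<one> \<longrightarrow> (\<forall>k\<in>K. c k = 0))"

definition fin_gen :: bool where
  "fin_gen \<longleftrightarrow> (\<exists>S. finite S \<and> S \<subseteq> carrier G \<and> (\<forall>u\<in>carrier G. \<exists>c. u = int_comb c (\<lambda>s. s) S))"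

lemma int_comb_closed [simp, intro]: "x ` K \<subseteq> carrier G \<Longrightarrow> int_comb c x K \<in> carrier G"
  unfolding int_comb_def by (rule finprod_closed) auto

lemma int_comb_cong:
  assumes "x ` K \<subseteq> carrier G" "\<And>k. k \<in> K \<Longrightarrow> c k = d k" "\<And>k. k \<in> K \<Longrightarrow> x k = y k"
  shows "int_comb c x K = int_comb d y K"
  unfolding int_comb_def using assms by (intro finprod_cong') (auto simp: image_subset_iff)

lemma int_comb_insert [simp]:
  assumes "finite K" "k \<notin> K" "x k \<in> carrier G" "x ` K \<subseteq> carrier G"
  shows "int_comb c x (insert k K) = x k [^] c k \<otimes> int_comb c x K"
  unfolding int_comb_def using assms by (subst finprod_insert) auto

lemma int_comb_empty [simp]: "int_comb c x {} = \<one>"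
  by (simp add: int_comb_def)

lemma int_comb_remove:
  assumes "finite K" "k \<in> K" "x ` K \<subseteq> carrier G"
  shows "int_comb c x K = x k [^] c k \<otimes> int_comb c x (K - {k})"
  using int_comb_insert[of "K - {k}" k x c] assms by (auto simp: insert_absorb)

lemma int_comb_add:
  assumes "x ` K \<subseteq> carrier G"
  shows "int_comb (\<lambda>k. c k + d k) x K = int_comb c x K \<otimes> int_comb d x K"
proof -
  have "int_comb (\<lambda>k. c k + d k) x K = (\<Otimes>k\<in>K. x k [^] c k \<otimes> x k [^] d k)"
    unfolding int_comb_def using assms by (intro finprod_cong') (auto simp: int_pow_mult image_subset_iff)
  then show ?thesis
    unfolding int_comb_def using assms by (subst (asm) finprod_multf) auto
qed

lemma int_comb_zero:
  assumes "\<And>k. k \<in> K \<Longrightarrow> c k = 0"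
  shows "int_comb c x K = \<one>"
  unfolding int_comb_def using assms by (simp add: finprod_one_eqI)

lemma int_comb_scale:
  assumes "x ` K \<subseteq> carrier G"
  shows "int_comb (\<lambda>k. m * c k) x K = int_comb c x K [^] m"
proof (cases "finite K")
  case True
  then show ?thesis using assms
  proof (induction K)
    case (insert k K)
    then have "x k \<in> carrier G" "x ` K \<subseteq> carrier G" by auto
    with insert show ?case
      by (simp add: int_pow_distrib int_pow_pow mult.commute)
  qed simp
qed (simp add: int_comb_def)

lemma int_comb_minus:
  assumes "x ` K \<subseteq> carrier G"
  shows "int_comb (\<lambda>k. - c k) x K = inv (int_comb c x K)"
  using int_comb_scale[OF assms, of "-1" c] assms
  by (simp add: int_pow_neg)

lemma int_comb_diff:
  assumes "x ` K \<subseteq> carrier G"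
  shows "int_comb (\<lambda>k. c k - d k) x K = int_comb c x K \<otimes> inv (int_comb d x K)"
  using int_comb_add[OF assms, of c "\<lambda>k. - d k"] int_comb_minus[OF assms] by simp

lemma int_comb_mult:
  assumes "x ` K \<subseteq> carrier G" "y ` K \<subseteq> carrier G"
  shows "int_comb c (\<lambda>k. x k \<otimes> y k) K = int_comb c x K \<otimes> int_comb c y K"
proof -
  have "int_comb c (\<lambda>k. x k \<otimes> y k) K = (\<Otimes>k\<in>K. x k [^] c k \<otimes> y k [^] c k)"
    unfolding int_comb_def using assms
    by (intro finprod_cong') (auto simp: int_pow_distrib image_subset_iff)
  then show ?thesis
    unfolding int_comb_def using assms by (subst (asm) finprod_multf) auto
qed

lemma int_comb_sum:
  assumes "finite J" "x ` K \<subseteq> carrier G"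
  shows "int_comb (\<lambda>k. \<Sum>j\<in>J. c j * a j k) x K = int_comb c (\<lambda>j. int_comb (a j) x K) J"
  using assms(1)
proof (induction J)
  case empty
  show ?case by (simp add: int_comb_zero)
next
  case (insert j J)
  have "(\<lambda>j. int_comb (a j) x K) ` J \<subseteq> carrier G" using assms(2) by auto
  with insert assms(2) show ?case
    by (simp add: int_comb_add int_comb_scale)
qed

lemma int_comb_delta:
  assumes "finite K" "k \<in> K" "x ` K \<subseteq> carrier G"
  shows "int_comb (\<lambda>j. if j = k then m else 0) x K = x k [^] m"
proof -
  have "int_comb (\<lambda>j. if j = k then m else 0) x (K - {k}) = \<one>"
    by (rule int_comb_zero) auto
  then show ?thesis using assms by (subst int_comb_remove[of K k]) auto
qed

lemma int_comb_reindex: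
  assumes "inj_on f K" "x ` f ` K \<subseteq> carrier G"
  shows "int_comb c x (f ` K) = int_comb (c \<circ> f) (x \<circ> f) K"
  unfolding int_comb_def using assms by (subst finprod_reindex) auto

lemma torsionI: "u \<in> carrier G \<Longrightarrow> N \<noteq> 0 \<Longrightarrow> u [^] (N::int) = \<one> \<Longrightarrow> u \<in> torsion"
  unfolding torsion_def by blast

lemma torsion_carrier: "u \<in> torsion \<Longrightarrow> u \<in> carrier G"
  by (simp add: torsion_def)

lemma torsion_one [simp]: "\<one> \<in> torsion"
  by (rule torsionI[of _ 1]) auto

lemma torsion_mult:
  assumes "u \<in> torsion" "v \<in> torsion"
  shows "u \<otimes> v \<in> torsion"
proof -
  obtain M N :: int where "M \<noteq> 0" "u [^] M = \<one>" "N \<noteq> 0" "v [^] N = \<one>"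
    using assms by (auto simp: torsion_def)
  moreover have uv: "u \<in> carrier G" "v \<in> carrier G" using assms by (auto simp: torsion_carrier)
  moreover have "(u \<otimes> v) [^] (M * N) = (u [^] M) [^] N \<otimes> (v [^] N) [^] M"
    using uv by (simp add: int_pow_distrib int_pow_pow mult.commute)
  ultimately show ?thesis by (intro torsionI[of _ "M * N"]) auto
qed

lemma torsion_int_pow:
  assumes "u \<in> torsion"
  shows "u [^] (m::int) \<in> torsion"
proof -
  obtain N :: int where "N \<noteq> 0" "u [^] N = \<one>"
    using assms by (auto simp: torsion_def)
  moreover have u: "u \<in> carrier G" using assms by (auto simp: torsion_carrier)
  moreover have "(u [^] m) [^] N = (u [^] N) [^] m"
    using u by (simp add: int_pow_pow mult.commute)
  ultimately show ?thesis by (intro torsionI[of _ N]) auto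
qed

lemma torsion_inv: "u \<in> torsion \<Longrightarrow> inv u \<in> torsion"
  using torsion_int_pow[of u "-1"] by (simp add: int_pow_neg torsion_carrier)

lemma torsion_root:
  assumes "u \<in> carrier G" "u [^] (m::int) \<in> torsion" "m \<noteq> 0"
  shows "u \<in> torsion"
proof -
  obtain N :: int where "N \<noteq> 0" "(u [^] m) [^] N = \<one>"
    using assms by (auto simp: torsion_def)
  with assms show ?thesis by (intro torsionI[of _ "m * N"]) (auto simp: int_pow_pow)
qed

lemma torsion_int_comb:
  assumes "x ` K \<subseteq> torsion"
  shows "int_comb c x K \<in> torsion"
proof (cases "finite K")
  case True
  then show ?thesis using assms
  proof (induction K)
    case (insert k K)
    then have "x k \<in> torsion" "x ` K \<subseteq> torsion" by auto
    moreover from this have "x k \<in> carrier G" "x ` K \<subseteq> carrier G" using torsion_carrier by auto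
    ultimately show ?case
      using insert by (simp add: torsion_mult torsion_int_pow)
  qed simp
qed (simp add: int_comb_def)

text \<open>Independence forbids relations modulo torsion as well: a multiple of such a relation is a
  relation.\<close>

lemma independent_family_torsion:
  assumes "independent_family x K" "int_comb c x K \<in> torsion" "k \<in> K"
  shows "c k = 0"
proof -
  obtain N :: int where N: "N \<noteq> 0" "int_comb c x K [^] N = \<one>"
    using assms by (auto simp: torsion_def)
  moreover have "x ` K \<subseteq> carrier G" using assms by (simp add: independent_family_def)
  ultimately have "int_comb (\<lambda>k. N * c k) x K = \<one>" by (simp add: int_comb_scale)
  then have "N * c k = 0" using assms unfolding independent_family_def by blast
  then show ?thesis using N by simp
qed

text \<open>An elementary move (a column operation): multiplying \<open>x j\<close> by a power of \<open>x i\<close> changes the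
  coefficient of \<open>x i\<close> only.\<close>

lemma int_comb_elementary_move:
  assumes "finite K" "i \<in> K" "j \<in> K" "i \<noteq> j" "x ` K \<subseteq> carrier G"
  shows "int_comb (c(i := c i - e * c j)) (x(j := x j \<otimes> x i [^] e)) K = int_comb c x K"
proof -
  let ?L = "K - {i} - {j}"
  have x: "x i \<in> carrier G" "x j \<in> carrier G" "x ` ?L \<subseteq> carrier G" using assms by auto
  let ?x = "x(j := x j \<otimes> x i [^] e)"
  have x': "?x ` K \<subseteq> carrier G" using assms by auto
  have L: "int_comb (c(i := c i - e * c j)) ?x ?L = int_comb c x ?L"
    using x by (intro int_comb_cong) auto
  have "int_comb (c(i := c i - e * c j)) ?x K =
      ?x i [^] (c i - e * c j) \<otimes> (?x j [^] c j \<otimes> int_comb (c(i := c i - e * c j)) ?x ?L)"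
    using assms x'
    by (subst int_comb_remove[of K i], simp, simp, simp, subst int_comb_remove[of "K - {i}" j]) auto
  also have "\<dots> = x i [^] (c i - e * c j) \<otimes> ((x j [^] c j \<otimes> x i [^] (e * c j)) \<otimes> int_comb c x ?L)"
    using assms(4) x unfolding L by (simp add: int_pow_distrib int_pow_pow)
  also have "\<dots> = (x i [^] (c i - e * c j) \<otimes> x i [^] (e * c j)) \<otimes> (x j [^] c j \<otimes> int_comb c x ?L)"
    using x by (simp add: m_ac)
  also have "x i [^] (c i - e * c j) \<otimes> x i [^] (e * c j) = x i [^] c i"
    using x by (simp flip: int_pow_mult)
  also have "x i [^] c i \<otimes> (x j [^] c j \<otimes> int_comb c x ?L) = int_comb c x K"
    using assms
    by (subst int_comb_remove[of K i], simp, simp, simp, subst int_comb_remove[of "K - {i}" j]) auto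
  finally show ?thesis .
qed

lemma spans_mod_torsion_remove:
  assumes "spans_mod_torsion x K" "i \<in> K" "x i \<in> torsion"
  shows "spans_mod_torsion x (K - {i})"
proof -
  have K: "finite K" "x ` K \<subseteq> carrier G" using assms by (auto simp: spans_mod_torsion_def)
  have "\<exists>c. u \<otimes> inv (int_comb c x (K - {i})) \<in> torsion" if "u \<in> carrier G" for u
  proof -
    obtain c where c: "u \<otimes> inv (int_comb c x K) \<in> torsion"
      using assms \<open>u \<in> carrier G\<close> unfolding spans_mod_torsion_def by blast
    let ?w = "int_comb c x (K - {i})"
    have cl: "x i \<in> carrier G" "?w \<in> carrier G" using assms K by auto
    have "u \<otimes> inv (int_comb c x K) \<otimes> x i [^] c i = u \<otimes> inv (x i [^] c i \<otimes> ?w) \<otimes> x i [^] c i"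
      using int_comb_remove[of K i x c] assms(2) K by simp
    also have "\<dots> = u \<otimes> inv ?w \<otimes> (inv (x i [^] c i) \<otimes> x i [^] c i)"
      using cl \<open>u \<in> carrier G\<close> by (simp add: inv_mult_group m_assoc)
    finally have "u \<otimes> inv ?w = (u \<otimes> inv (int_comb c x K)) \<otimes> x i [^] c i"
      using cl \<open>u \<in> carrier G\<close> by simp
    then show ?thesis using c assms(3) torsion_mult torsion_int_pow by metis
  qed
  then show ?thesis using K by (auto simp: spans_mod_torsion_def)
qed

text \<open>Descent on the sum of the absolute values of the coefficients of a relation modulo torsion. If two
  coefficients are nonzero, an elementary move lowers the sum, as in the Euclidean algorithm. If only
  one is nonzero, its generator is torsion and can be dropped, against minimality.\<close>

lemma minimal_spanning_family_independent:
  fixes x :: "'k \<Rightarrow> 'a"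
  assumes "spans_mod_torsion x K"
    and "\<And>(y::'k \<Rightarrow> 'a) L. spans_mod_torsion y L \<Longrightarrow> card K \<le> card L"
    and "int_comb c x K \<in> torsion"
  shows "\<forall>k\<in>K. c k = 0"
  using assms(1,3)
proof (induction "\<Sum>k\<in>K. nat \<bar>c k\<bar>" arbitrary: x c rule: less_induct)
  case less
  have K: "finite K" "x ` K \<subseteq> carrier G" using less.prems by (auto simp: spans_mod_torsion_def)
  show ?case
  proof (rule ccontr)
    assume "\<not> (\<forall>k\<in>K. c k = 0)"
    then obtain j where j: "j \<in> K" "c j \<noteq> 0" by blast
    show False
    proof (cases "\<exists>i\<in>K. i \<noteq> j \<and> c i \<noteq> 0")
      case True
      then obtain i' where i': "i' \<in> K" "i' \<noteq> j" "c i' \<noteq> 0" by blast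
      obtain i j where ij: "i \<in> K" "j \<in> K" "i \<noteq> j" "c j \<noteq> 0" "\<bar>c j\<bar> \<le> \<bar>c i\<bar>"
      proof (cases "\<bar>c j\<bar> \<le> \<bar>c i'\<bar>")
        case True
        then show ?thesis using that[of i' j] i' j by auto
      next
        case False
        then show ?thesis using that[of j i'] i' j by auto
      qed
      \<comment> \<open>This sign makes \<open>c i - e * c j\<close> smaller than \<open>c i\<close> in absolute value.\<close>
      define e where "e = sgn (c i) * sgn (c j)"
      let ?x = "x(j := x j \<otimes> x i [^] e)" and ?c = "\<lambda>c::'k \<Rightarrow> int. c(i := c i - e * c j)"
      have move: "int_comb (?c d) ?x K = int_comb d x K" for d
        using ij K by (intro int_comb_elementary_move) auto
      have "?x ` K \<subseteq> carrier G" using K ij by auto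
      moreover have "\<exists>d. u \<otimes> inv (int_comb d ?x K) \<in> torsion" if "u \<in> carrier G" for u
        using less.prems(1) that move unfolding spans_mod_torsion_def by metis
      ultimately have "spans_mod_torsion ?x K" using K by (auto simp: spans_mod_torsion_def)
      moreover have "int_comb (?c c) ?x K \<in> torsion" using less.prems(2) move by simp
      moreover have "(\<Sum>k\<in>K. nat \<bar>?c c k\<bar>) < (\<Sum>k\<in>K. nat \<bar>c k\<bar>)"
      proof (rule sum_strict_mono_ex1)
        have "\<bar>c i - e * c j\<bar> < \<bar>c i\<bar>"
          using ij(4,5) unfolding e_def by (auto simp: sgn_if split: if_splits)
        then show "\<forall>k\<in>K. nat \<bar>?c c k\<bar> \<le> nat \<bar>c k\<bar>" "\<exists>k\<in>K. nat \<bar>?c c k\<bar> < nat \<bar>c k\<bar>"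
          using ij(1) by auto
      qed (rule K)
      ultimately have "\<forall>k\<in>K. ?c c k = 0" using less.hyps by blast
      then show False using ij by auto
    next
      case False
      have "int_comb c x K = int_comb (\<lambda>k. if k = j then c j else 0) x K"
        using False K by (intro int_comb_cong) auto
      then have "x j [^] c j \<in> torsion" using less.prems(2) int_comb_delta[of K j x "c j"] K j by simp
      then have "x j \<in> torsion" using torsion_root[of "x j" "c j"] j K by auto
      then have "spans_mod_torsion x (K - {j})" using less.prems(1) j by (intro spans_mod_torsion_remove)
      then have "card K \<le> card (K - {j})" by (rule assms(2))
      then show False using K j card_Diff1_less[of K j] by simp
    qed
  qed
qed

theorem ex_basis_mod_torsion:
  assumes "fin_gen"
  obtains r and x :: "nat \<Rightarrow> 'a" where "spans_mod_torsion x {..<r}" "independent_family x {..<r}"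
proof -
  obtain S where S: "finite S" "S \<subseteq> carrier G" "\<And>u. u \<in> carrier G \<Longrightarrow> \<exists>c. u = int_comb c (\<lambda>s. s) S"
    using assms unfolding fin_gen_def by blast
  have ex: "\<exists>n K. (\<exists>x :: 'a \<Rightarrow> 'a. spans_mod_torsion x K) \<and> card K = n"
  proof -
    have "\<exists>c. u \<otimes> inv (int_comb c (\<lambda>s. s) S) \<in> torsion" if u: "u \<in> carrier G" for u
    proof -
      obtain c where "u = int_comb c (\<lambda>s. s) S" using S(3) u by blast
      then have "u \<otimes> inv (int_comb c (\<lambda>s. s) S) = \<one>" using r_inv[OF u] by metis
      then show ?thesis using torsion_one by metis
    qed
    then have "spans_mod_torsion (\<lambda>s. s) S" using S by (auto simp: spans_mod_torsion_def)
    then show ?thesis by blast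
  qed
  define n where "n = (LEAST n. \<exists>K. (\<exists>x :: 'a \<Rightarrow> 'a. spans_mod_torsion x K) \<and> card K = n)"
  obtain K and x :: "'a \<Rightarrow> 'a" where K: "spans_mod_torsion x K" "card K = n"
    using LeastI_ex[OF ex] unfolding n_def by blast
  have min: "card K \<le> card L" if "spans_mod_torsion y L" for y :: "'a \<Rightarrow> 'a" and L
    unfolding K(2) n_def by (rule Least_le) (use that in blast)
  have fin: "finite K" and carr: "x ` K \<subseteq> carrier G" using K by (auto simp: spans_mod_torsion_def)
  obtain f where f: "bij_betw f {..<n} K"
    using ex_bij_betw_nat_finite[OF fin] K(2) by (auto simp: atLeast0LessThan)
  have re: "int_comb c x K = int_comb (c \<circ> f) (x \<circ> f) {..<n}" for c
    using int_comb_reindex[of f "{..<n}" x c] f carr by (auto simp: bij_betw_def)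
  have carr': "(x \<circ> f) ` {..<n} \<subseteq> carrier G" using f carr by (auto simp: bij_betw_def)
  show thesis
  proof (rule that)
    show "spans_mod_torsion (x \<circ> f) {..<n}"
      using K(1) carr' re unfolding spans_mod_torsion_def by (metis finite_lessThan)
    show "independent_family (x \<circ> f) {..<n}"
      unfolding independent_family_def
    proof (intro conjI carr' allI impI ballI)
      fix c k assume c: "int_comb c (x \<circ> f) {..<n} = \<one>" and k: "k \<in> {..<n}"
      let ?d = "\<lambda>s. c (inv_into {..<n} f s)"
      have df: "(?d \<circ> f) j = c j" if "j < n" for j
        using f that by (simp add: bij_betw_def)
      have "int_comb ?d x K = \<one>"
        unfolding re using c by (subst int_comb_cong[OF carr', of _ c "x \<circ> f"]) (use df in auto)
      then have "\<forall>s\<in>K. ?d s = 0"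
        by (intro minimal_spanning_family_independent[OF K(1)]) (use min in auto)
      then show "c k = 0" using df[of k] k f by (auto simp: bij_betw_def)
    qed simp
  qed
qed

end

section \<open>Free rank and torsion\<close>

text \<open>More than \<open>r\<close> integer vectors of length \<open>r\<close> are linearly dependent. The induction step
  eliminates the last coordinate with a pivot \<open>p\<close>.\<close>

lemma ex_integer_relation:
  fixes a :: "'b \<Rightarrow> nat \<Rightarrow> int"
  assumes "finite B" "r < card B"
  shows "\<exists>c. (\<exists>b\<in>B. c b \<noteq> 0) \<and> (\<forall>k<r. (\<Sum>b\<in>B. c b * a b k) = 0)"
  using assms
proof (induction r arbitrary: B a)
  case 0
  then obtain b where "b \<in> B" by fastforce
  then show ?case by (auto intro!: exI[of _ "\<lambda>_. 1"])
next
  case (Suc r)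
  show ?case
  proof (cases "\<forall>b\<in>B. a b r = 0")
    case True
    obtain c where "\<exists>b\<in>B. c b \<noteq> 0" "\<forall>k<r. (\<Sum>b\<in>B. c b * a b k) = 0"
      using Suc.IH[of B a] Suc.prems by auto
    with True show ?thesis by (auto intro!: exI[of _ c] simp: less_Suc_eq)
  next
    case False
    then obtain p where p: "p \<in> B" "a p r \<noteq> 0" by blast
    let ?B = "B - {p}"
    have B: "finite ?B" "r < card ?B" using Suc.prems p by (auto simp: card_Diff_singleton)
    obtain c where c: "\<exists>b\<in>?B. c b \<noteq> 0"
      "\<forall>k<r. (\<Sum>b\<in>?B. c b * (a p r * a b k - a b r * a p k)) = 0"
      using Suc.IH[OF B, of "\<lambda>b k. a p r * a b k - a b r * a p k"] by blast
    \<comment> \<open>The coefficient of the pivot is chosen so that the last coordinate cancels.\<close>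
    define d where "d b = (if b = p then - (\<Sum>b\<in>?B. c b * a b r) else a p r * c b)" for b
    have "(\<Sum>b\<in>B. d b * a b k) = (\<Sum>b\<in>?B. c b * (a p r * a b k - a b r * a p k))" for k
    proof -
      have "(\<Sum>b\<in>B. d b * a b k) = d p * a p k + (\<Sum>b\<in>?B. d b * a b k)"
        using Suc.prems p by (simp add: sum.remove)
      also have "(\<Sum>b\<in>?B. d b * a b k) = (\<Sum>b\<in>?B. a p r * c b * a b k)"
        by (rule sum.cong) (auto simp: d_def)
      also have "d p * a p k = (\<Sum>b\<in>?B. - (c b * a b r * a p k))"
        by (simp add: d_def sum_negf flip: sum_distrib_right)
      finally show ?thesis
        by (simp add: algebra_simps flip: sum.distrib)
    qed
    moreover have "(\<Sum>b\<in>?B. c b * (a p r * a b r - a b r * a p r)) = 0"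
      by (simp add: mult.commute)
    ultimately have "\<forall>k<Suc r. (\<Sum>b\<in>B. d b * a b k) = 0"
      using c(2) by (simp add: less_Suc_eq)
    moreover have "\<exists>b\<in>B. d b \<noteq> 0"
    proof -
      obtain b where "b \<in> ?B" "c b \<noteq> 0" using c(1) by blast
      then show ?thesis using p by (intro bexI[of _ b]) (auto simp: d_def)
    qed
    ultimately show ?thesis by blast
  qed
qed

context comm_group
begin

lemma independent_family_inj_on:
  assumes "independent_family y K"
  shows "inj_on y K"
proof (rule inj_onI, rule ccontr)
  fix i j assume ij: "i \<in> K" "j \<in> K" "y i = y j" "i \<noteq> j"
  have K: "finite K" "y ` K \<subseteq> carrier G" using assms by (auto simp: independent_family_def)
  have "int_comb (\<lambda>k. (if k = i then 1 else 0) - (if k = j then 1 else 0)) y K = \<one>"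
    using K ij by (subst int_comb_diff) (auto simp: int_comb_delta)
  then have "\<forall>k\<in>K. (if k = i then 1 else 0) - (if k = j then 1 else 0) = (0::int)"
    using assms unfolding independent_family_def by blast
  then show False using ij by auto
qed

text \<open>Translation from independent sets, which define \<^const>\<open>free_rank\<close>, to independent families.\<close>

lemma int_independent_iff:
  assumes "finite B" "B \<subseteq> carrier G"
  shows "int_independent G B \<longleftrightarrow> independent_family (\<lambda>b. b) B"
  using assms by (auto simp: int_independent_def independent_family_def int_comb_def)

lemma independent_family_image:
  assumes "independent_family y K"
  shows "independent_family (\<lambda>b. b) (y ` K)"
  unfolding independent_family_def
proof (intro conjI allI impI ballI)
  have K: "finite K" "y ` K \<subseteq> carrier G" using assms by (auto simp: independent_family_def)
  then show "finite (y ` K)" "(\<lambda>b. b) ` y ` K \<subseteq> carrier G" by auto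
  fix c b assume c: "int_comb c (\<lambda>b. b) (y ` K) = \<one>" and "b \<in> y ` K"
  then obtain k where k: "k \<in> K" "b = y k" by blast
  have "int_comb (c \<circ> y) y K = \<one>"
    using int_comb_reindex[OF independent_family_inj_on[OF assms], of "\<lambda>b. b" c] K c
    by (simp add: comp_def)
  then have "(c \<circ> y) k = 0" using assms k unfolding independent_family_def by blast
  then show "c b = 0" using k by simp
qed

lemma mult_eq_mult_imp_quotient_eq:
  assumes "p \<in> carrier G" "q \<in> carrier G" "s \<in> carrier G" "t \<in> carrier G" "p \<otimes> s = q \<otimes> t"
  shows "p \<otimes> inv q = t \<otimes> inv s"
proof -
  have "p \<otimes> inv q = (p \<otimes> s) \<otimes> inv s \<otimes> inv q" using assms(1-4) by (simp add: m_assoc)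
  also have "\<dots> = t \<otimes> inv s"
    unfolding assms(5) using assms(1-4) by (simp add: m_assoc m_comm[of q])
  finally show ?thesis .
qed

lemma int_comb_mod:
  assumes "x ` K \<subseteq> carrier G" "\<And>k. k \<in> K \<Longrightarrow> x k [^] (N k :: int) = \<one>"
  shows "int_comb c x K = int_comb (\<lambda>k\<in>K. c k mod N k) x K"
  unfolding int_comb_def
proof (rule finprod_cong'[OF refl])
  fix k assume k: "k \<in> K"
  have "x k [^] c k = x k [^] (N k * (c k div N k) + c k mod N k)" by simp
  also have "\<dots> = (x k [^] N k) [^] (c k div N k) \<otimes> x k [^] (c k mod N k)"
    using assms(1) k by (simp only: int_pow_mult int_pow_pow image_subset_iff)
  finally show "x k [^] c k = x k [^] (\<lambda>k\<in>K. c k mod N k) k"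
    using assms k by (simp add: image_subset_iff)
qed (use assms(1) in auto)

lemma fin_genI:
  assumes K: "finite K" "x ` K \<subseteq> carrier G"
    and gen: "\<And>u. u \<in> carrier G \<Longrightarrow> \<exists>c. u = int_comb c x K"
  shows fin_gen
  unfolding fin_gen_def
proof (intro exI[of _ "x ` K"] conjI ballI)
  fix u assume "u \<in> carrier G"
  then obtain c where c: "u = int_comb c x K" using gen by blast
  have xK: "(\<lambda>t. t) ` (x ` K) \<subseteq> carrier G" using K(2) by simp
  have "u = int_comb c (\<lambda>k. int_comb (\<lambda>t. if t = x k then 1 else 0) (\<lambda>t. t) (x ` K)) K"
    unfolding c using K xK by (intro int_comb_cong) (auto simp: int_comb_delta image_subset_iff)
  also have "\<dots> = int_comb (\<lambda>t. \<Sum>k\<in>K. c k * (if t = x k then 1 else 0)) (\<lambda>t. t) (x ` K)"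
    using K(1) xK by (subst int_comb_sum) auto
  finally show "\<exists>c. u = int_comb c (\<lambda>t. t) (x ` K)" by blast
qed (use K in auto)

end

text \<open>A fixed basis modulo torsion splits every element into a combination of the basis, with
  coefficients \<open>coord\<close>, and a torsion factor.\<close>

locale basis_mod_torsion = comm_group G for G (structure) +
  fixes x :: "nat \<Rightarrow> 'a" and r :: nat
  assumes spans: "spans_mod_torsion x {..<r}" and independent: "independent_family x {..<r}"
begin

definition coord :: "'a \<Rightarrow> nat \<Rightarrow> int" where
  "coord u = (SOME c. u \<otimes> inv (int_comb c x {..<r}) \<in> torsion)"

definition torsion_part :: "'a \<Rightarrow> 'a" where
  "torsion_part u = u \<otimes> inv (int_comb (coord u) x {..<r})"

lemma basis_carrier: "x ` {..<r} \<subseteq> carrier G"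
  using spans by (simp add: spans_mod_torsion_def)

lemma basis_comb_carrier: "int_comb c x {..<r} \<in> carrier G"
  using basis_carrier by (rule int_comb_closed)

lemma torsion_part_torsion:
  assumes "u \<in> carrier G"
  shows "torsion_part u \<in> torsion"
proof -
  have "\<exists>c. u \<otimes> inv (int_comb c x {..<r}) \<in> torsion"
    using spans assms unfolding spans_mod_torsion_def by blast
  then show ?thesis unfolding torsion_part_def coord_def by (rule someI_ex)
qed

lemma coord_decomposition:
  assumes "u \<in> carrier G"
  shows "u = int_comb (coord u) x {..<r} \<otimes> torsion_part u"
  using assms basis_comb_carrier[of "coord u"] by (simp add: torsion_part_def m_lcomm)

text \<open>Any other way of writing \<open>u\<close> as a combination times a torsion element differs by a relation modulo
  torsion, which independence makes trivial.\<close>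

lemma coord_unique:
  assumes u: "u = int_comb c x {..<r} \<otimes> t" and t: "t \<in> torsion" and k: "k < r"
  shows "coord u k = c k"
proof -
  have uc: "u \<in> carrier G" using u basis_comb_carrier torsion_carrier[OF t] by simp
  have "int_comb (coord u) x {..<r} \<otimes> torsion_part u = int_comb c x {..<r} \<otimes> t"
    using coord_decomposition[OF uc] u by simp
  then have "int_comb (coord u) x {..<r} \<otimes> inv (int_comb c x {..<r}) = t \<otimes> inv (torsion_part u)"
    by (intro mult_eq_mult_imp_quotient_eq basis_comb_carrier torsion_carrier torsion_part_torsion uc t)
  then have "int_comb (\<lambda>k. coord u k - c k) x {..<r} \<in> torsion"
    unfolding int_comb_diff[OF basis_carrier]
    by (simp add: torsion_mult torsion_inv torsion_part_torsion[OF uc] t)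
  then have "coord u k - c k = 0" by (rule independent_family_torsion[OF independent]) (simp add: k)
  then show ?thesis by simp
qed

lemma coord_basis:
  assumes "j < r" "k < r"
  shows "coord (x j) k = (if k = j then 1 else 0)"
  by (rule coord_unique[of _ _ \<one>])
    (use assms basis_carrier in \<open>auto simp: int_comb_delta image_subset_iff\<close>)

lemma int_comb_decomposition:
  assumes "finite K" "y ` K \<subseteq> carrier G"
  shows "int_comb c y K =
    int_comb (\<lambda>j. \<Sum>i\<in>K. c i * coord (y i) j) x {..<r} \<otimes> int_comb c (\<lambda>i. torsion_part (y i)) K"
proof -
  let ?p = "\<lambda>i. int_comb (coord (y i)) x {..<r}" and ?t = "\<lambda>i. torsion_part (y i)"
  have "int_comb c y K = int_comb c (\<lambda>i. ?p i \<otimes> ?t i) K"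
    by (rule int_comb_cong[OF assms(2) refl coord_decomposition]) (use assms(2) in blast)
  also have "\<dots> = int_comb c ?p K \<otimes> int_comb c ?t K"
    by (rule int_comb_mult) (use assms(2) basis_comb_carrier torsion_carrier torsion_part_torsion in blast)+
  also have "int_comb c ?p K = int_comb (\<lambda>j. \<Sum>i\<in>K. c i * coord (y i) j) x {..<r}"
    by (rule int_comb_sum[OF assms(1) basis_carrier, symmetric])
  finally show ?thesis .
qed

lemma torsion_comb_torsion_part:
  assumes "y ` K \<subseteq> carrier G"
  shows "int_comb c (\<lambda>i. torsion_part (y i)) K \<in> torsion"
  by (rule torsion_int_comb) (use assms torsion_part_torsion in blast)

lemma coord_int_comb:
  assumes "finite K" "y ` K \<subseteq> carrier G" "k < r"
  shows "coord (int_comb c y K) k = (\<Sum>i\<in>K. c i * coord (y i) k)"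
  by (rule coord_unique[OF int_comb_decomposition[OF assms(1,2)]
        torsion_comb_torsion_part[OF assms(2)] assms(3)])

lemma coord_mult:
  assumes u: "u \<in> carrier G" and v: "v \<in> carrier G" and k: "k < r"
  shows "coord (u \<otimes> v) k = coord u k + coord v k"
proof (rule coord_unique[OF _ _ k])
  let ?U = "int_comb (coord u) x {..<r}" and ?V = "int_comb (coord v) x {..<r}"
  note t = torsion_part_torsion[OF u] torsion_part_torsion[OF v]
  have "u \<otimes> v = (?U \<otimes> torsion_part u) \<otimes> (?V \<otimes> torsion_part v)"
    using coord_decomposition[OF u] coord_decomposition[OF v] by simp
  also have "\<dots> = (?U \<otimes> ?V) \<otimes> (torsion_part u \<otimes> torsion_part v)"
    using t[THEN torsion_carrier] basis_comb_carrier by (simp add: m_ac)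
  finally show "u \<otimes> v = int_comb (\<lambda>k. coord u k + coord v k) x {..<r} \<otimes> (torsion_part u \<otimes> torsion_part v)"
    by (simp only: int_comb_add[OF basis_carrier])
  show "torsion_part u \<otimes> torsion_part v \<in> torsion" by (rule torsion_mult[OF t])
qed

lemma coord_torsion:
  assumes "u \<in> torsion" "k < r"
  shows "coord u k = 0"
  by (rule coord_unique[OF _ assms])
    (simp add: int_comb_zero torsion_carrier[OF assms(1)])

lemma coord_zero_imp_torsion:
  assumes "u \<in> carrier G" "\<And>k. k < r \<Longrightarrow> coord u k = 0"
  shows "u \<in> torsion"
proof -
  have "int_comb (coord u) x {..<r} = \<one>" by (rule int_comb_zero) (simp add: assms(2))
  then have "u = torsion_part u"
    using coord_decomposition[OF assms(1)] torsion_carrier[OF torsion_part_torsion[OF assms(1)]] by simp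
  then show ?thesis using torsion_part_torsion[OF assms(1)] by simp
qed

lemma independent_family_card_le:
  assumes y: "independent_family y K"
  shows "card K \<le> r"
proof (rule ccontr)
  assume "\<not> card K \<le> r"
  have K: "finite K" "y ` K \<subseteq> carrier G" using y by (auto simp: independent_family_def)
  obtain c where c: "\<exists>k\<in>K. c k \<noteq> 0" "\<forall>j<r. (\<Sum>k\<in>K. c k * coord (y k) j) = 0"
    using ex_integer_relation[of K r "\<lambda>k. coord (y k)"] K \<open>\<not> card K \<le> r\<close> by auto
  have "int_comb c y K \<in> torsion"
    by (rule coord_zero_imp_torsion) (simp_all add: int_comb_closed K c(2) coord_int_comb)
  then show False using c(1) independent_family_torsion[OF y] by blast
qed

lemma free_rank_eq: "free_rank G = r"
proof -
  let ?N = "{card B | B. finite B \<and> B \<subseteq> carrier G \<and> int_independent G B}"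
  have le: "n \<le> r" if "n \<in> ?N" for n
    using that independent_family_card_le by (auto simp: int_independent_iff)
  have "card (x ` {..<r}) = r"
    using independent_family_inj_on[OF independent] by (simp add: card_image)
  then have "r \<in> ?N"
    using independent_family_image[OF independent] int_independent_iff[of "x ` {..<r}"] basis_carrier
    by (metis (mono_tags, lifting) finite_imageI finite_lessThan mem_Collect_eq)
  moreover have "finite ?N" using le by (meson finite_nat_set_iff_bounded_le)
  ultimately show ?thesis unfolding free_rank_def using le by (intro Max_eqI) auto
qed

end

context comm_group
begin

lemma ex_basis_free_rank:
  assumes "fin_gen"
  obtains x where "basis_mod_torsion G x (free_rank G)"
proof -
  obtain r and x :: "nat \<Rightarrow> 'a" where "spans_mod_torsion x {..<r}" "independent_family x {..<r}"
    using ex_basis_mod_torsion[OF assms] by metis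
  then have "basis_mod_torsion G x r"
    by (intro basis_mod_torsion.intro basis_mod_torsion_axioms.intro comm_group_axioms)
  then show thesis using that basis_mod_torsion.free_rank_eq by metis
qed

lemma independent_family_card_le_free_rank:
  "fin_gen \<Longrightarrow> independent_family y K \<Longrightarrow> card K \<le> free_rank G"
  using ex_basis_free_rank basis_mod_torsion.independent_family_card_le by metis

text \<open>A torsion element is a combination of the torsion parts of the generators, because its coordinates
  vanish. The exponents matter only modulo the orders of these torsion parts, so there are finitely
  many possibilities.\<close>

theorem finite_torsion:
  assumes "fin_gen"
  shows "finite torsion"
proof -
  obtain S where S: "finite S" "S \<subseteq> carrier G" "\<And>u. u \<in> carrier G \<Longrightarrow> \<exists>c. u = int_comb c (\<lambda>s. s) S"
    using assms unfolding fin_gen_def by blast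
  obtain x where "basis_mod_torsion G x (free_rank G)" by (rule ex_basis_free_rank[OF assms])
  then interpret B: basis_mod_torsion G x "free_rank G" .
  have tc: "B.torsion_part ` S \<subseteq> carrier G"
    using S(2) B.torsion_part_torsion torsion_carrier by blast
  have "\<forall>s\<in>S. \<exists>N::int. N \<noteq> 0 \<and> B.torsion_part s [^] N = \<one>"
    using S(2) B.torsion_part_torsion unfolding torsion_def by blast
  then obtain N :: "'a \<Rightarrow> int" where
    N: "\<And>s. s \<in> S \<Longrightarrow> N s \<noteq> 0" "\<And>s. s \<in> S \<Longrightarrow> B.torsion_part s [^] N s = \<one>" by metis
  have "torsion \<subseteq> (\<lambda>c. int_comb c B.torsion_part S) ` (\<Pi>\<^sub>E s\<in>S. {- \<bar>N s\<bar>..\<bar>N s\<bar>})"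
  proof
    fix u assume u: "u \<in> torsion"
    then obtain c where c: "u = int_comb c (\<lambda>s. s) S" using S torsion_carrier by blast
    have "(\<Sum>s\<in>S. c s * B.coord s j) = 0" if "j < free_rank G" for j
      using B.coord_int_comb[OF S(1), of "\<lambda>s. s" j c] B.coord_torsion[OF u that] S(2) c that by simp
    then have "int_comb (\<lambda>j. \<Sum>s\<in>S. c s * B.coord s j) x {..<free_rank G} = \<one>"
      by (intro int_comb_zero) simp
    then have "u = int_comb c B.torsion_part S"
      using B.int_comb_decomposition[OF S(1), of "\<lambda>s. s" c] S(2) c int_comb_closed[OF tc] by simp
    also have "\<dots> = int_comb (\<lambda>s\<in>S. c s mod N s) B.torsion_part S"
      using tc N(2) by (rule int_comb_mod)
    finally have u_mod: "u = (\<lambda>c. int_comb c B.torsion_part S) (\<lambda>s\<in>S. c s mod N s)" .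
    show "u \<in> (\<lambda>c. int_comb c B.torsion_part S) ` (\<Pi>\<^sub>E s\<in>S. {- \<bar>N s\<bar>..\<bar>N s\<bar>})"
      unfolding u_mod
    proof (rule imageI)
      have "c s mod N s \<in> {- \<bar>N s\<bar>..\<bar>N s\<bar>}" if "s \<in> S" for s
        using N(1)[OF that] abs_mod_less[of "N s" "c s"] by (auto simp: abs_le_iff)
      then show "(\<lambda>s\<in>S. c s mod N s) \<in> (\<Pi>\<^sub>E s\<in>S. {- \<bar>N s\<bar>..\<bar>N s\<bar>})" by auto
    qed
  qed
  moreover have "finite (\<Pi>\<^sub>E s\<in>S. {- \<bar>N s\<bar>..\<bar>N s\<bar>})" using S(1) by (intro finite_PiE) auto
  ultimately show ?thesis by (meson finite_surj)
qed

end

lemma hom_int_comb: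
  assumes "comm_group G" "comm_group H" "h \<in> hom G H" "x ` K \<subseteq> carrier G"
  shows "h (comm_group.int_comb G c x K) = comm_group.int_comb H c (h \<circ> x) K"
proof -
  interpret G: comm_group G by fact
  interpret H: comm_group H by fact
  interpret h: group_hom G H h by unfold_locales fact
  show ?thesis
  proof (cases "finite K")
    case True
    then show ?thesis using assms(4)
    proof (induction K)
      case (insert k K)
      then have "x k \<in> carrier G" "x ` K \<subseteq> carrier G" "(h \<circ> x) ` K \<subseteq> carrier H" by auto
      with insert show ?case
        by (simp add: h.hom_int_pow)
    qed simp
  qed (simp add: G.int_comb_def H.int_comb_def)
qed

text \<open>A basis of \<open>H\<close> modulo torsion lifts along \<open>h\<close> to an independent family of \<open>G\<close>, whence the
  inequality. If the kernel contains an element of infinite order, that element extends the lifted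
  family, so the inequality is strict. Otherwise the kernel consists of torsion elements and is
  finite by \<open>finite_torsion\<close>. If the kernel is finite, it consists of torsion elements, so
  the image of an independent family is independent.\<close>

theorem free_rank_surjective_hom:
  assumes G: "comm_group G" and H: "comm_group H" and h: "h \<in> hom G H"
    and surj: "h ` carrier G = carrier H" and fg: "comm_group.fin_gen G"
  shows "free_rank H \<le> free_rank G"
    and "free_rank H = free_rank G \<longleftrightarrow> finite (kernel G H h)"
proof -
  interpret G: comm_group G by fact
  interpret H: comm_group H by fact
  interpret h: group_hom G H h by unfold_locales fact
  have fgH: "H.fin_gen"
  proof -
    obtain S where S: "finite S" "S \<subseteq> carrier G"
      "\<And>u. u \<in> carrier G \<Longrightarrow> \<exists>c. u = G.int_comb c (\<lambda>s. s) S"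
      using fg unfolding G.fin_gen_def by blast
    show ?thesis
    proof (rule H.fin_genI[OF S(1)])
      show "h ` S \<subseteq> carrier H" using S(2) by auto
      fix v assume "v \<in> carrier H"
      then obtain u where "u \<in> carrier G" "v = h u" using surj by blast
      then obtain c where c: "u = G.int_comb c (\<lambda>s. s) S" using S by blast
      have "v = H.int_comb c h S"
        using hom_int_comb[OF G H h, of "\<lambda>s. s" S c] S(2) c \<open>v = h u\<close> by (simp add: comp_def)
      then show "\<exists>c. v = H.int_comb c h S" by blast
    qed
  qed
  obtain x where x: "G.independent_family x {..<free_rank G}"
    using G.ex_basis_free_rank[OF fg] basis_mod_torsion.independent by metis
  obtain y where y: "H.independent_family y {..<free_rank H}"
    using H.ex_basis_free_rank[OF fgH] basis_mod_torsion.independent by metis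
  have Y: "y k \<in> carrier H" if "k < free_rank H" for k
    using y that by (auto simp: H.independent_family_def)
  define z where "z k = inv_into (carrier G) h (y k)" for k
  have z: "z k \<in> carrier G" "h (z k) = y k" if "k < free_rank H" for k
    using Y[OF that] surj unfolding z_def by (auto intro: inv_into_into f_inv_into_f)
  have hz: "h (G.int_comb c z {..<free_rank H}) = H.int_comb c y {..<free_rank H}" for c
  proof -
    have "h (G.int_comb c z {..<free_rank H}) = H.int_comb c (h \<circ> z) {..<free_rank H}"
      using z by (intro hom_int_comb[OF G H h]) auto
    also have "\<dots> = H.int_comb c y {..<free_rank H}"
      using z Y by (intro H.int_comb_cong) auto
    finally show ?thesis .
  qed
  have zind: "G.independent_family z {..<free_rank H}"
    unfolding G.independent_family_def
  proof (intro conjI allI impI)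
    fix c assume "G.int_comb c z {..<free_rank H} = \<one>\<^bsub>G\<^esub>"
    then have "H.int_comb c y {..<free_rank H} = \<one>\<^bsub>H\<^esub>" using hz[of c] by simp
    then show "\<forall>k\<in>{..<free_rank H}. c k = 0" using y unfolding H.independent_family_def by blast
  qed (use z in auto)
  show le: "free_rank H \<le> free_rank G"
    using G.independent_family_card_le_free_rank[OF fg zind] by simp
  show "free_rank H = free_rank G \<longleftrightarrow> finite (kernel G H h)"
  proof
    assume eq: "free_rank H = free_rank G"
    have "kernel G H h \<subseteq> G.torsion"
    proof (rule ccontr)
      assume "\<not> kernel G H h \<subseteq> G.torsion"
      then obtain u where u: "u \<in> carrier G" "h u = \<one>\<^bsub>H\<^esub>" "u \<notin> G.torsion"
        by (auto simp: kernel_def)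
      \<comment> \<open>The lifted basis is indexed below \<open>?n\<close>, so \<open>?n\<close> is a free index for \<open>u\<close>.\<close>
      let ?n = "free_rank H" and ?z = "z(free_rank H := u)"
      have Z: "?z ` {..<Suc ?n} \<subseteq> carrier G" using z u by (auto simp: less_Suc_eq)
      have "G.independent_family ?z {..<Suc ?n}"
        unfolding G.independent_family_def
      proof (intro conjI allI impI Z finite_lessThan)
        fix c assume c: "G.int_comb c ?z {..<Suc ?n} = \<one>\<^bsub>G\<^esub>"
        have zc: "z ` {..<?n} \<subseteq> carrier G" using z by auto
        have "G.int_comb c ?z {..<?n} = G.int_comb c z {..<?n}"
          using zc by (intro G.int_comb_cong) auto
        then have split: "u [^]\<^bsub>G\<^esub> c ?n \<otimes>\<^bsub>G\<^esub> G.int_comb c z {..<?n} = \<one>\<^bsub>G\<^esub>"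
          using c zc u by (simp add: lessThan_Suc)
        have "h (u [^]\<^bsub>G\<^esub> c ?n \<otimes>\<^bsub>G\<^esub> G.int_comb c z {..<?n}) = H.int_comb c y {..<?n}"
          using zc u hz[of c] y by (simp add: h.hom_int_pow H.independent_family_def)
        then have "H.int_comb c y {..<?n} = \<one>\<^bsub>H\<^esub>" using split by simp
        then have c0: "\<forall>k\<in>{..<?n}. c k = 0" using y unfolding H.independent_family_def by blast
        then have "G.int_comb c z {..<?n} = \<one>\<^bsub>G\<^esub>" by (intro G.int_comb_zero) auto
        then have "u [^]\<^bsub>G\<^esub> c ?n = \<one>\<^bsub>G\<^esub>" using split u by simp
        then have "c ?n = 0" using u(1,3) G.torsionI by blast
        then show "\<forall>k\<in>{..<Suc ?n}. c k = 0" using c0 by (auto simp: less_Suc_eq)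
      qed
      from G.independent_family_card_le_free_rank[OF fg this] show False using eq by simp
    qed
    then show "finite (kernel G H h)" using G.finite_torsion[OF fg] finite_subset by blast
  next
    assume fin: "finite (kernel G H h)"
    have ker_tor: "u \<in> G.torsion" if u: "u \<in> kernel G H h" for u
    proof -
      have uc: "u \<in> carrier G" "h u = \<one>\<^bsub>H\<^esub>" using u by (auto simp: kernel_def)
      have "\<not> inj_on (\<lambda>n::nat. u [^]\<^bsub>G\<^esub> int n) UNIV"
      proof
        assume "inj_on (\<lambda>n::nat. u [^]\<^bsub>G\<^esub> int n) UNIV"
        moreover have "range (\<lambda>n::nat. u [^]\<^bsub>G\<^esub> int n) \<subseteq> kernel G H h"
          using uc by (auto simp: kernel_def h.hom_int_pow)
        ultimately show False using fin finite_subset finite_imageD by blast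
      qed
      then obtain m n :: nat where "m \<noteq> n" "u [^]\<^bsub>G\<^esub> int m = u [^]\<^bsub>G\<^esub> int n"
        by (auto simp: inj_on_def)
      then have "u [^]\<^bsub>G\<^esub> (int m - int n) = \<one>\<^bsub>G\<^esub>" "int m - int n \<noteq> 0"
        using uc by (auto simp: G.int_pow_diff)
      then show ?thesis using uc G.torsionI by blast
    qed
    have X: "x ` {..<free_rank G} \<subseteq> carrier G" using x by (auto simp: G.independent_family_def)
    have "H.independent_family (h \<circ> x) {..<free_rank G}"
      unfolding H.independent_family_def
    proof (intro conjI allI impI ballI)
      fix c k assume c: "H.int_comb c (h \<circ> x) {..<free_rank G} = \<one>\<^bsub>H\<^esub>" and k: "k \<in> {..<free_rank G}"
      have "h (G.int_comb c x {..<free_rank G}) = \<one>\<^bsub>H\<^esub>"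
        using hom_int_comb[OF G H h X, of c] c by simp
      then have "G.int_comb c x {..<free_rank G} \<in> G.torsion"
        using X by (intro ker_tor) (auto simp: kernel_def)
      then show "c k = 0" using G.independent_family_torsion[OF x _ k] by blast
    qed (use X in auto)
    from H.independent_family_card_le_free_rank[OF fgH this] show "free_rank H = free_rank G"
      using le by simp
  qed
qed

section \<open>Roots of unity\<close>

text \<open>The polynomial \<open>z ^ m - 1\<close> splits into linear factors. A double root \<open>a\<close> would be a root of the
  derivative \<open>m * z ^ (m - 1)\<close>, hence zero, but zero is not a root.\<close>

lemma roots_of_unity:
  assumes "(of_nat m :: 'f::alg_closed_field) \<noteq> 0"
  shows card_roots_of_unity: "card {z::'f. z ^ m = 1} = m"
    and finite_roots_of_unity: "finite {z::'f. z ^ m = 1}"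
proof -
  have m: "m > 0" using assms by (cases m) auto
  define p :: "'f poly" where "p = monom 1 m + [:-1:]"
  have deg: "degree p = m"
    unfolding p_def using m by (subst degree_add_eq_left) (auto simp: degree_monom_eq)
  then have p0: "p \<noteq> 0" using m by auto
  have roots: "{x. poly p x = 0} = {z. z ^ m = 1}"
    by (auto simp: p_def poly_monom algebra_simps)
  have der: "poly (pderiv p) a = of_nat m * a ^ (m - 1)" for a
    by (simp add: p_def pderiv_add pderiv_monom poly_monom pderiv_pCons)
  obtain A where A: "size A = degree p" "p = smult (lead_coeff p) (\<Prod>x\<in>#A. [:-x, 1:])"
    using alg_closed_imp_factorization[OF p0] by blast
  have "count A a \<le> 1" for a
  proof (rule ccontr)
    assume "\<not> count A a \<le> 1"
    then have "{#a, a#} \<subseteq># A"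
      by (intro mset_subset_eqI) (auto split: if_splits)
    then obtain B where B: "A = {#a, a#} + B" by (auto simp: subset_mset.le_iff_add)
    have "p = smult (lead_coeff p) (\<Prod>x\<in>#{#a, a#} + B. [:-x, 1:])"
      using A(2) B by metis
    then have "p = [:-a, 1:] * [:-a, 1:] * smult (lead_coeff p) (\<Prod>x\<in>#B. [:-x, 1:])"
      by (simp only: image_mset_union prod_mset_Un image_mset_add_mset prod_mset.add_mset
          image_mset_empty prod_mset_empty mult_1_right mult_smult_right mult.assoc)
    then obtain q where q: "p = [:-a, 1:] * [:-a, 1:] * q" by blast
    have "poly (pderiv p) a = 0" unfolding q pderiv_mult poly_add poly_mult by simp
    then have "a ^ (m - 1) = 0" using der assms by simp
    then have "a = 0" by (simp split: if_splits)
    moreover have "poly p a = 0" by (subst q) simp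
    ultimately show False using m by (simp add: p_def poly_monom power_0_left)
  qed
  then have "count A a = (if a \<in># A then 1 else 0)" for a
    by (meson count_eq_zero_iff count_greater_eq_one_iff le_antisym)
  then have "A = mset_set (set_mset A)"
    by (intro multiset_eqI) (auto simp: count_mset_set' not_in_iff)
  then have "size A = card (set_mset A)" by (metis size_mset_set)
  moreover have "set_mset A = {x. poly p x = 0}"
  proof -
    have "poly p x = lead_coeff p * (\<Prod>a\<in>#A. x - a)" for x
      using arg_cong[OF A(2), of "\<lambda>p. poly p x"] by (simp add: poly_prod_mset)
    then show ?thesis using p0 by (auto simp: prod_mset_zero_iff)
  qed
  ultimately show "card {z::'f. z ^ m = 1} = m" using A deg roots by simp
  show "finite {z::'f. z ^ m = 1}" using poly_roots_finite[OF p0] roots by simp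
qed

definition torsion_units :: "'f::field set" where
  "torsion_units = {z. \<exists>m. of_nat m \<noteq> (0::'f) \<and> z ^ m = 1}"

lemma of_nat_or_of_nat_Suc_nonzero: "(of_nat m :: 'f::field) \<noteq> 0 \<or> (of_nat (Suc m) :: 'f) \<noteq> 0"
  by auto

text \<open>Of any two consecutive numbers one is nonzero in the field, so there are arbitrarily large \<open>m\<close> for
  which the field has \<open>m\<close> distinct \<open>m\<close>-th roots of unity.\<close>

lemma infinite_torsion_units: "infinite (torsion_units :: 'f::alg_closed_field set)"
proof
  assume fin: "finite (torsion_units :: 'f set)"
  let ?N = "Suc (card (torsion_units :: 'f set))"
  obtain m where m: "?N \<le> m" "(of_nat m :: 'f) \<noteq> 0"
    using of_nat_or_of_nat_Suc_nonzero[of ?N, where 'f = 'f] by (metis le_Suc_eq order_refl)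
  have "{z::'f. z ^ m = 1} \<subseteq> torsion_units" using m by (auto simp: torsion_units_def)
  then have "m \<le> card (torsion_units :: 'f set)"
    using card_roots_of_unity[OF m(2)] card_mono[OF fin] by metis
  then show False using m by simp
qed

text \<open>Orthogonality of characters: multiplication by a root \<open>w\<close> with \<open>w ^ j \<noteq> 1\<close> permutes the roots and
  multiplies the sum by a factor other than one.\<close>

lemma sum_powers_roots_of_unity:
  assumes "(of_nat m :: 'f::alg_closed_field) \<noteq> 0" "j < m"
  shows "(\<Sum>z | z ^ m = 1. inverse (z::'f) ^ j) = (if j = 0 then of_nat m else 0)"
proof (cases "j = 0")
  case True
  then show ?thesis using card_roots_of_unity[OF assms(1)] by simp
next
  case False
  let ?U = "{z::'f. z ^ m = 1}"
  have m: "m > 0" using assms by (cases m) auto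
  obtain w where w: "w \<in> ?U" "w ^ j \<noteq> 1"
  proof -
    define p :: "'f poly" where "p = monom 1 j + [:-1:]"
    have deg: "degree p = j"
      unfolding p_def using False by (subst degree_add_eq_left) (auto simp: degree_monom_eq)
    then have p0: "p \<noteq> 0" using False by auto
    have roots: "{x. poly p x = 0} = {z. z ^ j = 1}"
      by (auto simp: p_def poly_monom algebra_simps)
    have fin: "finite {z::'f. z ^ j = 1}" and "card {z::'f. z ^ j = 1} \<le> j"
      using poly_roots_finite[OF p0] card_poly_roots_bound[OF p0] by (simp_all add: roots deg)
    then have "\<not> ?U \<subseteq> {z. z ^ j = 1}"
      using card_mono[OF fin, of ?U] card_roots_of_unity[OF assms(1)] assms(2) by auto
    then show ?thesis using that by blast
  qed
  have w0: "w \<noteq> 0" using w m by (auto simp: power_0_left)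
  have "(\<Sum>z\<in>?U. inverse z ^ j) = (\<Sum>z\<in>?U. inverse (w * z) ^ j)"
  proof (rule sum.reindex_bij_witness[of _ "\<lambda>z. w * z" "\<lambda>z. inverse w * z"])
    show "inverse (w * (inverse w * z)) ^ j = inverse z ^ j" for z
      using w0 by (simp flip: mult.assoc)
    show "inverse w * z \<in> ?U" if "z \<in> ?U" for z
      using that w by (simp add: power_mult_distrib power_inverse)
    show "w * z \<in> ?U" if "z \<in> ?U" for z
      using that w by (simp add: power_mult_distrib)
  qed (use w0 in simp_all)
  also have "\<dots> = inverse (w ^ j) * (\<Sum>z\<in>?U. inverse z ^ j)"
    by (simp add: sum_distrib_left power_mult_distrib power_inverse)
  finally have "(1 - inverse (w ^ j)) * (\<Sum>z\<in>?U. inverse z ^ j) = 0"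
    by (simp add: algebra_simps)
  moreover have "inverse (w ^ j) \<noteq> 1" using w by simp
  ultimately show ?thesis using False by simp
qed

section \<open>Tori and their points of finite order\<close>

text \<open>A regular function on a torus is a Laurent polynomial in each coordinate separately; \<open>x ^ N\<close> clears
  the denominator.\<close>

lemma laurent_polynomial_slice:
  assumes "p \<in> mult_torus_regular n"
  shows "\<exists>N q. \<forall>x. x \<noteq> 0 \<longrightarrow> p (t(k := x)) * x ^ N = poly q x"
  using assms unfolding mult_torus_regular_def
proof (induction rule: fun_algebra.induct)
  case (fun_algebra_gen e)
  then consider j where "e = (\<lambda>t. t j)" | j where "e = (\<lambda>t. inverse (t j))" by auto
  then show ?case
  proof cases
    case 1
    show ?thesis
      using 1 by (intro exI[of _ 0] exI[of _ "if j = k then [:0, 1:] else [:t j:]"]) auto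
  next
    case 2
    show ?thesis
    proof (cases "j = k")
      case True
      then show ?thesis using 2 by (intro exI[of _ 1] exI[of _ "[:1:]"]) auto
    next
      case False
      then show ?thesis using 2 by (intro exI[of _ 0] exI[of _ "[:inverse (t j):]"]) auto
    qed
  qed
next
  case (fun_algebra_const c)
  show ?case by (intro exI[of _ 0] exI[of _ "[:c:]"]) auto
next
  case (fun_algebra_add p q)
  then obtain N M P Q where PQ: "\<And>x. x \<noteq> 0 \<Longrightarrow> p (t(k := x)) * x ^ N = poly P x"
    "\<And>x. x \<noteq> 0 \<Longrightarrow> q (t(k := x)) * x ^ M = poly Q x" by blast
  show ?case
  proof (intro exI allI impI)
    fix x :: 'a assume x: "x \<noteq> 0"
    have "(p (t(k := x)) + q (t(k := x))) * x ^ (N + M) =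
        (p (t(k := x)) * x ^ N) * x ^ M + (q (t(k := x)) * x ^ M) * x ^ N"
      by (simp add: power_add algebra_simps)
    then show "(p (t(k := x)) + q (t(k := x))) * x ^ (N + M) = poly (P * monom 1 M + Q * monom 1 N) x"
      by (simp only: PQ[OF x] poly_add poly_mult poly_monom mult_1)
  qed
next
  case (fun_algebra_mult p q)
  then obtain N M P Q where PQ: "\<And>x. x \<noteq> 0 \<Longrightarrow> p (t(k := x)) * x ^ N = poly P x"
    "\<And>x. x \<noteq> 0 \<Longrightarrow> q (t(k := x)) * x ^ M = poly Q x" by blast
  show ?case
  proof (intro exI allI impI)
    fix x :: 'a assume x: "x \<noteq> 0"
    have "p (t(k := x)) * q (t(k := x)) * x ^ (N + M) =
        (p (t(k := x)) * x ^ N) * (q (t(k := x)) * x ^ M)"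
      by (simp add: power_add algebra_simps)
    then show "p (t(k := x)) * q (t(k := x)) * x ^ (N + M) = poly (P * Q) x"
      by (simp only: PQ[OF x] poly_mult)
  qed
qed

text \<open>The coordinates are released from \<open>M\<close> one at a time: a Laurent polynomial in one variable with
  infinitely many zeros vanishes.\<close>

lemma mult_torus_regular_vanish_on_grid:
  fixes p :: "(nat \<Rightarrow> 'f::field) \<Rightarrow> 'f"
  assumes p: "p \<in> mult_torus_regular n" and M: "infinite M" "0 \<notin> M"
    and van: "\<And>t. t \<in> {..<n} \<rightarrow>\<^sub>E M \<Longrightarrow> p t = 0"
    and t: "t \<in> carrier (mult_torus n)"
  shows "p t = 0"
proof -
  have "p t = 0" if "j \<le> n" "t \<in> carrier (mult_torus n)" "\<And>k. j \<le> k \<Longrightarrow> k < n \<Longrightarrow> t k \<in> M" for j t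
    using that
  proof (induction j arbitrary: t)
    case 0
    then show ?case by (intro van) (auto simp: mult_torus_def PiE_def)
  next
    case (Suc j)
    obtain N q where q: "\<And>x. x \<noteq> 0 \<Longrightarrow> p (t(j := x)) * x ^ N = poly q x"
      using laurent_polynomial_slice[OF p] by metis
    have "poly q x = 0" if "x \<in> M" for x
    proof -
      have x: "x \<noteq> 0" using that M by auto
      have "p (t(j := x)) = 0"
        using Suc.prems that x
        by (intro Suc.IH) (auto simp: mult_torus_def PiE_def extensional_def Pi_def)
      then show ?thesis using q[OF x] by simp
    qed
    then have "M \<subseteq> {x. poly q x = 0}" by blast
    then have "q = 0" using M poly_roots_finite finite_subset by blast
    moreover have "t j \<noteq> 0" using Suc.prems by (auto simp: mult_torus_def PiE_def Pi_def)
    ultimately show ?case using q[of "t j"] by simp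
  qed
  from this[of n t] t show ?thesis by simp
qed

lemma torus_subset_GL: "torus_of_dim scale n T \<Longrightarrow> T \<subseteq> carrier (GL scale)"
  unfolding torus_of_dim_def algebraic_subgroup_def by (meson subgroup.subset)

text \<open>The group-theoretic half of a parametrization of a torus.\<close>

definition mult_torus_action :: "nat \<Rightarrow> ((nat \<Rightarrow> 'f::field) \<Rightarrow> 'v \<Rightarrow> 'v) \<Rightarrow> bool" where
  "mult_torus_action n \<theta> \<longleftrightarrow>
     (\<forall>t\<in>carrier (mult_torus n). bij (\<theta> t)) \<and>
     (\<forall>s\<in>carrier (mult_torus n). \<forall>t\<in>carrier (mult_torus n).
        \<theta> (\<lambda>k\<in>{..<n}. s k * t k) = \<theta> s \<circ> \<theta> t)"

lemma mult_torus_action_mult: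
  assumes "mult_torus_action n \<theta>" "s \<in> carrier (mult_torus n)" "t \<in> carrier (mult_torus n)"
  shows "\<theta> (\<lambda>k\<in>{..<n}. s k * t k) = \<theta> s \<circ> \<theta> t"
  using assms unfolding mult_torus_action_def by blast

lemma torus_of_dimE:
  assumes "torus_of_dim scale n T"
  obtains \<theta> :: "(nat \<Rightarrow> 'f::field) \<Rightarrow> 'v::ab_group_add \<Rightarrow> 'v" where
    "bij_betw \<theta> (carrier (mult_torus n)) T"
    "mult_torus_action n \<theta>"
    "\<And>q. q \<in> GL_regular scale \<Longrightarrow>
       \<exists>p \<in> mult_torus_regular n. \<forall>t\<in>carrier (mult_torus n). q (\<theta> t) = p t"
proof -
  obtain \<theta> where \<theta>: "\<theta> \<in> iso (mult_torus n :: (nat \<Rightarrow> 'f) monoid) (GL scale\<lparr>carrier := T\<rparr>)"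
    "regular_map (carrier (mult_torus n)) (mult_torus_regular n) T (GL_regular scale) \<theta>"
    using assms unfolding torus_of_dim_def by blast
  show thesis
  proof (rule that[of \<theta>])
    show "bij_betw \<theta> (carrier (mult_torus n)) T" using \<theta>(1) by (simp add: iso_def)
    have "\<theta> (\<lambda>k\<in>{..<n}. s k * t k) = \<theta> s \<circ> \<theta> t"
      if "s \<in> carrier (mult_torus n)" "t \<in> carrier (mult_torus n)" for s t
    proof -
      have "\<theta> (s \<otimes>\<^bsub>mult_torus n\<^esub> t) = \<theta> s \<otimes>\<^bsub>GL scale\<lparr>carrier := T\<rparr>\<^esub> \<theta> t"
        using \<theta>(1) that by (auto simp: iso_def hom_def)
      then show ?thesis by (simp add: mult_torus_def GL_def)
    qed
    moreover have "bij (\<theta> t)" if "t \<in> carrier (mult_torus n)" for t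
    proof -
      have "\<theta> t \<in> T" using \<theta>(1) that by (auto simp: iso_def bij_betw_def)
      then show ?thesis using torus_subset_GL[OF assms] by (auto simp: GL_def)
    qed
    ultimately show "mult_torus_action n \<theta>" unfolding mult_torus_action_def by blast
    show "\<exists>p \<in> mult_torus_regular n. \<forall>t\<in>carrier (mult_torus n). q (\<theta> t) = p t"
      if "q \<in> GL_regular scale" for q
      using \<theta>(2) that by (auto simp: regular_map_def)
  qed
qed

lemma mult_torus_carrier: "carrier (mult_torus n) = {..<n} \<rightarrow>\<^sub>E (UNIV - {0})"
  by (simp add: mult_torus_def)

lemma mult_torus_power_closed:
  assumes t: "t \<in> carrier (mult_torus n)"
  shows "(\<lambda>k\<in>{..<n}. t k ^ m) \<in> carrier (mult_torus n)"
  unfolding mult_torus_carrier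
proof (rule PiE_I)
  fix k assume k: "k \<in> {..<n}"
  then have "t k \<noteq> 0" using t unfolding mult_torus_carrier by (metis Diff_iff PiE_mem singletonI)
  then show "(\<lambda>k\<in>{..<n}. t k ^ m) k \<in> UNIV - {0}" using k by simp
qed simp

lemma torus_param_power:
  fixes \<theta> :: "(nat \<Rightarrow> 'f::field) \<Rightarrow> 'v \<Rightarrow> 'v"
  assumes act: "mult_torus_action n \<theta>" and t: "t \<in> carrier (mult_torus n)"
  shows "\<theta> (\<lambda>k\<in>{..<n}. t k ^ m) = \<theta> t ^^ m"
proof (induction m)
  case 0
  let ?e = "\<lambda>k\<in>{..<n}. 1 :: 'f"
  have e: "?e \<in> carrier (mult_torus n)" by (auto simp: mult_torus_carrier)
  have "\<theta> ?e \<circ> \<theta> ?e = \<theta> (\<lambda>k\<in>{..<n}. ?e k * ?e k)"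
    using mult_torus_action_mult[OF act e e] by simp
  also have "(\<lambda>k\<in>{..<n}. ?e k * ?e k) = ?e" by auto
  finally have "\<theta> ?e (\<theta> ?e x) = \<theta> ?e x" for x by (metis comp_apply)
  then have "\<theta> ?e x = x" for x using act e unfolding mult_torus_action_def by (metis bij_is_inj injD)
  then have "\<theta> ?e = id" by (simp add: fun_eq_iff)
  then show ?case by (simp only: power_0 funpow.simps)
next
  case (Suc m)
  let ?u = "\<lambda>k\<in>{..<n}. t k ^ m"
  have u: "?u \<in> carrier (mult_torus n)" using t by (rule mult_torus_power_closed)
  have "(\<lambda>k\<in>{..<n}. t k ^ Suc m) = (\<lambda>k\<in>{..<n}. t k * ?u k)"
    by (rule restrict_ext) simp
  then have "\<theta> (\<lambda>k\<in>{..<n}. t k ^ Suc m) = \<theta> t \<circ> \<theta> ?u"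
    using mult_torus_action_mult[OF act t u] by (simp only:)
  then show ?case unfolding Suc.IH by (simp only: funpow.simps)
qed

lemma torus_param_one:
  assumes "mult_torus_action n \<theta>"
  shows "\<theta> (\<lambda>k\<in>{..<n}. 1) = id"
  using torus_param_power[OF assms, of "\<lambda>k\<in>{..<n}. 1" 0] by (simp add: mult_torus_carrier)

lemma torus_commute:
  fixes scale :: "'f::field \<Rightarrow> 'v::ab_group_add \<Rightarrow> 'v"
  assumes "torus_of_dim scale n T" "g \<in> T" "h \<in> T"
  shows "g \<circ> h = h \<circ> g"
proof -
  obtain \<theta> :: "(nat \<Rightarrow> 'f) \<Rightarrow> 'v \<Rightarrow> 'v" where \<theta>: "bij_betw \<theta> (carrier (mult_torus n)) T"
    "mult_torus_action n \<theta>"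
    "\<And>q. q \<in> GL_regular scale \<Longrightarrow>
       \<exists>p \<in> mult_torus_regular n. \<forall>t\<in>carrier (mult_torus n). q (\<theta> t) = p t"
    by (rule torus_of_dimE[OF assms(1)], rule that)
  obtain s t where st: "s \<in> carrier (mult_torus n)" "t \<in> carrier (mult_torus n)" "g = \<theta> s" "h = \<theta> t"
    using \<theta>(1) assms(2,3) unfolding bij_betw_def by blast
  have "(\<lambda>k\<in>{..<n}. s k * t k) = (\<lambda>k\<in>{..<n}. t k * s k)" by (simp add: mult.commute)
  then show ?thesis using mult_torus_action_mult[OF \<theta>(2) st(1,2)]
      mult_torus_action_mult[OF \<theta>(2) st(2,1)] st(3,4) by argo
qed

text \<open>Roots can be extracted coordinate by coordinate because the field is algebraically closed.\<close>

lemma torus_divisible: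
  fixes scale :: "'f::alg_closed_field \<Rightarrow> 'v::ab_group_add \<Rightarrow> 'v"
  assumes T: "torus_of_dim scale n T" and g: "g \<in> T" and m: "m > 0"
  shows "\<exists>h\<in>T. h ^^ m = g"
proof -
  obtain \<theta> :: "(nat \<Rightarrow> 'f) \<Rightarrow> 'v \<Rightarrow> 'v" where \<theta>: "bij_betw \<theta> (carrier (mult_torus n)) T"
    "mult_torus_action n \<theta>"
    "\<And>q. q \<in> GL_regular scale \<Longrightarrow>
       \<exists>p \<in> mult_torus_regular n. \<forall>t\<in>carrier (mult_torus n). q (\<theta> t) = p t"
    by (rule torus_of_dimE[OF T], rule that)
  obtain t where t: "t \<in> carrier (mult_torus n)" "g = \<theta> t"
    using \<theta>(1) g unfolding bij_betw_def by blast
  have "\<forall>k. \<exists>y. y ^ m = t k" using nth_root_exists[OF m] by blast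
  then obtain s where s: "\<And>k. s k ^ m = t k" by metis
  let ?s = "\<lambda>k\<in>{..<n}. s k"
  have "s k \<noteq> 0" if "k < n" for k
    using s[of k] t(1) that m by (auto simp: mult_torus_carrier PiE_def Pi_def power_0_left)
  then have s_carr: "?s \<in> carrier (mult_torus n)" by (auto simp: mult_torus_carrier)
  have "(\<lambda>k\<in>{..<n}. ?s k ^ m) = t"
    using s t(1) by (auto simp: mult_torus_carrier fun_eq_iff PiE_def extensional_def)
  then have "\<theta> ?s ^^ m = g"
    using torus_param_power[OF \<theta>(2) s_carr, of m] t by simp
  moreover have "\<theta> ?s \<in> T" using \<theta>(1) s_carr by (auto simp: bij_betw_def)
  ultimately show ?thesis by blast
qed

text \<open>The parametrization identifies the points killed by \<open>m\<close> with \<open>n\<close>-tuples of \<open>m\<close>-th roots of unity.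
  So the count recovers the dimension from the abstract group.\<close>

lemma card_torus_torsion:
  assumes T: "torus_of_dim (scale :: 'f::field \<Rightarrow> 'v::ab_group_add \<Rightarrow> 'v) n T" and m: "m > 0"
  shows "card {g \<in> T. g ^^ m = id} = card {z::'f. z ^ m = 1} ^ n"
proof -
  obtain \<theta> :: "(nat \<Rightarrow> 'f) \<Rightarrow> 'v \<Rightarrow> 'v" where \<theta>: "bij_betw \<theta> (carrier (mult_torus n)) T"
    "mult_torus_action n \<theta>"
    "\<And>q. q \<in> GL_regular scale \<Longrightarrow>
       \<exists>p \<in> mult_torus_regular n. \<forall>t\<in>carrier (mult_torus n). q (\<theta> t) = p t"
    by (rule torus_of_dimE[OF T], rule that)
  let ?U = "{..<n} \<rightarrow>\<^sub>E {z::'f. z ^ m = 1}"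
  have U: "?U \<subseteq> carrier (mult_torus n)"
    using m by (auto simp: mult_torus_carrier PiE_def Pi_def power_0_left)
  have one: "(\<lambda>k\<in>{..<n}. 1 :: 'f) \<in> carrier (mult_torus n)" by (auto simp: mult_torus_carrier)
  have \<theta>_one: "\<theta> (\<lambda>k\<in>{..<n}. 1) = id" using torus_param_one[OF \<theta>(2)] .
  have "\<theta> ` ?U = {g \<in> T. g ^^ m = id}"
  proof (intro equalityI subsetI)
    fix g assume "g \<in> \<theta> ` ?U"
    then obtain t where t: "t \<in> ?U" "g = \<theta> t" by blast
    then have tc: "t \<in> carrier (mult_torus n)" using U by blast
    have "(\<lambda>k\<in>{..<n}. t k ^ m) = (\<lambda>k\<in>{..<n}. 1)" using t by (auto simp: fun_eq_iff)
    then have "g ^^ m = id" using torus_param_power[OF \<theta>(2) tc, of m] t \<theta>_one by simp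
    then show "g \<in> {g \<in> T. g ^^ m = id}" using \<theta>(1) t tc by (auto simp: bij_betw_def)
  next
    fix g assume g: "g \<in> {g \<in> T. g ^^ m = id}"
    then obtain t where t: "t \<in> carrier (mult_torus n)" "g = \<theta> t"
      using \<theta>(1) by (auto simp: bij_betw_def)
    have "\<theta> (\<lambda>k\<in>{..<n}. t k ^ m) = \<theta> (\<lambda>k\<in>{..<n}. 1)"
      using torus_param_power[OF \<theta>(2) t(1), of m] t g \<theta>_one by simp
    moreover have "(\<lambda>k\<in>{..<n}. t k ^ m) \<in> carrier (mult_torus n)"
      using t(1) by (rule mult_torus_power_closed)
    ultimately have "(\<lambda>k\<in>{..<n}. t k ^ m) = (\<lambda>k\<in>{..<n}. 1)"
      using \<theta>(1) one unfolding bij_betw_def by (meson inj_onD)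
    then have "t k ^ m = 1" if "k < n" for k using that by (metis lessThan_iff restrict_apply')
    then have "t \<in> ?U" using t(1) by (auto simp: mult_torus_carrier PiE_def)
    then show "g \<in> \<theta> ` ?U" using t by blast
  qed
  moreover have "inj_on \<theta> ?U"
    using \<theta>(1) U unfolding bij_betw_def by (blast intro: inj_on_subset)
  ultimately have "card {g \<in> T. g ^^ m = id} = card ?U"
    using card_image by (metis (no_types))
  then show ?thesis by (simp add: card_funcsetE)
qed

text \<open>Zariski density of the points whose order is prime to the characteristic: they contain the image
  of the grid of tuples from \<^const>\<open>torsion_units\<close>, on which a nonzero Laurent polynomial cannot
  vanish.\<close>

lemma torus_torsion_dense:
  assumes T: "torus_of_dim (scale :: 'f::alg_closed_field \<Rightarrow> 'v::ab_group_add \<Rightarrow> 'v) n T"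
    and q: "q \<in> GL_regular scale"
    and van: "\<And>g m. g \<in> T \<Longrightarrow> of_nat m \<noteq> (0::'f) \<Longrightarrow> g ^^ m = id \<Longrightarrow> q g = 0"
    and g: "g \<in> T"
  shows "q g = 0"
proof -
  obtain \<theta> :: "(nat \<Rightarrow> 'f) \<Rightarrow> 'v \<Rightarrow> 'v" where \<theta>: "bij_betw \<theta> (carrier (mult_torus n)) T"
    "mult_torus_action n \<theta>"
    "\<And>q. q \<in> GL_regular scale \<Longrightarrow>
       \<exists>p \<in> mult_torus_regular n. \<forall>t\<in>carrier (mult_torus n). q (\<theta> t) = p t"
    by (rule torus_of_dimE[OF T], rule that)
  have one: "(\<lambda>k\<in>{..<n}. 1 :: 'f) \<in> carrier (mult_torus n)" by (auto simp: mult_torus_carrier)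
  have \<theta>_one: "\<theta> (\<lambda>k\<in>{..<n}. 1) = id" using torus_param_one[OF \<theta>(2)] .
  obtain p where p: "p \<in> mult_torus_regular n" "\<And>t. t \<in> carrier (mult_torus n) \<Longrightarrow> q (\<theta> t) = p t"
    using \<theta>(3)[OF q] by blast
  have zero: "0 \<notin> (torsion_units :: 'f set)"
  proof
    assume "0 \<in> (torsion_units :: 'f set)"
    then obtain m where "of_nat m \<noteq> (0::'f)" "(0::'f) ^ m = 1" by (auto simp: torsion_units_def)
    then show False by (cases m) auto
  qed
  have "p t = 0" if t: "t \<in> {..<n} \<rightarrow>\<^sub>E torsion_units" for t
  proof -
    have tc: "t \<in> carrier (mult_torus n)" using t zero by (auto simp: mult_torus_carrier PiE_def Pi_def)
    have "\<forall>k\<in>{..<n}. \<exists>m. of_nat m \<noteq> (0::'f) \<and> t k ^ m = 1"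
      using t by (auto simp: torsion_units_def PiE_def Pi_def)
    then obtain m where m: "\<And>k. k < n \<Longrightarrow> of_nat (m k) \<noteq> (0::'f)" "\<And>k. k < n \<Longrightarrow> t k ^ m k = 1"
      by (metis lessThan_iff)
    let ?m = "\<Prod>k<n. m k"
    have "t k ^ ?m = 1" if "k < n" for k
    proof -
      have "m k dvd ?m" using that by (intro dvd_prodI) auto
      then show ?thesis using m(2)[OF that] by (auto simp: power_mult elim!: dvdE)
    qed
    then have "(\<lambda>k\<in>{..<n}. t k ^ ?m) = (\<lambda>k\<in>{..<n}. 1)" by (auto simp: fun_eq_iff)
    then have "\<theta> t ^^ ?m = id" using torus_param_power[OF \<theta>(2) tc, of ?m] \<theta>_one by simp
    moreover have "of_nat ?m \<noteq> (0::'f)" using m(1) by (simp add: of_nat_prod)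
    moreover have "\<theta> t \<in> T" using \<theta>(1) tc by (auto simp: bij_betw_def)
    ultimately show ?thesis using van p(2)[OF tc] by metis
  qed
  then have "p t = 0" if "t \<in> carrier (mult_torus n)" for t
    using mult_torus_regular_vanish_on_grid[OF p(1) infinite_torsion_units zero] that by blast
  then show ?thesis using g \<theta>(1) p(2) unfolding bij_betw_def by force
qed

lemma ex_many_roots_of_unity:
  obtains m where "m > 0" "of_nat m \<noteq> (0::'f::alg_closed_field)" "2 \<le> card {z::'f. z ^ m = 1}"
proof -
  obtain m where "2 \<le> m" "(of_nat m :: 'f) \<noteq> 0"
    using of_nat_or_of_nat_Suc_nonzero[of 2, where 'f = 'f] by (metis le_Suc_eq order_refl)
  then show thesis using that[of m] card_roots_of_unity[of m, where 'f = 'f] by simp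
qed

lemma torus_dim_mono:
  assumes T: "torus_of_dim (scale :: 'f::alg_closed_field \<Rightarrow> 'v::ab_group_add \<Rightarrow> 'v) n T"
    and T': "torus_of_dim scale n' T'" and sub: "T \<subseteq> T'"
  shows "n \<le> n'"
proof -
  obtain m where m: "m > 0" "2 \<le> card {z::'f. z ^ m = 1}" by (rule ex_many_roots_of_unity)
  let ?c = "card {z::'f. z ^ m = 1}"
  have "card {g \<in> T'. g ^^ m = id} > 0"
    unfolding card_torus_torsion[OF T' m(1)] using m by simp
  then have "finite {g \<in> T'. g ^^ m = id}" by (rule card_ge_0_finite)
  then have "?c ^ n \<le> ?c ^ n'"
    unfolding card_torus_torsion[OF T m(1), symmetric] card_torus_torsion[OF T' m(1), symmetric]
    using sub by (intro card_mono) auto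
  then show ?thesis using m by (simp add: power_increasing_iff)
qed

text \<open>For every \<open>m\<close> that is nonzero in the field, both tori have the same finite number of points killed
  by \<open>m\<close>, hence the same such points. Together these are dense in \<open>T'\<close> and \<open>T\<close> is closed.\<close>

lemma torus_subset_eq:
  assumes T: "torus_of_dim (scale :: 'f::alg_closed_field \<Rightarrow> 'v::ab_group_add \<Rightarrow> 'v) n T"
    and T': "torus_of_dim scale n T'" and sub: "T \<subseteq> T'"
  shows "T = T'"
proof
  obtain P where P: "P \<subseteq> GL_regular scale" "T = {g \<in> carrier (GL scale). \<forall>p\<in>P. p g = 0}"
  proof -
    have "closed_in_GL scale T" using T by (simp add: torus_of_dim_def algebraic_subgroup_def)
    then show thesis unfolding closed_in_GL_def by (elim exE conjE) (rule that)
  qed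
  show "T' \<subseteq> T"
  proof
    fix g assume g: "g \<in> T'"
    have "p g = 0" if p: "p \<in> P" for p
    proof (rule torus_torsion_dense[OF T' _ _ g])
      show "p \<in> GL_regular scale" using p P by blast
      fix h m assume h: "h \<in> T'" "of_nat m \<noteq> (0::'f)" "h ^^ m = id"
      have m: "m > 0" using h by (cases m) auto
      have "card {g \<in> T'. g ^^ m = id} > 0"
        unfolding card_torus_torsion[OF T' m] card_roots_of_unity[OF h(2)] using m by simp
      then have "finite {g \<in> T'. g ^^ m = id}" by (rule card_ge_0_finite)
      then have "{g \<in> T. g ^^ m = id} = {g \<in> T'. g ^^ m = id}"
        using sub card_torus_torsion[OF T' m] card_torus_torsion[OF T m] by (intro card_subset_eq) auto
      then have "h \<in> T" using h by blast
      then show "p h = 0" using P p by blast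
    qed
    then show "g \<in> T" using P(2) g torus_subset_GL[OF T'] by blast
  qed
qed (rule sub)

text \<open>Among the tori between \<open>T\<close> and \<open>H\<close> one of largest dimension is maximal for inclusion, since nested
  tori of equal dimension coincide.\<close>

lemma maximal_torus_above:
  assumes T: "torus_of_dim (scale :: 'f::alg_closed_field \<Rightarrow> 'v::ab_group_add \<Rightarrow> 'v) n T" "T \<subseteq> H"
    and bound: "\<And>n T. torus_of_dim scale n T \<Longrightarrow> n \<le> d"
  obtains n' T' where "maximal_torus scale H T'" "torus_of_dim scale n' T'" "n \<le> n'"
proof -
  define P where "P k \<longleftrightarrow> (\<exists>T'. torus_of_dim scale k T' \<and> T \<subseteq> T' \<and> T' \<subseteq> H)" for k
  define k where "k = (GREATEST k. P k)"
  have P_bound: "l \<le> d" if "P l" for l using that bound unfolding P_def by metis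
  have Pn: "P n" unfolding P_def using T by (intro exI[of _ T]) simp
  have k: "P k" "\<And>l. P l \<Longrightarrow> l \<le> k"
    unfolding k_def using GreatestI_nat[of P n d] Greatest_le_nat[of P _ d] Pn P_bound by metis+
  obtain T' where T': "torus_of_dim scale k T'" "T \<subseteq> T'" "T' \<subseteq> H"
    using k(1) unfolding P_def by metis
  have "maximal_torus scale H T'"
    unfolding maximal_torus_def
  proof (intro conjI allI impI)
    fix T'' assume T'': "torus scale T'' \<and> T'' \<subseteq> H \<and> T' \<subseteq> T''"
    then obtain l where l: "torus_of_dim scale l T''" unfolding torus_def by metis
    have "P l" unfolding P_def using l T'' T' by (intro exI[of _ T'']) blast
    then have "l \<le> k" by (rule k(2))
    moreover have "k \<le> l" by (rule torus_dim_mono[OF T'(1) l]) (use T'' in simp)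
    ultimately have "k = l" by simp
    then show "T'' = T'" using torus_subset_eq[OF T'(1), of T''] l T'' by metis
  next
    show "torus scale T'" unfolding torus_def using T'(1) by metis
  qed (rule T'(3))
  then show thesis using that T'(1) k(2)[OF Pn] by metis
qed

section \<open>Diagonalization of tori\<close>

locale alg_closed_fd_space = finite_dimensional_vector_space scale Basis
  for scale :: "'f::alg_closed_field \<Rightarrow> 'v::ab_group_add \<Rightarrow> 'v" and Basis :: "'v set"
begin

abbreviation endo :: "('v \<Rightarrow> 'v) \<Rightarrow> bool" where
  "endo \<equiv> Vector_Spaces.linear scale scale"

abbreviation functional :: "('v \<Rightarrow> 'f) \<Rightarrow> bool" where
  "functional \<equiv> Vector_Spaces.linear scale (*)"

lemma ex_separating_functional:
  assumes "subspace S" "v \<notin> S"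
  obtains l where "functional l" "\<And>x. x \<in> S \<Longrightarrow> l x = 0" "l v = 1"
proof -
  have vs: "vector_space ((*) :: 'f \<Rightarrow> 'f \<Rightarrow> 'f)" by unfold_locales (auto simp: algebra_simps)
  interpret P: vector_space_pair scale "(*) :: 'f \<Rightarrow> 'f \<Rightarrow> 'f"
    by (intro vector_space_pair.intro vs vector_space_axioms)
  obtain B where B: "B \<subseteq> S" "independent B" "S \<subseteq> span B"
    using basis_exists[of S] by metis
  have span_B: "span B = S" using B assms(1) span_minimal[of B S] by blast
  have ind: "independent (insert v B)"
    using B(2) assms(2) span_B by (intro independent_insertI) auto
  obtain l where l: "functional l" "\<And>x. x \<in> insert v B \<Longrightarrow> l x = (if x = v then 1 else 0)"
    using P.linear_independent_extend[OF ind, of "\<lambda>x. if x = v then 1 else 0"] by blast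
  have "v \<notin> B" using assms(2) B(1) by blast
  then have "l x = 0" if "x \<in> B" for x using l(2)[of x] that by auto
  then have "l x = 0" if "x \<in> S" for x
    using P.linear_eq_0_on_span[OF l(1), of B x] that span_B by blast
  then show thesis using that l by simp
qed

lemma GL_linear: "g \<in> carrier (GL scale) \<Longrightarrow> endo g"
  by (simp add: GL_def)

lemma linear_simps:
  assumes "endo g"
  shows "g (x + y) = g x + g y" "g (scale c x) = scale c (g x)" "g 0 = 0" "g (sum f A) = (\<Sum>a\<in>A. g (f a))"
proof -
  interpret g: Vector_Spaces.linear scale scale g by fact
  show "g (x + y) = g x + g y" "g (scale c x) = scale c (g x)" "g 0 = 0" "g (sum f A) = (\<Sum>a\<in>A. g (f a))"
    by (simp_all add: g.add g.scale g.sum)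
qed

text \<open>The component of \<open>v\<close> for the eigenvalue \<open>z\<close> is the average of \<open>z\<close> to the power \<open>- j\<close> times
  \<open>g\<close> to the power \<open>j\<close> applied to \<open>v\<close>.\<close>

lemma finite_order_eigenvector_decomposition:
  assumes lin: "endo g" and ord: "g ^^ m = id"
    and m: "of_nat m \<noteq> (0::'f)"
    and W: "subspace W" "g ` W \<subseteq> W" "v \<in> W"
  obtains w :: "'f \<Rightarrow> 'v" where "\<And>z. w z \<in> W" "\<And>z. z ^ m = 1 \<Longrightarrow> g (w z) = scale z (w z)"
    "v = (\<Sum>z | z ^ m = 1. w z)"
proof -
  have m0: "m > 0" using m by (cases m) auto
  let ?F = "\<lambda>z j. scale (inverse z ^ j) ((g ^^ j) v)"
  define w where "w z = scale (inverse (of_nat m)) (\<Sum>j<m. ?F z j)" for z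
  have pow_W: "(g ^^ j) v \<in> W" for j by (induction j) (use W in auto)
  show thesis
  proof (rule that)
    show "w z \<in> W" for z
      unfolding w_def by (intro subspace_scale subspace_sum W(1) pow_W)
    show "g (w z) = scale z (w z)" if z: "z ^ m = 1" for z
    proof -
      have z0: "z \<noteq> 0" using z m0 by (auto simp: power_0_left)
      have "g (?F z j) = scale z (?F z (Suc j))" for j
        using z0 by (simp add: linear_simps[OF lin] mult.assoc[symmetric])
      then have "g (w z) = scale (inverse (of_nat m)) (\<Sum>j<m. scale z (?F z (Suc j)))"
        by (simp only: w_def linear_simps[OF lin])
      also have "(\<Sum>j<m. scale z (?F z (Suc j))) = scale z (\<Sum>j<m. ?F z (Suc j))"
        by (simp only: scale_sum_right)
      also have "(\<Sum>j<m. ?F z (Suc j)) = (\<Sum>j<m. ?F z j)"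
      proof -
        have "?F z m = ?F z 0" using z ord by (simp add: power_inverse)
        moreover have "(\<Sum>j<m. ?F z j) + ?F z m = ?F z 0 + (\<Sum>j<m. ?F z (Suc j))"
          using sum.lessThan_Suc[of "?F z" m] sum.lessThan_Suc_shift[of "?F z" m] by simp
        ultimately show ?thesis by simp
      qed
      finally show ?thesis by (simp add: w_def mult.commute)
    qed
    have "(\<Sum>z | z ^ m = 1. w z) = scale (inverse (of_nat m)) (\<Sum>z | z ^ m = 1. \<Sum>j<m. ?F z j)"
      by (simp only: w_def scale_sum_right)
    also have "(\<Sum>z | z ^ m = 1. \<Sum>j<m. ?F z j) = (\<Sum>j<m. \<Sum>z | z ^ m = 1. ?F z j)"
      by (rule sum.swap)
    also have "\<dots> = (\<Sum>j<m. scale (if j = 0 then of_nat m else 0) ((g ^^ j) v))"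
      by (rule sum.cong) (auto simp: scale_sum_left[symmetric] sum_powers_roots_of_unity[OF m])
    also have "\<dots> = scale (of_nat m) v"
      using m0 by (subst sum.remove[of _ 0]) auto
    finally show "v = (\<Sum>z | z ^ m = 1. w z)" using m by simp
  qed
qed

text \<open>Induction on the dimension. If some member \<open>g\<close> of the family is not scalar on \<open>W\<close>, then \<open>W\<close> is the
  sum of the eigenspaces of \<open>g\<close> in \<open>W\<close>. These are proper subspaces, and the whole family preserves
  them because it commutes with \<open>g\<close>.\<close>

lemma commuting_finite_order_eigenvectors_span:
  assumes lin: "\<And>g. g \<in> G \<Longrightarrow> endo g"
    and comm: "\<And>g h. g \<in> G \<Longrightarrow> h \<in> G \<Longrightarrow> g \<circ> h = h \<circ> g"
    and ord: "\<And>g. g \<in> G \<Longrightarrow> \<exists>m. of_nat m \<noteq> (0::'f) \<and> g ^^ m = id"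
    and W: "subspace W" "\<And>g. g \<in> G \<Longrightarrow> g ` W \<subseteq> W"
  shows "W \<subseteq> span {v \<in> W. \<forall>g\<in>G. \<exists>c. g v = scale c v}"
  using W
proof (induction "dim W" arbitrary: W rule: less_induct)
  case less
  let ?E = "{v \<in> W. \<forall>g\<in>G. \<exists>c. g v = scale c v}"
  show ?case
  proof (cases "W \<subseteq> ?E")
    case True
    then show ?thesis using span_superset by blast
  next
    case False
    then obtain v g where vg: "v \<in> W" "g \<in> G" "\<And>c. g v \<noteq> scale c v" by blast
    obtain m where m: "of_nat m \<noteq> (0::'f)" "g ^^ m = id" using ord[OF vg(2)] by blast
    have eig: "{w \<in> W. g w = scale z w} \<subseteq> span ?E" for z
    proof -
      let ?W = "{w \<in> W. g w = scale z w}"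
      have sub: "subspace ?W"
        using less.prems(1) lin[OF vg(2)]
        by (auto simp: subspace_def linear_simps scale_right_distrib scale_left_commute)
      have inv: "h ` ?W \<subseteq> ?W" if h: "h \<in> G" for h
      proof
        fix y assume "y \<in> h ` ?W"
        then obtain w where w: "w \<in> W" "g w = scale z w" "y = h w" by blast
        have "g (h w) = h (g w)" using comm[OF vg(2) h] by (metis comp_apply)
        then show "y \<in> ?W"
          using w less.prems(2)[OF h] linear_simps(2)[OF lin[OF h]] by auto
      qed
      have "?W \<subset> W" using vg by blast
      then have "dim ?W < dim W"
        using sub less.prems(1) by (intro dim_psubset) (simp add: span_eq_iff[THEN iffD2])
      then have "?W \<subseteq> span {v \<in> ?W. \<forall>g\<in>G. \<exists>c. g v = scale c v}"
        using less.hyps[of ?W] sub inv by blast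
      also have "\<dots> \<subseteq> span ?E" by (rule span_mono) blast
      finally show ?thesis .
    qed
    show ?thesis
    proof
      fix u assume u: "u \<in> W"
      obtain w where w: "\<And>z. w z \<in> W" "\<And>z. z ^ m = 1 \<Longrightarrow> g (w z) = scale z (w z)"
        "u = (\<Sum>z | z ^ m = 1. w z)"
        using finite_order_eigenvector_decomposition[OF lin[OF vg(2)] m(2,1) less.prems(1) less.prems(2)[OF vg(2)] u]
        by blast
      show "u \<in> span ?E"
        unfolding w(3)
      proof (rule span_sum)
        fix z :: 'f assume "z \<in> {z. z ^ m = 1}"
        then have "w z \<in> {x \<in> W. g x = scale z x}" using w(1,2) by simp
        then show "w z \<in> span ?E" using eig by blast
      qed
    qed
  qed
qed

lemma GL_regular_matrix_entry:
  "functional l \<Longrightarrow> (\<lambda>g. l (g v)) \<in> GL_regular scale"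
  unfolding GL_regular_def by (rule fun_algebra.fun_algebra_gen, rule UnI1, rule CollectI,
      rule exI[of _ l], rule exI[of _ v]) (intro conjI refl)

text \<open>A torus is diagonalizable on every invariant subspace. The points of finite order prime to the
  characteristic are simultaneously diagonalizable. A common eigenvector \<open>v\<close> of these points is an
  eigenvector of the whole torus: the condition that \<open>g v\<close> lies on the line of \<open>v\<close> is Zariski
  closed, and these points are dense.\<close>

theorem torus_eigenvectors_span:
  assumes T: "torus_of_dim scale n T" and W: "subspace W" "\<And>g. g \<in> T \<Longrightarrow> g ` W \<subseteq> W"
  shows "W \<subseteq> span {v \<in> W. \<forall>g\<in>T. \<exists>c. g v = scale c v}"
proof -
  define G where "G = {g \<in> T. \<exists>m. of_nat m \<noteq> (0::'f) \<and> g ^^ m = id}"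
  have "W \<subseteq> span {v \<in> W. \<forall>g\<in>G. \<exists>c. g v = scale c v}"
  proof (rule commuting_finite_order_eigenvectors_span)
    show "endo g" if "g \<in> G" for g
      using that torus_subset_GL[OF T] GL_linear unfolding G_def by blast
    show "g \<circ> h = h \<circ> g" if "g \<in> G" "h \<in> G" for g h
      by (rule torus_commute[OF T]) (use that in \<open>simp_all add: G_def\<close>)
    show "\<exists>m. of_nat m \<noteq> (0::'f) \<and> g ^^ m = id" if "g \<in> G" for g
      using that by (simp add: G_def)
    show "g ` W \<subseteq> W" if "g \<in> G" for g using W(2) that by (simp add: G_def)
  qed (rule W(1))
  also have "{v \<in> W. \<forall>g\<in>G. \<exists>c. g v = scale c v} \<subseteq> {v \<in> W. \<forall>g\<in>T. \<exists>c. g v = scale c v}"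
  proof safe
    fix v g assume v: "v \<in> W" "\<forall>g\<in>G. \<exists>c. g v = scale c v" and g: "g \<in> T"
    show "\<exists>c. g v = scale c v"
    proof (rule ccontr)
      assume no: "\<nexists>c. g v = scale c v"
      have "g v \<notin> span {v}" using no by (auto simp: span_singleton)
      then obtain l where l: "functional l" "\<And>x. x \<in> span {v} \<Longrightarrow> l x = 0" "l (g v) = 1"
        using ex_separating_functional[OF subspace_span] by metis
      have "l (g v) = 0"
      proof (rule torus_torsion_dense[OF T GL_regular_matrix_entry[OF l(1)] _ g])
        fix h m assume "h \<in> T" "of_nat m \<noteq> (0::'f)" "h ^^ m = id"
        then have "h \<in> G" unfolding G_def by blast
        then obtain c where "h v = scale c v" using v by blast
        then show "l (h v) = 0" using l(2) by (simp add: span_base span_scale)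
      qed
      then show False using l(3) by simp
    qed
  qed
  then have "span {v \<in> W. \<forall>g\<in>G. \<exists>c. g v = scale c v} \<subseteq> span {v \<in> W. \<forall>g\<in>T. \<exists>c. g v = scale c v}"
    by (rule span_mono)
  finally show ?thesis .
qed

text \<open>In a basis of common eigenvectors the points killed by \<open>m\<close> become tuples of \<open>m\<close>-th roots of unity
  of length \<open>dimension\<close>. Comparing their number with \<open>card_torus_torsion\<close> gives the bound.\<close>

theorem torus_dim_le_dimension:
  assumes T: "torus_of_dim scale n T"
  shows "n \<le> dimension"
proof -
  define E where "E = {v. \<forall>g\<in>T. \<exists>c. g v = scale c v}"
  have "UNIV \<subseteq> span {v \<in> UNIV. \<forall>g\<in>T. \<exists>c. g v = scale c v}"
    by (rule torus_eigenvectors_span[OF T]) auto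
  then have span_E: "span E = UNIV" unfolding E_def by auto
  obtain B where B: "B \<subseteq> E" "independent B" "E \<subseteq> span B"
    using basis_exists[of E] by metis
  have fin: "finite B" using B(2) by (rule finiteI_independent)
  have span_B: "span B = UNIV"
    using span_mono[OF B(3)] span_E by (auto simp: span_span)
  have card_B: "card B = dimension"
    using basis_card_eq_dim[of B UNIV] B(2) span_B by (simp add: dimension_def)
  obtain m where m: "m > 0" "of_nat m \<noteq> (0::'f)" "2 \<le> card {z::'f. z ^ m = 1}"
    by (rule ex_many_roots_of_unity)
  let ?U = "{z::'f. z ^ m = 1}"
  define ev where "ev g = (\<lambda>b\<in>B. SOME c. g b = scale c b)" for g :: "'v \<Rightarrow> 'v"
  have b0: "b \<noteq> 0" if "b \<in> B" for b using B(2) that dependent_zero by metis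
  have ev: "g b = scale (ev g b) b" if "g \<in> T" "b \<in> B" for g b
    using that B(1) someI_ex[of "\<lambda>c. g b = scale c b"] unfolding ev_def E_def by auto
  have lin: "endo g" if "g \<in> T" for g
    using that torus_subset_GL[OF T] GL_linear by blast
  have ev_U: "ev ` {g \<in> T. g ^^ m = id} \<subseteq> B \<rightarrow>\<^sub>E ?U"
  proof (rule image_subsetI)
    fix g assume "g \<in> {g \<in> T. g ^^ m = id}"
    then have g: "g \<in> T" "g ^^ m = id" by simp_all
    show "ev g \<in> B \<rightarrow>\<^sub>E ?U"
    proof (rule PiE_I)
      fix b assume b: "b \<in> B"
      have "(g ^^ j) b = scale (ev g b ^ j) b" for j
        by (induction j) (simp_all add: linear_simps[OF lin[OF g(1)]] ev[OF g(1) b] mult.commute)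
      from this[of m] have "scale (ev g b ^ m) b = scale 1 b" using g(2) by simp
      then have "ev g b ^ m = 1" using b0[OF b] by (simp only: scale_cancel_right) simp
      then show "ev g b \<in> ?U" by simp
    qed (simp add: ev_def)
  qed
  have inj: "inj_on ev {g \<in> T. g ^^ m = id}"
  proof (rule inj_onI)
    fix g h assume gh: "g \<in> {g \<in> T. g ^^ m = id}" "h \<in> {g \<in> T. g ^^ m = id}" "ev g = ev h"
    interpret P: vector_space_pair scale scale
      by (intro vector_space_pair.intro vector_space_axioms)
    show "g = h"
    proof
      fix v
      show "g v = h v"
      proof (rule P.linear_eq_on[of g h v B])
        show "endo g" "endo h"
          using gh lin by simp_all
        show "v \<in> span B" using span_B by simp
        show "g b = h b" if "b \<in> B" for b using ev[of g b] ev[of h b] gh that by simp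
      qed
    qed
  qed
  have "finite (B \<rightarrow>\<^sub>E ?U)"
    using fin finite_roots_of_unity[OF m(2)] by (intro finite_PiE)
  then have "card {g \<in> T. g ^^ m = id} \<le> card (B \<rightarrow>\<^sub>E ?U)"
    by (rule card_inj_on_le[OF inj ev_U])
  then have "card ?U ^ n \<le> card ?U ^ card B"
    by (simp only: card_torus_torsion[OF T m(1)] card_funcsetE[OF fin])
  then show ?thesis using m(3) card_B by (simp add: power_increasing_iff)
qed

end

section \<open>Regular functions and monomials\<close>

lemma fun_algebra_sum:
  assumes "finite A" "\<And>a. a \<in> A \<Longrightarrow> p a \<in> fun_algebra E"
  shows "(\<lambda>x. \<Sum>a\<in>A. p a x) \<in> fun_algebra E"
  using assms
proof (induction A)
  case empty
  then show ?case using fun_algebra.fun_algebra_const[of 0 E] by simp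
next
  case (insert a A)
  then show ?case using fun_algebra.fun_algebra_add[of "p a" E "\<lambda>x. \<Sum>a\<in>A. p a x"] by simp
qed

lemma fun_algebra_prod:
  assumes "finite A" "\<And>a. a \<in> A \<Longrightarrow> p a \<in> fun_algebra E"
  shows "(\<lambda>x. \<Prod>a\<in>A. p a x) \<in> fun_algebra E"
  using assms
proof (induction A)
  case empty
  then show ?case using fun_algebra.fun_algebra_const[of 1 E] by simp
next
  case (insert a A)
  then show ?case using fun_algebra.fun_algebra_mult[of "p a" E "\<lambda>x. \<Prod>a\<in>A. p a x"] by simp
qed

lemma fun_algebra_power:
  assumes "p \<in> fun_algebra E"
  shows "(\<lambda>x. p x ^ n) \<in> fun_algebra E"
  using fun_algebra_prod[of "{..<n}" "\<lambda>_. p" E] assms by simp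

lemma fun_algebra_diff:
  assumes "p \<in> fun_algebra E" "q \<in> fun_algebra E"
  shows "(\<lambda>x. p x - q x) \<in> fun_algebra E"
  using fun_algebra.fun_algebra_add[OF assms(1)
      fun_algebra.fun_algebra_mult[OF fun_algebra.fun_algebra_const[of "-1" E] assms(2)]]
  by simp

text \<open>The integer power of \<open>x\<close> written polynomially in \<open>x\<close> and an element \<open>y\<close> standing for the
  inverse of \<open>x\<close>.\<close>

definition powi_pair :: "'f::field \<Rightarrow> 'f \<Rightarrow> int \<Rightarrow> 'f" where
  "powi_pair x y n = (if 0 \<le> n then x ^ nat n else y ^ nat (- n))"

lemma powi_pair_inverse: "powi_pair x (inverse x) n = x powi n"
  by (simp add: powi_pair_def power_int_def)

lemma fun_algebra_powi_pair:
  assumes "p \<in> fun_algebra E" "q \<in> fun_algebra E"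
  shows "(\<lambda>x. powi_pair (p x) (q x) n) \<in> fun_algebra E"
  using assms by (cases "0 \<le> n") (simp_all add: powi_pair_def fun_algebra_power)

lemma regular_map_fun_algebra:
  assumes "\<theta> ` X \<subseteq> Y"
    and gen: "\<And>e. e \<in> E \<Longrightarrow> \<exists>p\<in>fun_algebra E'. \<forall>x\<in>X. e (\<theta> x) = p x"
  shows "regular_map X (fun_algebra E') Y (fun_algebra E) \<theta>"
  unfolding regular_map_def
proof (intro conjI assms(1) ballI)
  fix q assume "q \<in> fun_algebra E"
  then show "\<exists>p\<in>fun_algebra E'. \<forall>x\<in>X. q (\<theta> x) = p x"
  proof (induction rule: fun_algebra.induct)
    case (fun_algebra_const c)
    show ?case by (rule bexI[OF _ fun_algebra.fun_algebra_const[of c]]) simp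
  next
    case (fun_algebra_add q q')
    then obtain p p' where "p \<in> fun_algebra E'" "p' \<in> fun_algebra E'"
      "\<forall>x\<in>X. q (\<theta> x) = p x" "\<forall>x\<in>X. q' (\<theta> x) = p' x" by blast
    then show ?case by (intro bexI[OF _ fun_algebra.fun_algebra_add[of p _ p']]) simp_all
  next
    case (fun_algebra_mult q q')
    then obtain p p' where "p \<in> fun_algebra E'" "p' \<in> fun_algebra E'"
      "\<forall>x\<in>X. q (\<theta> x) = p x" "\<forall>x\<in>X. q' (\<theta> x) = p' x" by blast
    then show ?case by (intro bexI[OF _ fun_algebra.fun_algebra_mult[of p _ p']]) simp_all
  qed (rule gen)
qed

definition monomial :: "nat \<Rightarrow> (nat \<Rightarrow> int) \<Rightarrow> (nat \<Rightarrow> 'f::field) \<Rightarrow> 'f" where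
  "monomial r a t = (\<Prod>k<r. t k powi a k)"

lemma mult_torus_nonzero: "t \<in> carrier (mult_torus r) \<Longrightarrow> k < r \<Longrightarrow> t k \<noteq> 0"
  unfolding mult_torus_carrier by (metis Diff_iff PiE_mem lessThan_iff singletonI)

lemma monomial_nonzero: "t \<in> carrier (mult_torus r) \<Longrightarrow> monomial r a t \<noteq> 0"
  unfolding monomial_def using mult_torus_nonzero[of t r] by simp

lemma monomial_mult: "monomial r a (\<lambda>k\<in>{..<r}. s k * t k) = monomial r a s * monomial r a t"
  by (simp add: monomial_def power_int_mult_distrib prod.distrib)

lemma prod_powi:
  assumes "(x::'f::field) \<noteq> 0"
  shows "(\<Prod>a\<in>A. x powi f a) = x powi (\<Sum>a\<in>A. f a)"
  using assms by (induction A rule: infinite_finite_induct) (simp_all add: power_int_add)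

lemma powi_prod: "(\<Prod>a\<in>A. f a) powi n = (\<Prod>a\<in>A. (f a :: 'f::field) powi n)"
  by (induction A rule: infinite_finite_induct) (simp_all add: power_int_mult_distrib)

lemma monomial_add:
  assumes "t \<in> carrier (mult_torus r)"
  shows "monomial r (\<lambda>k. a k + b k) t = monomial r a t * monomial r b t"
  unfolding monomial_def prod.distrib[symmetric]
  by (rule prod.cong) (use mult_torus_nonzero[OF assms] in \<open>auto simp: power_int_add\<close>)

text \<open>The monomials with exponents \<open>a X\<close> recover the coordinates of \<open>t\<close> when the exponent vectors
  generate the integer lattice; \<open>n\<close> expresses the \<open>k\<close>-th unit vector in them.\<close>

lemma monomial_combination:
  assumes t: "t \<in> carrier (mult_torus r)" and k: "k < r"
    and n: "\<And>j. j < r \<Longrightarrow> (\<Sum>X\<in>A. n X * a X j) = (if j = k then 1 else 0)"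
  shows "(\<Prod>X\<in>A. monomial r (a X) t powi n X) = t k"
proof -
  have "(\<Prod>X\<in>A. monomial r (a X) t powi n X) = (\<Prod>X\<in>A. \<Prod>j<r. t j powi (n X * a X j))"
    by (simp add: monomial_def powi_prod power_int_mult[symmetric] mult.commute)
  also have "\<dots> = (\<Prod>j<r. \<Prod>X\<in>A. t j powi (n X * a X j))"
    by (rule prod.swap)
  also have "\<dots> = (\<Prod>j<r. t j powi (if j = k then 1 else 0))"
    by (rule prod.cong) (use mult_torus_nonzero[OF t] n in \<open>auto simp: prod_powi\<close>)
  also have "\<dots> = (\<Prod>j<r. if j = k then t j else 1)"
    by (rule prod.cong) auto
  also have "\<dots> = t k" using k by (simp add: prod.delta)
  finally show ?thesis .
qed

section \<open>Direct sums and diagonal operators\<close>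

context alg_closed_fd_space
begin

lemma linear_comp:
  assumes "endo g" "endo h"
  shows "endo (g \<circ> h)"
  unfolding Vector_Spaces.linear_iff using vector_space_axioms
  by (simp add: linear_simps[OF assms(1)] linear_simps[OF assms(2)])

lemma group_GL: "group (GL scale)"
proof (rule groupI)
  show "\<one>\<^bsub>GL scale\<^esub> \<in> carrier (GL scale)" using linear_id by (simp add: GL_def)
  show "g \<otimes>\<^bsub>GL scale\<^esub> h \<in> carrier (GL scale)"
    if "g \<in> carrier (GL scale)" "h \<in> carrier (GL scale)" for g h
    using that by (simp add: GL_def bij_comp linear_comp)
  show "\<exists>h\<in>carrier (GL scale). h \<otimes>\<^bsub>GL scale\<^esub> g = \<one>\<^bsub>GL scale\<^esub>" if g: "g \<in> carrier (GL scale)" for g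
  proof -
    have lin: "endo g" and bij: "bij g" using g by (simp_all add: GL_def)
    have inj: "inj g" and surj: "surj g" using bij by (simp_all add: bij_def)
    have "inv_into UNIV g (x + y) = inv_into UNIV g x + inv_into UNIV g y" for x y
      by (rule injD[OF inj]) (simp add: linear_simps[OF lin] surj_f_inv_f[OF surj])
    moreover have "inv_into UNIV g (scale c x) = scale c (inv_into UNIV g x)" for c x
      by (rule injD[OF inj]) (simp add: linear_simps[OF lin] surj_f_inv_f[OF surj])
    ultimately have "endo (inv_into UNIV g)"
      unfolding Vector_Spaces.linear_iff using vector_space_axioms by blast
    then have "inv_into UNIV g \<in> carrier (GL scale)" using bij by (simp add: GL_def bij_imp_bij_inv)
    moreover have "inv_into UNIV g \<otimes>\<^bsub>GL scale\<^esub> g = \<one>\<^bsub>GL scale\<^esub>" using inj by (simp add: GL_def)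
    ultimately show ?thesis by blast
  qed
qed (simp_all add: GL_def comp_assoc)

text \<open>The summands of \<open>v\<close>, in the form in which the uniqueness clause of
  \<^const>\<open>direct_sum_decomposition\<close> provides them.\<close>

definition component :: "'v set set \<Rightarrow> 'v \<Rightarrow> 'v set \<Rightarrow> 'v" where
  "component \<Gamma> v = (THE f. (\<forall>X\<in>\<Gamma>. f X \<in> X) \<and> (\<forall>X. X \<notin> \<Gamma> \<longrightarrow> f X = 0) \<and>
               finite {X. f X \<noteq> 0} \<and> v = (\<Sum>X | f X \<noteq> 0. f X))"

definition diag :: "'v set set \<Rightarrow> ('v set \<Rightarrow> 'f) \<Rightarrow> 'v \<Rightarrow> 'v" where
  "diag \<Gamma> w v = (\<Sum>X\<in>\<Gamma>. scale (w X) (component \<Gamma> v X))"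

lemma sum_support:
  assumes "finite F" "\<And>X. X \<notin> F \<Longrightarrow> f X = (0::'v)"
  shows "(\<Sum>X | f X \<noteq> 0. f X) = (\<Sum>X\<in>F. f X)"
  using assms by (intro sum.mono_neutral_left) auto

lemma direct_sum_zero:
  assumes ds: "direct_sum_decomposition scale \<Gamma>" and F: "finite F" "F \<subseteq> \<Gamma>"
    and f: "\<And>X. X \<in> F \<Longrightarrow> f X \<in> X" "(\<Sum>X\<in>F. f X) = 0" and X: "X \<in> F"
  shows "f X = 0"
proof -
  let ?P = "\<lambda>g. (\<forall>X\<in>\<Gamma>. g X \<in> X) \<and> (\<forall>X. X \<notin> \<Gamma> \<longrightarrow> g X = 0) \<and>
               finite {X. g X \<noteq> 0} \<and> 0 = (\<Sum>X | g X \<noteq> 0. g X)"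
  let ?f = "\<lambda>X. if X \<in> F then f X else 0"
  have sub: "0 \<in> X" if "X \<in> \<Gamma>" for X
    using ds that subspace_0 unfolding direct_sum_decomposition_def by blast
  have "(\<Sum>X | ?f X \<noteq> 0. ?f X) = (\<Sum>X\<in>F. ?f X)" by (rule sum_support) (use F in auto)
  then have sum: "0 = (\<Sum>X | ?f X \<noteq> 0. ?f X)" using f(2) by simp
  have "finite {X. ?f X \<noteq> 0}" by (rule finite_subset[OF _ F(1)]) auto
  then have Pf: "?P ?f" using sub f(1) F(2) sum by auto
  have P0: "?P (\<lambda>_. 0)" using sub by simp
  have ex1: "\<exists>!g. ?P g" using ds unfolding direct_sum_decomposition_def by blast
  have "?f = (\<lambda>_. 0)"
    by (rule trans[OF sym[OF the1_equality[of ?P, OF ex1 Pf]] the1_equality[of ?P, OF ex1 P0]])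
  then have "?f X = 0" by (rule fun_cong)
  then show ?thesis using X by simp
qed

lemma span_Union_decomposition:
  assumes sub: "\<And>X. X \<in> \<Gamma> \<Longrightarrow> subspace X" and v: "v \<in> span (\<Union>\<Gamma>)"
  shows "\<exists>f. (\<forall>X\<in>\<Gamma>. f X \<in> X) \<and> (\<forall>X. X \<notin> \<Gamma> \<longrightarrow> f X = 0) \<and>
               finite {X. f X \<noteq> 0} \<and> v = (\<Sum>X | f X \<noteq> 0. f X)"
  using v
proof (induction rule: span_induct_alt)
  case base
  show ?case using sub subspace_0 by (intro exI[of _ "\<lambda>_. 0"]) simp
next
  case (step c x y)
  then obtain f where f: "\<forall>X\<in>\<Gamma>. f X \<in> X" "\<forall>X. X \<notin> \<Gamma> \<longrightarrow> f X = 0"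
    "finite {X. f X \<noteq> 0}" "y = (\<Sum>X | f X \<noteq> 0. f X)" by blast
  obtain X where X: "X \<in> \<Gamma>" "x \<in> X" using step by blast
  let ?F = "insert X {X. f X \<noteq> 0}" and ?g = "f(X := f X + scale c x)"
  have "?g Y \<in> Y" if "Y \<in> \<Gamma>" for Y
    using f(1) X that sub[of X] by (auto intro: subspace_add subspace_scale)
  moreover have "finite {Y. ?g Y \<noteq> 0}"
    by (rule finite_subset[of _ ?F]) (use f(3) in auto)
  moreover have "(\<Sum>Y | ?g Y \<noteq> 0. ?g Y) = scale c x + y"
  proof -
    have "(\<Sum>Y | ?g Y \<noteq> 0. ?g Y) = (\<Sum>Y\<in>?F. ?g Y)" by (rule sum_support) (use f(3) in auto)
    also have "\<dots> = ?g X + (\<Sum>Y\<in>?F - {X}. ?g Y)" by (rule sum.remove) (use f(3) in auto)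
    also have "(\<Sum>Y\<in>?F - {X}. ?g Y) = (\<Sum>Y\<in>?F - {X}. f Y)" by (rule sum.cong) auto
    also have "?g X + \<dots> = scale c x + (f X + (\<Sum>Y\<in>?F - {X}. f Y))" by (simp add: add_ac)
    also have "f X + (\<Sum>Y\<in>?F - {X}. f Y) = (\<Sum>Y\<in>?F. f Y)"
      by (rule sum.remove[symmetric]) (use f(3) in auto)
    also have "(\<Sum>Y\<in>?F. f Y) = y"
      unfolding f(4) by (rule sum_support[symmetric]) (use f(3) in auto)
    finally show ?thesis .
  qed
  ultimately show ?case using f(2) X(1) by (intro exI[of _ ?g]) auto
qed

lemma direct_sum_decompositionI:
  assumes sub: "\<And>X. X \<in> \<Gamma> \<Longrightarrow> subspace X" and span: "span (\<Union>\<Gamma>) = UNIV"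
    and zero: "\<And>F f X. finite F \<Longrightarrow> F \<subseteq> \<Gamma> \<Longrightarrow> (\<And>X. X \<in> F \<Longrightarrow> f X \<in> X) \<Longrightarrow>
       (\<Sum>X\<in>F. f X) = 0 \<Longrightarrow> X \<in> F \<Longrightarrow> f X = 0"
  shows "direct_sum_decomposition scale \<Gamma>"
  unfolding direct_sum_decomposition_def
proof (intro conjI ballI allI ex_ex1I)
  fix v
  show "\<exists>f. (\<forall>X\<in>\<Gamma>. f X \<in> X) \<and> (\<forall>X. X \<notin> \<Gamma> \<longrightarrow> f X = 0) \<and>
               finite {X. f X \<noteq> 0} \<and> v = (\<Sum>X | f X \<noteq> 0. f X)"
    by (rule span_Union_decomposition) (use sub span in auto)
  fix f g assume f: "(\<forall>X\<in>\<Gamma>. f X \<in> X) \<and> (\<forall>X. X \<notin> \<Gamma> \<longrightarrow> f X = 0) \<and>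
               finite {X. f X \<noteq> 0} \<and> v = (\<Sum>X | f X \<noteq> 0. f X)"
    and g: "(\<forall>X\<in>\<Gamma>. g X \<in> X) \<and> (\<forall>X. X \<notin> \<Gamma> \<longrightarrow> g X = 0) \<and>
               finite {X. g X \<noteq> 0} \<and> v = (\<Sum>X | g X \<noteq> 0. g X)"
  let ?F = "{X. f X \<noteq> 0} \<union> {X. g X \<noteq> 0}"
  have F: "finite ?F" "?F \<subseteq> \<Gamma>" using f g by auto
  have "v = (\<Sum>X\<in>?F. f X)"
  proof -
    have "v = (\<Sum>X | f X \<noteq> 0. f X)" using f by blast
    also have "\<dots> = (\<Sum>X\<in>?F. f X)" by (rule sum_support[OF F(1)]) simp
    finally show ?thesis .
  qed
  moreover have "v = (\<Sum>X\<in>?F. g X)"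
  proof -
    have "v = (\<Sum>X | g X \<noteq> 0. g X)" using g by blast
    also have "\<dots> = (\<Sum>X\<in>?F. g X)" by (rule sum_support[OF F(1)]) simp
    finally show ?thesis .
  qed
  ultimately have "(\<Sum>X\<in>?F. f X) = (\<Sum>X\<in>?F. g X)" by (rule trans[OF sym])
  then have "(\<Sum>X\<in>?F. f X - g X) = 0" by (simp add: sum_subtractf)
  moreover have "f X - g X \<in> X" if "X \<in> ?F" for X
    using f g F(2) that sub[of X] by (intro subspace_diff) auto
  ultimately have "f X - g X = 0" if "X \<in> ?F" for X
    using zero[of ?F "\<lambda>X. f X - g X" X] F that by blast
  then have "f X = g X" if "X \<in> ?F" for X using that by simp
  moreover have "f X = g X" if "X \<notin> ?F" for X using that by simp
  ultimately show "f = g" by blast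
qed (rule sub)

text \<open>Nonzero vectors chosen in distinct summands are linearly independent.\<close>

lemma finite_direct_sum:
  assumes ds: "direct_sum_decomposition scale \<Gamma>" and nz: "\<And>X. X \<in> \<Gamma> \<Longrightarrow> X \<noteq> {0}"
  shows "finite \<Gamma>"
proof (rule ccontr)
  assume "infinite \<Gamma>"
  then obtain A where A: "finite A" "card A = Suc dimension" "A \<subseteq> \<Gamma>"
    using infinite_arbitrarily_large by blast
  have sub: "subspace X" if "X \<in> \<Gamma>" for X
    using ds that unfolding direct_sum_decomposition_def by blast
  have "\<forall>X\<in>\<Gamma>. \<exists>v\<in>X. v \<noteq> 0" using nz sub subspace_0 by blast
  then obtain v where v: "\<And>X. X \<in> \<Gamma> \<Longrightarrow> v X \<in> X" "\<And>X. X \<in> \<Gamma> \<Longrightarrow> v X \<noteq> 0" by metis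
  have zero: "c X = 0" if "(\<Sum>X\<in>A. scale (c X) (v X)) = 0" "X \<in> A" for c X
  proof -
    have "scale (c X) (v X) = 0"
    proof (rule direct_sum_zero[OF ds A(1,3)])
      show "scale (c Y) (v Y) \<in> Y" if "Y \<in> A" for Y
        using that A(3) v(1) sub by (intro subspace_scale) auto
    qed (use that in auto)
    then show ?thesis using v(2) A(3) that(2) by auto
  qed
  have inj: "inj_on v A"
  proof (rule inj_onI, rule ccontr)
    fix X Y assume XY: "X \<in> A" "Y \<in> A" "v X = v Y" "X \<noteq> Y"
    let ?c = "\<lambda>Z. if Z = X then 1 else if Z = Y then - 1 else (0::'f)"
    have "(\<Sum>Z\<in>A. scale (?c Z) (v Z)) = (\<Sum>Z\<in>{X, Y}. scale (?c Z) (v Z))"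
      by (rule sum.mono_neutral_right) (use A(1) XY in auto)
    also have "\<dots> = 0" using XY by simp
    finally have "?c X = 0" by (rule zero) (rule XY)
    then show False by simp
  qed
  have "independent (v ` A)"
  proof (rule independent_if_scalars_zero)
    fix c x assume c: "(\<Sum>x\<in>v ` A. scale (c x) x) = 0" and "x \<in> v ` A"
    then obtain X where X: "X \<in> A" "x = v X" by blast
    have "(\<Sum>X\<in>A. scale (c (v X)) (v X)) = 0" using c by (simp add: sum.reindex[OF inj])
    then show "c x = 0" using zero[of "\<lambda>X. c (v X)" X] X by simp
  qed (use A in simp)
  then have "card (v ` A) \<le> dim (UNIV :: 'v set)"
    by (intro independent_card_le_dim) auto
  then show False using A(2) by (simp add: card_image[OF inj] dimension_def)
qed

end

locale finite_decomposition = alg_closed_fd_space scale Basis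
  for scale :: "'f::alg_closed_field \<Rightarrow> 'v::ab_group_add \<Rightarrow> 'v" and Basis :: "'v set" +
  fixes \<Gamma> :: "'v set set"
  assumes ds: "direct_sum_decomposition scale \<Gamma>" and nonzero: "\<And>X. X \<in> \<Gamma> \<Longrightarrow> X \<noteq> {0}"
begin

lemma subspace_component: "X \<in> \<Gamma> \<Longrightarrow> subspace X"
  using ds unfolding direct_sum_decomposition_def by blast

lemma finite_components: "finite \<Gamma>"
  using finite_direct_sum[OF ds] nonzero by blast

lemma component_spec:
  shows component_mem: "X \<in> \<Gamma> \<Longrightarrow> component \<Gamma> v X \<in> X" and component_sum: "(\<Sum>X\<in>\<Gamma>. component \<Gamma> v X) = v"
proof -
  let ?P = "\<lambda>f. (\<forall>X\<in>\<Gamma>. f X \<in> X) \<and> (\<forall>X. X \<notin> \<Gamma> \<longrightarrow> f X = 0) \<and>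
               finite {X. f X \<noteq> 0} \<and> v = (\<Sum>X | f X \<noteq> 0. f X)"
  have "\<exists>!f. ?P f" using ds unfolding direct_sum_decomposition_def by blast
  then have P: "?P (component \<Gamma> v)" unfolding component_def by (rule theI')
  then show "X \<in> \<Gamma> \<Longrightarrow> component \<Gamma> v X \<in> X" by blast
  show "(\<Sum>X\<in>\<Gamma>. component \<Gamma> v X) = v" 
  proof -
    have "v = (\<Sum>X | component \<Gamma> v X \<noteq> 0. component \<Gamma> v X)" using P by blast
    also have "\<dots> = (\<Sum>X\<in>\<Gamma>. component \<Gamma> v X)"
      by (rule sum_support[OF finite_components]) (use P in blast)
    finally show ?thesis by (rule sym)
  qed
qed

lemma component_unique:
  assumes "\<And>X. X \<in> \<Gamma> \<Longrightarrow> f X \<in> X" "(\<Sum>X\<in>\<Gamma>. f X) = v" "X \<in> \<Gamma>"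
  shows "component \<Gamma> v X = f X"
proof -
  have "component \<Gamma> v X - f X = 0"
  proof (rule direct_sum_zero[OF ds finite_components subset_refl])
    show "component \<Gamma> v X - f X \<in> X" if "X \<in> \<Gamma>" for X
      using that assms(1) component_mem subspace_component by (intro subspace_diff) auto
    show "(\<Sum>X\<in>\<Gamma>. component \<Gamma> v X - f X) = 0" by (simp add: sum_subtractf component_sum assms(2))
  qed (rule assms(3))
  then show ?thesis by simp
qed

lemma component_of_member:
  assumes "v \<in> X" "X \<in> \<Gamma>" "Y \<in> \<Gamma>"
  shows "component \<Gamma> v Y = (if Y = X then v else 0)"
proof (rule component_unique)
  show "(if Y = X then v else 0) \<in> Y" if "Y \<in> \<Gamma>" for Y
    using assms that subspace_component subspace_0 by auto
  show "(\<Sum>Y\<in>\<Gamma>. if Y = X then v else 0) = v" using finite_components assms by (simp add: sum.delta)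
qed (rule assms(3))

lemma linear_diag: "endo (diag \<Gamma> w)"
proof -
  have add: "component \<Gamma> (u + v) X = component \<Gamma> u X + component \<Gamma> v X" if "X \<in> \<Gamma>" for u v X
    using component_mem component_sum subspace_component that
    by (intro component_unique) (auto simp: sum.distrib intro: subspace_add)
  have scl: "component \<Gamma> (scale c v) X = scale c (component \<Gamma> v X)" if "X \<in> \<Gamma>" for c v X
    using component_mem component_sum subspace_component that
    by (intro component_unique) (auto simp: scale_sum_right[symmetric] intro: subspace_scale)
  have "diag \<Gamma> w (u + v) = diag \<Gamma> w u + diag \<Gamma> w v" for u v
    unfolding diag_def sum.distrib[symmetric]
    by (rule sum.cong) (simp_all add: add scale_right_distrib)
  moreover have "diag \<Gamma> w (scale c v) = scale c (diag \<Gamma> w v)" for c v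
    unfolding diag_def scale_sum_right
    by (rule sum.cong) (simp_all add: scl mult.commute)
  ultimately show ?thesis
    unfolding Vector_Spaces.linear_iff using vector_space_axioms by blast
qed

lemma diag_component:
  assumes "v \<in> X" "X \<in> \<Gamma>"
  shows "diag \<Gamma> w v = scale (w X) v"
proof -
  have "diag \<Gamma> w v = (\<Sum>Y\<in>\<Gamma>. if Y = X then scale (w X) v else 0)"
    unfolding diag_def by (rule sum.cong) (use component_of_member[OF assms] in auto)
  then show ?thesis using finite_components assms(2) by (simp add: sum.delta)
qed

lemma linear_eq_diag:
  assumes "endo g"
    and "\<And>X v. X \<in> \<Gamma> \<Longrightarrow> v \<in> X \<Longrightarrow> g v = scale (w X) v"
  shows "g = diag \<Gamma> w"
proof
  fix v
  have "g v = g (\<Sum>X\<in>\<Gamma>. component \<Gamma> v X)" by (simp add: component_sum)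
  also have "\<dots> = (\<Sum>X\<in>\<Gamma>. g (component \<Gamma> v X))" by (rule linear_simps[OF assms(1)])
  also have "\<dots> = diag \<Gamma> w v" unfolding diag_def by (rule sum.cong) (use assms(2) component_mem in auto)
  finally show "g v = diag \<Gamma> w v" .
qed

lemma diag_comp: "diag \<Gamma> w \<circ> diag \<Gamma> w' = diag \<Gamma> (\<lambda>X. w X * w' X)"
proof (rule linear_eq_diag)
  show "endo (diag \<Gamma> w \<circ> diag \<Gamma> w')"
    by (rule linear_comp[OF linear_diag linear_diag])
  show "(diag \<Gamma> w \<circ> diag \<Gamma> w') v = scale (w X * w' X) v" if "X \<in> \<Gamma>" "v \<in> X" for X v
    using that by (simp add: diag_component linear_simps[OF linear_diag] mult.commute)
qed

lemma diag_one:
  assumes "\<And>X. X \<in> \<Gamma> \<Longrightarrow> w X = 1"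
  shows "diag \<Gamma> w = id"
  by (rule linear_eq_diag[symmetric]) (use linear_id assms in \<open>auto simp: id_def\<close>)

lemma diag_inverse:
  assumes "\<And>X. X \<in> \<Gamma> \<Longrightarrow> w X \<noteq> 0"
  shows "diag \<Gamma> w \<in> carrier (GL scale)" "inv_into UNIV (diag \<Gamma> w) = diag \<Gamma> (\<lambda>X. inverse (w X))"
proof -
  let ?w = "\<lambda>X. inverse (w X)"
  have 1: "diag \<Gamma> w \<circ> diag \<Gamma> ?w = id" "diag \<Gamma> ?w \<circ> diag \<Gamma> w = id"
    unfolding diag_comp by (rule diag_one, simp add: assms)+
  then have "bij (diag \<Gamma> w)" by (intro o_bij)
  then show "diag \<Gamma> w \<in> carrier (GL scale)" using linear_diag by (simp add: GL_def)
  show "inv_into UNIV (diag \<Gamma> w) = diag \<Gamma> ?w"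
    using 1 by (intro inv_unique_comp)
qed

end

section \<open>The torus of monomial weights\<close>

text \<open>Integer vectors \<open>a X\<close> attached to the summands \<open>X\<close>, together with coefficients \<open>n k\<close> that express
  the \<open>k\<close>-th unit vector as a combination of them. So the vectors \<open>a X\<close> generate the integer lattice.
  This makes the monomial action faithful, with a regular inverse.\<close>

locale monomial_torus = finite_decomposition scale Basis \<Gamma>
  for scale :: "'f::alg_closed_field \<Rightarrow> 'v::ab_group_add \<Rightarrow> 'v" and Basis :: "'v set" and \<Gamma> +
  fixes r :: nat and a :: "'v set \<Rightarrow> nat \<Rightarrow> int" and n :: "nat \<Rightarrow> 'v set \<Rightarrow> int"
  assumes dual: "\<And>j k. j < r \<Longrightarrow> k < r \<Longrightarrow> (\<Sum>X\<in>\<Gamma>. n k X * a X j) = (if j = k then 1 else 0)"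
begin

definition act :: "(nat \<Rightarrow> 'f) \<Rightarrow> 'v \<Rightarrow> 'v" where
  "act t = diag \<Gamma> (\<lambda>X. monomial r (a X) t)"

definition diag_torus :: "('v \<Rightarrow> 'v) set" where
  "diag_torus = act ` carrier (mult_torus r)"

text \<open>A test vector in \<open>X\<close>. Together with the functional \<open>dual_vec X\<close> it reads off, as a matrix entry,
  the scalar by which a diagonal operator acts on \<open>X\<close>.\<close>

definition vec :: "'v set \<Rightarrow> 'v" where
  "vec X = (SOME v. v \<in> X \<and> v \<noteq> 0)"

definition dual_vec :: "'v set \<Rightarrow> 'v \<Rightarrow> 'f" where
  "dual_vec X = (SOME l. functional l \<and> l (vec X) = 1)"

definition weight :: "'v set \<Rightarrow> ('v \<Rightarrow> 'v) \<Rightarrow> 'f" where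
  "weight X g = dual_vec X (g (vec X))"

definition inv_weight :: "'v set \<Rightarrow> ('v \<Rightarrow> 'v) \<Rightarrow> 'f" where
  "inv_weight X g = dual_vec X (inv_into UNIV g (vec X))"

definition coord :: "nat \<Rightarrow> ('v \<Rightarrow> 'v) \<Rightarrow> 'f" where
  "coord k g = (\<Prod>X\<in>\<Gamma>. powi_pair (weight X g) (inv_weight X g) (n k X))"

definition inv_coord :: "nat \<Rightarrow> ('v \<Rightarrow> 'v) \<Rightarrow> 'f" where
  "inv_coord k g = (\<Prod>X\<in>\<Gamma>. powi_pair (inv_weight X g) (weight X g) (n k X))"

lemma vec:
  assumes "X \<in> \<Gamma>"
  shows "vec X \<in> X" "vec X \<noteq> 0"
proof -
  have "\<exists>v. v \<in> X \<and> v \<noteq> 0" using nonzero[OF assms] subspace_0[OF subspace_component[OF assms]] by blast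
  from someI_ex[OF this] show "vec X \<in> X" "vec X \<noteq> 0" unfolding vec_def by simp_all
qed

lemma dual_vec:
  assumes "X \<in> \<Gamma>"
  shows "functional (dual_vec X)" "dual_vec X (vec X) = 1"
proof -
  have "\<exists>l. functional l \<and> l (vec X) = 1"
    using ex_separating_functional[OF subspace_single_0, of "vec X"] vec(2)[OF assms] by blast
  from someI_ex[OF this] show "functional (dual_vec X)" "dual_vec X (vec X) = 1"
    unfolding dual_vec_def by simp_all
qed

lemma functional_scale:
  "functional l \<Longrightarrow> l (scale c v) = c * l v"
  using linear_imp_scale unfolding Vector_Spaces.linear_iff by blast

lemma functional_sum:
  assumes "functional l"
  shows "l (\<Sum>x\<in>A. f x) = (\<Sum>x\<in>A. l (f x))"
proof -
  interpret l: Vector_Spaces.linear scale "(*)" l by fact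
  show ?thesis by (rule l.sum)
qed

lemma weight_diag:
  assumes "\<And>X. X \<in> \<Gamma> \<Longrightarrow> w X \<noteq> 0" "X \<in> \<Gamma>"
  shows "weight X (diag \<Gamma> w) = w X" "inv_weight X (diag \<Gamma> w) = inverse (w X)"
  using assms vec[OF assms(2)] dual_vec[OF assms(2)]
  by (simp_all add: weight_def inv_weight_def diag_inverse(2) diag_component functional_scale)

lemma act_GL: "t \<in> carrier (mult_torus r) \<Longrightarrow> act t \<in> carrier (GL scale)"
  unfolding act_def by (rule diag_inverse) (rule monomial_nonzero)

lemma inv_act:
  "t \<in> carrier (mult_torus r) \<Longrightarrow> inv_into UNIV (act t) = diag \<Gamma> (\<lambda>X. inverse (monomial r (a X) t))"
  unfolding act_def by (rule diag_inverse) (rule monomial_nonzero)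

lemma coord_act:
  assumes t: "t \<in> carrier (mult_torus r)" and k: "k < r"
  shows "coord k (act t) = t k" "inv_coord k (act t) = inverse (t k)"
proof -
  have w: "weight X (act t) = monomial r (a X) t" "inv_weight X (act t) = inverse (monomial r (a X) t)"
    if "X \<in> \<Gamma>" for X
    using weight_diag[of "\<lambda>X. monomial r (a X) t", OF _ that] monomial_nonzero[OF t]
    unfolding act_def by simp_all
  have "coord k (act t) = (\<Prod>X\<in>\<Gamma>. monomial r (a X) t powi n k X)"
    unfolding coord_def by (rule prod.cong) (simp_all add: w powi_pair_inverse)
  also have "\<dots> = t k" by (rule monomial_combination[OF t k]) (use dual k in auto)
  finally show 1: "coord k (act t) = t k" .
  have "inv_coord k (act t) = (\<Prod>X\<in>\<Gamma>. inverse (monomial r (a X) t powi n k X))"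
    unfolding inv_coord_def
  proof (rule prod.cong[OF refl])
    fix X assume X: "X \<in> \<Gamma>"
    show "powi_pair (inv_weight X (act t)) (weight X (act t)) (n k X) = inverse (monomial r (a X) t powi n k X)"
      using powi_pair_inverse[of "inverse (monomial r (a X) t)" "n k X"]
      by (simp add: w[OF X] power_int_inverse)
  qed
  also have "\<dots> = inverse (coord k (act t))"
    using \<open>coord k (act t) = (\<Prod>X\<in>\<Gamma>. monomial r (a X) t powi n k X)\<close>
    by (simp add: prod_inversef[symmetric] comp_def)
  finally show "inv_coord k (act t) = inverse (t k)" by (simp add: 1)
qed

lemma act_mult:
  "act (\<lambda>k\<in>{..<r}. s k * t k) = act s \<circ> act t"
  unfolding act_def diag_comp monomial_mult ..

lemma act_one: "act (\<lambda>k\<in>{..<r}. 1) = id"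
  unfolding act_def by (rule diag_one) (simp add: monomial_def)

lemma mult_torus_eqI:
  assumes "s \<in> carrier (mult_torus r)" "t \<in> carrier (mult_torus r)" "\<And>k. k < r \<Longrightarrow> s k = t k"
  shows "s = t"
  using assms unfolding mult_torus_carrier by (intro PiE_ext[of s "{..<r}" _ t]) auto

lemma inj_act: "inj_on act (carrier (mult_torus r))"
  by (rule inj_onI) (metis coord_act(1) mult_torus_eqI)

lemma inv_torus_closed:
  assumes "t \<in> carrier (mult_torus r)"
  shows "(\<lambda>k\<in>{..<r}. inverse (t k)) \<in> carrier (mult_torus r)"
  unfolding mult_torus_carrier by (rule PiE_I) (simp_all add: mult_torus_nonzero[OF assms])

lemma mult_torus_closed:
  assumes "s \<in> carrier (mult_torus r)" "t \<in> carrier (mult_torus r)"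
  shows "(\<lambda>k\<in>{..<r}. s k * t k :: 'f) \<in> carrier (mult_torus r)"
  unfolding mult_torus_carrier
  by (rule PiE_I) (simp_all add: mult_torus_nonzero[OF assms(1)] mult_torus_nonzero[OF assms(2)])

lemma subgroup_diag_torus: "subgroup diag_torus (GL scale)"
proof -
  interpret GL: group "GL scale" by (rule group_GL)
  have one: "(\<lambda>k\<in>{..<r}. 1 :: 'f) \<in> carrier (mult_torus r)"
    unfolding mult_torus_carrier by (rule PiE_I) simp_all
  show ?thesis
  proof (rule GL.subgroupI)
    show "diag_torus \<subseteq> carrier (GL scale)" unfolding diag_torus_def using act_GL by blast
    show "diag_torus \<noteq> {}" unfolding diag_torus_def using one by blast
    show "g \<otimes>\<^bsub>GL scale\<^esub> h \<in> diag_torus" if gh: "g \<in> diag_torus" "h \<in> diag_torus" for g h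
    proof -
      obtain s t where st: "s \<in> carrier (mult_torus r)" "t \<in> carrier (mult_torus r)" "g = act s" "h = act t"
        using gh unfolding diag_torus_def by blast
      have "g \<otimes>\<^bsub>GL scale\<^esub> h = act (\<lambda>k\<in>{..<r}. s k * t k)" unfolding act_mult st by (simp add: GL_def)
      then show ?thesis unfolding diag_torus_def using mult_torus_closed[OF st(1,2)] by blast
    qed
    show "inv\<^bsub>GL scale\<^esub> g \<in> diag_torus" if g: "g \<in> diag_torus" for g
    proof -
      obtain t where t: "t \<in> carrier (mult_torus r)" "g = act t" using g unfolding diag_torus_def by blast
      let ?s = "\<lambda>k\<in>{..<r}. inverse (t k)"
      have s: "?s \<in> carrier (mult_torus r)" by (rule inv_torus_closed[OF t(1)])
      have "(\<lambda>k\<in>{..<r}. ?s k * t k) = (\<lambda>k\<in>{..<r}. 1)"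
        by (rule restrict_ext) (simp add: mult_torus_nonzero[OF t(1)])
      then have "act ?s \<circ> act t = id" using act_mult[of ?s t] act_one by simp
      then have "act ?s \<otimes>\<^bsub>GL scale\<^esub> g = \<one>\<^bsub>GL scale\<^esub>" using t(2) by (simp add: GL_def)
      then have "inv\<^bsub>GL scale\<^esub> g = act ?s"
        using act_GL[OF s] act_GL[OF t(1)] t(2) by (intro GL.inv_equality) simp_all
      then show ?thesis unfolding diag_torus_def using s by blast
    qed
  qed
qed

lemma weight_regular:
  assumes "X \<in> \<Gamma>"
  shows "weight X \<in> GL_regular scale" "inv_weight X \<in> GL_regular scale"
proof -
  have "weight X = (\<lambda>g. dual_vec X (g (vec X)))" by (rule ext) (simp add: weight_def)
  then show "weight X \<in> GL_regular scale" using GL_regular_matrix_entry[OF dual_vec(1)[OF assms]] by simp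
  have "inv_weight X = (\<lambda>g. dual_vec X (inv_into UNIV g (vec X)))" by (rule ext) (simp add: inv_weight_def)
  then show "inv_weight X \<in> GL_regular scale" using dual_vec(1)[OF assms] unfolding GL_regular_def
    by (auto intro!: fun_algebra.fun_algebra_gen)
qed

lemma coord_regular: "coord k \<in> GL_regular scale" "inv_coord k \<in> GL_regular scale"
proof -
  have "(\<lambda>g. coord k g) \<in> GL_regular scale"
    unfolding coord_def GL_regular_def
    by (intro fun_algebra_prod finite_components fun_algebra_powi_pair)
      (use weight_regular in \<open>simp_all add: GL_regular_def\<close>)
  then show "coord k \<in> GL_regular scale" by simp
  have "(\<lambda>g. inv_coord k g) \<in> GL_regular scale"
    unfolding inv_coord_def GL_regular_def
    by (intro fun_algebra_prod finite_components fun_algebra_powi_pair)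
      (use weight_regular in \<open>simp_all add: GL_regular_def\<close>)
  then show "inv_coord k \<in> GL_regular scale" by simp
qed

text \<open>The equations of the torus inside the general linear group: \<open>g\<close> lies in it when the coordinates
  read off from \<open>g\<close> are invertible and \<open>g\<close> is the operator that these coordinates define.\<close>

definition entry_defect :: "('v \<Rightarrow> 'f) \<Rightarrow> 'v \<Rightarrow> ('v \<Rightarrow> 'v) \<Rightarrow> 'f" where
  "entry_defect l v g = l (g v) -
     (\<Sum>X\<in>\<Gamma>. (\<Prod>k<r. powi_pair (coord k g) (inv_coord k g) (a X k)) * l (component \<Gamma> v X))"

definition unit_defect :: "'v set \<Rightarrow> ('v \<Rightarrow> 'v) \<Rightarrow> 'f" where
  "unit_defect X g = weight X g * inv_weight X g - 1"

lemma entry_defect_regular: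
  assumes "functional l"
  shows "entry_defect l v \<in> GL_regular scale"
proof -
  have "(\<lambda>g. entry_defect l v g) \<in> GL_regular scale"
    unfolding entry_defect_def GL_regular_def
    by (intro fun_algebra_diff fun_algebra_sum finite_components fun_algebra.fun_algebra_mult
        fun_algebra_prod finite_lessThan fun_algebra_powi_pair fun_algebra.fun_algebra_const)
      (use coord_regular GL_regular_matrix_entry[OF assms] in \<open>simp_all add: GL_regular_def\<close>)
  then show ?thesis by simp
qed

lemma unit_defect_regular:
  assumes "X \<in> \<Gamma>"
  shows "unit_defect X \<in> GL_regular scale"
proof -
  have "(\<lambda>g. unit_defect X g) \<in> GL_regular scale"
    unfolding unit_defect_def GL_regular_def
    by (intro fun_algebra_diff fun_algebra.fun_algebra_mult fun_algebra.fun_algebra_const)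
      (use weight_regular[OF assms] in \<open>simp_all add: GL_regular_def\<close>)
  then show ?thesis by simp
qed

lemma functional_act:
  assumes "functional l"
  shows "l (diag \<Gamma> w v) = (\<Sum>X\<in>\<Gamma>. w X * l (component \<Gamma> v X))"
  unfolding diag_def by (simp add: functional_sum[OF assms] functional_scale[OF assms])

lemma diag_torus_iff:
  assumes g: "g \<in> carrier (GL scale)"
  shows "g \<in> diag_torus \<longleftrightarrow> (\<forall>X\<in>\<Gamma>. unit_defect X g = 0) \<and>
     (\<forall>l v. functional l \<longrightarrow> entry_defect l v g = 0)"
proof
  assume "g \<in> diag_torus"
  then obtain t where t: "t \<in> carrier (mult_torus r)" "g = act t" unfolding diag_torus_def by blast
  have "unit_defect X g = 0" if "X \<in> \<Gamma>" for X
    using weight_diag[of "\<lambda>X. monomial r (a X) t", OF _ that] monomial_nonzero[OF t(1)]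
    unfolding t(2) act_def unit_defect_def by simp
  moreover have "entry_defect l v g = 0" if l: "functional l" for l v
  proof -
    have "(\<Prod>k<r. powi_pair (coord k g) (inv_coord k g) (a X k)) = monomial r (a X) t" for X
      unfolding monomial_def
      by (rule prod.cong) (simp_all add: t(2) coord_act[OF t(1)] powi_pair_inverse)
    then show ?thesis
      unfolding entry_defect_def by (simp add: t(2) act_def functional_act[OF l])
  qed
  ultimately show "(\<forall>X\<in>\<Gamma>. unit_defect X g = 0) \<and>
     (\<forall>l v. functional l \<longrightarrow> entry_defect l v g = 0)" by blast
next
  assume "(\<forall>X\<in>\<Gamma>. unit_defect X g = 0) \<and>
     (\<forall>l v. functional l \<longrightarrow> entry_defect l v g = 0)"
  then have unit: "\<And>X. X \<in> \<Gamma> \<Longrightarrow> weight X g * inv_weight X g = 1"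
    and entry: "\<And>l v. functional l \<Longrightarrow> entry_defect l v g = 0"
    unfolding unit_defect_def by simp_all
  have w: "weight X g \<noteq> 0" "inv_weight X g = inverse (weight X g)" if "X \<in> \<Gamma>" for X
    using unit[OF that] by (auto simp: inverse_unique)
  have coord: "coord k g = (\<Prod>X\<in>\<Gamma>. weight X g powi n k X)" for k
    unfolding coord_def by (rule prod.cong) (simp_all add: w powi_pair_inverse)
  have inv_coord: "inv_coord k g = inverse (coord k g)" for k
  proof -
    have "inv_coord k g = (\<Prod>X\<in>\<Gamma>. inverse (weight X g powi n k X))"
      unfolding inv_coord_def
    proof (rule prod.cong[OF refl])
      fix X assume X: "X \<in> \<Gamma>"
      show "powi_pair (inv_weight X g) (weight X g) (n k X) = inverse (weight X g powi n k X)"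
        using powi_pair_inverse[of "inverse (weight X g)" "n k X"]
        by (simp add: w[OF X] power_int_inverse)
    qed
    then show ?thesis by (simp add: coord prod_inversef[symmetric] comp_def)
  qed
  define t where "t = (\<lambda>k\<in>{..<r}. coord k g)"
  have coord0: "coord k g \<noteq> 0" for k using w(1) finite_components by (simp add: coord)
  have t: "t \<in> carrier (mult_torus r)"
    unfolding t_def mult_torus_carrier by (rule PiE_I) (simp_all add: coord0)
  have mon: "(\<Prod>k<r. powi_pair (coord k g) (inv_coord k g) (a X k)) = monomial r (a X) t" for X
    unfolding monomial_def by (rule prod.cong) (simp_all add: inv_coord powi_pair_inverse t_def)
  have "g v = act t v" for v
  proof (rule ccontr)
    assume "g v \<noteq> act t v"
    then have "g v - act t v \<notin> {0}" by simp
    then obtain l where l: "functional l" "l (g v - act t v) = 1"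
      using ex_separating_functional[OF subspace_single_0] by metis
    interpret l: Vector_Spaces.linear scale "(*)" l by (rule l(1))
    have "l (g v) = l (act t v)"
      using entry[OF l(1), of v] by (simp add: entry_defect_def mon act_def functional_act[OF l(1)])
    then show False using l(2) by (simp add: l.diff)
  qed
  then have "g = act t" by blast
  then show "g \<in> diag_torus" unfolding diag_torus_def using t by blast
qed

lemma closed_diag_torus: "closed_in_GL scale diag_torus"
proof -
  let ?P = "unit_defect ` \<Gamma> \<union> {entry_defect l v | l v. functional l}"
  have "?P \<subseteq> GL_regular scale" using unit_defect_regular entry_defect_regular by blast
  moreover have "diag_torus = {g \<in> carrier (GL scale). \<forall>p\<in>?P. p g = 0}"
  proof (rule Set.set_eqI)
    fix g
    have "g \<in> diag_torus \<longleftrightarrow> g \<in> carrier (GL scale) \<and> g \<in> diag_torus"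
      using subgroup.subset[OF subgroup_diag_torus] by blast
    also have "\<dots> \<longleftrightarrow> g \<in> carrier (GL scale) \<and> (\<forall>p\<in>?P. p g = 0)"
      using diag_torus_iff[of g] by blast
    finally show "g \<in> diag_torus \<longleftrightarrow> g \<in> {g \<in> carrier (GL scale). \<forall>p\<in>?P. p g = 0}" by simp
  qed
  ultimately show ?thesis unfolding closed_in_GL_def by blast
qed

lemma monomial_regular:
  "(\<lambda>t. monomial r b t :: 'f) \<in> mult_torus_regular r"
  "(\<lambda>t. inverse (monomial r b t) :: 'f) \<in> mult_torus_regular r"
proof -
  have gen: "(\<lambda>t. t k :: 'f) \<in> mult_torus_regular r" "(\<lambda>t. inverse (t k) :: 'f) \<in> mult_torus_regular r" if "k < r" for k
    unfolding mult_torus_regular_def using that by (auto intro!: fun_algebra.fun_algebra_gen)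
  have pw: "(\<lambda>t. powi_pair (t k) (inverse (t k)) m :: 'f) \<in> mult_torus_regular r" if "k < r" for k m
    using gen[OF that] unfolding mult_torus_regular_def by (rule fun_algebra_powi_pair)
  have *: "(\<lambda>t. monomial r b t :: 'f) \<in> mult_torus_regular r" for b
    unfolding monomial_def mult_torus_regular_def
    by (rule fun_algebra_prod) (use pw in \<open>simp_all add: powi_pair_inverse mult_torus_regular_def\<close>)
  show "(\<lambda>t. monomial r b t :: 'f) \<in> mult_torus_regular r" by (rule *)
  have "inverse (monomial r b t) = monomial r (\<lambda>k. - b k) t" for t :: "nat \<Rightarrow> 'f"
    by (simp add: monomial_def power_int_minus prod_inversef[symmetric] comp_def)
  then show "(\<lambda>t. inverse (monomial r b t) :: 'f) \<in> mult_torus_regular r"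
    using *[of "\<lambda>k. - b k"] by (simp only:)
qed

text \<open>The parametrization has Laurent monomials as weights, and its inverse is given by the matrix entries
  that make up \<open>coord\<close>.\<close>

theorem torus_diag_torus: "torus_of_dim scale r diag_torus"
  unfolding torus_of_dim_def algebraic_subgroup_def
proof (intro conjI bexI[of _ act] subgroup_diag_torus closed_diag_torus)
  have bij: "bij_betw act (carrier (mult_torus r)) diag_torus"
    unfolding bij_betw_def diag_torus_def using inj_act by simp
  have inv_act_param: "inv_into (carrier (mult_torus r)) act (act t) = t" if "t \<in> carrier (mult_torus r)" for t
    using inj_act that by (rule inv_into_f_f)
  show "act \<in> iso (mult_torus r) (GL scale\<lparr>carrier := diag_torus\<rparr>)"
  proof (rule isoI)
    show "act \<in> hom (mult_torus r) (GL scale\<lparr>carrier := diag_torus\<rparr>)"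
    proof (rule homI)
      show "act t \<in> carrier (GL scale\<lparr>carrier := diag_torus\<rparr>)" if "t \<in> carrier (mult_torus r)" for t
        using that by (simp add: diag_torus_def)
      show "act (s \<otimes>\<^bsub>mult_torus r\<^esub> t) = act s \<otimes>\<^bsub>GL scale\<lparr>carrier := diag_torus\<rparr>\<^esub> act t" for s t
        using act_mult[of s t] by (simp add: mult_torus_def GL_def)
    qed
    show "bij_betw act (carrier (mult_torus r)) (carrier (GL scale\<lparr>carrier := diag_torus\<rparr>))" using bij by simp
  qed
  show "regular_map (carrier (mult_torus r)) (mult_torus_regular r) diag_torus (GL_regular scale) act"
    unfolding mult_torus_regular_def GL_regular_def
  proof (rule regular_map_fun_algebra)
    show "act ` carrier (mult_torus r) \<subseteq> diag_torus" by (simp add: diag_torus_def)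
    fix e :: "('v \<Rightarrow> 'v) \<Rightarrow> 'f"
    assume "e \<in> {\<lambda>g. l (g v) | l v. functional l} \<union>
        {\<lambda>g. l (inv_into UNIV g v) | l v. functional l}"
    then consider (dir) l v where "functional l" "e = (\<lambda>g. l (g v))"
      | (inv) l v where "functional l" "e = (\<lambda>g. l (inv_into UNIV g v))" by blast
    then have "\<exists>p\<in>mult_torus_regular r. \<forall>t\<in>carrier (mult_torus r). e (act t) = p t"
    proof cases
      case dir
      have "(\<lambda>t. \<Sum>X\<in>\<Gamma>. monomial r (a X) t * l (component \<Gamma> v X)) \<in> mult_torus_regular r"
        unfolding mult_torus_regular_def
        by (intro fun_algebra_sum finite_components fun_algebra.fun_algebra_mult fun_algebra.fun_algebra_const)
          (use monomial_regular in \<open>simp add: mult_torus_regular_def\<close>)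
      then show ?thesis
        by (rule bexI[rotated]) (simp add: dir(2) act_def functional_act[OF dir(1)])
    next
      case inv
      have "(\<lambda>t. \<Sum>X\<in>\<Gamma>. inverse (monomial r (a X) t) * l (component \<Gamma> v X)) \<in> mult_torus_regular r"
        unfolding mult_torus_regular_def
        by (intro fun_algebra_sum finite_components fun_algebra.fun_algebra_mult fun_algebra.fun_algebra_const)
          (use monomial_regular in \<open>simp add: mult_torus_regular_def\<close>)
      then show ?thesis
        by (rule bexI[rotated]) (simp add: inv(2) inv_act functional_act[OF inv(1)])
    qed
    then show "\<exists>p\<in>fun_algebra ({\<lambda>t. t k | k. k < r} \<union> {\<lambda>t. inverse (t k) | k. k < r}).
        \<forall>t\<in>carrier (mult_torus r). e (act t) = p t"
      unfolding mult_torus_regular_def .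
  qed
  show "regular_map diag_torus (GL_regular scale) (carrier (mult_torus r)) (mult_torus_regular r)
          (inv_into (carrier (mult_torus r)) act)"
    unfolding mult_torus_regular_def GL_regular_def
  proof (rule regular_map_fun_algebra)
    show "inv_into (carrier (mult_torus r)) act ` diag_torus \<subseteq> carrier (mult_torus r)"
      unfolding diag_torus_def using inv_act_param by (metis image_subsetI inv_into_into)
    fix e :: "(nat \<Rightarrow> 'f) \<Rightarrow> 'f"
    assume "e \<in> {\<lambda>t. t k | k. k < r} \<union> {\<lambda>t. inverse (t k) | k. k < r}"
    then consider (dir) k where "k < r" "e = (\<lambda>t. t k)" | (inv) k where "k < r" "e = (\<lambda>t. inverse (t k))"
      by blast
    then have "\<exists>p\<in>GL_regular scale. \<forall>g\<in>diag_torus. e (inv_into (carrier (mult_torus r)) act g) = p g"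
    proof cases
      case dir
      then show ?thesis
        by (intro bexI[OF _ coord_regular(1)[of k]]) (auto simp: diag_torus_def inv_act_param coord_act)
    next
      case inv
      then show ?thesis
        by (intro bexI[OF _ coord_regular(2)[of k]]) (auto simp: diag_torus_def inv_act_param coord_act)
    qed
    then show "\<exists>p\<in>fun_algebra ({\<lambda>g. l (g v) | l v. functional l} \<union>
        {\<lambda>g. l (inv_into UNIV g v) | l v. functional l}).
        \<forall>g\<in>diag_torus. e (inv_into (carrier (mult_torus r)) act g) = p g"
      unfolding GL_regular_def .
  qed
qed

end

section \<open>Homomorphisms from the universal groups\<close>

text \<open>An element records by which scalar each member \<open>g\<close> of a family of operators acts on a given
  subspace.\<close>

definition unit_functions :: "('g \<Rightarrow> 'f::field) monoid" where
  "unit_functions = \<lparr>carrier = {\<chi>. \<forall>g. \<chi> g \<noteq> 0}, monoid.mult = (\<lambda>\<chi> \<psi> g. \<chi> g * \<psi> g), one = (\<lambda>_. 1)\<rparr>"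

lemma comm_group_unit_functions: "comm_group (unit_functions :: ('g \<Rightarrow> 'f::field) monoid)"
proof (rule comm_groupI)
  fix \<chi> :: "'g \<Rightarrow> 'f" assume "\<chi> \<in> carrier unit_functions"
  then show "\<exists>\<psi>\<in>carrier unit_functions. \<psi> \<otimes>\<^bsub>unit_functions\<^esub> \<chi> = \<one>\<^bsub>unit_functions\<^esub>"
    by (intro bexI[of _ "\<lambda>g. inverse (\<chi> g)"]) (simp_all add: unit_functions_def)
qed (simp_all add: unit_functions_def mult_ac)

lemma foldr_unit_functions:
  "foldr (\<lambda>x y. f x \<otimes>\<^bsub>unit_functions\<^esub> y) xs \<one>\<^bsub>unit_functions\<^esub> = (\<lambda>g. prod_list (map (\<lambda>x. f x g) xs))"
  by (induction xs) (simp_all add: unit_functions_def)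

lemma unit_functions_int_pow:
  assumes "\<chi> \<in> carrier (unit_functions :: ('g \<Rightarrow> 'f::field) monoid)"
  shows "(\<chi> [^]\<^bsub>unit_functions\<^esub> (n :: int)) g = \<chi> g powi n"
proof -
  let ?U = "unit_functions :: ('g \<Rightarrow> 'f) monoid"
  interpret U: comm_group ?U by (rule comm_group_unit_functions)
  have inv: "(inv\<^bsub>?U\<^esub> \<psi>) g = inverse (\<psi> g)" if "\<psi> \<in> carrier ?U" for \<psi>
  proof -
    have "inv\<^bsub>?U\<^esub> \<psi> = (\<lambda>g. inverse (\<psi> g))"
      by (rule U.inv_equality) (use that in \<open>simp_all add: unit_functions_def\<close>)
    then show ?thesis by simp
  qed
  have pow: "(\<chi> [^]\<^bsub>?U\<^esub> (m :: nat)) g = \<chi> g ^ m" for m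
    by (induction m) (simp_all add: unit_functions_def)
  show ?thesis
  proof (cases "n < 0")
    case True
    then have "(\<chi> [^]\<^bsub>?U\<^esub> n) g = inverse ((\<chi> [^]\<^bsub>?U\<^esub> nat (- n)) g)"
      unfolding int_pow_def2 by (simp only: if_True inv[OF U.nat_pow_closed[OF assms]])
    then show ?thesis using True by (simp only: pow) (simp add: power_int_def power_inverse)
  next
    case False
    then show ?thesis unfolding int_pow_def2 by (simp only: if_False pow) (simp add: power_int_def)
  qed
qed

lemma unit_functions_int_comb:
  assumes "finite K" "f ` K \<subseteq> carrier (unit_functions :: ('g \<Rightarrow> 'f::field) monoid)"
  shows "comm_group.int_comb unit_functions c f K g = (\<Prod>k\<in>K. f k g powi c k)"
proof -
  interpret U: comm_group "unit_functions :: ('g \<Rightarrow> 'f) monoid" by (rule comm_group_unit_functions)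
  have mult: "(\<chi> \<otimes>\<^bsub>unit_functions\<^esub> \<psi>) g = \<chi> g * \<psi> g" for \<chi> \<psi> :: "'g \<Rightarrow> 'f"
    by (simp add: unit_functions_def)
  show ?thesis
    using assms
  proof (induction K)
    case empty
    show ?case unfolding U.int_comb_empty by (simp add: unit_functions_def)
  next
    case (insert k K)
    then have "f k \<in> carrier unit_functions" "f ` K \<subseteq> carrier unit_functions" by auto
    with insert show ?case by (simp add: mult unit_functions_int_pow)
  qed
qed

lemma listset_iff: "xs \<in> listset Xs \<longleftrightarrow> list_all2 (\<in>) xs Xs"
  by (induction Xs arbitrary: xs) (auto simp: set_Cons_def list_all2_Cons2)

context multilinear_algebra
begin

text \<open>Assignments of group elements to components that satisfy the defining relations of the universal
  group. By the universal property these are the homomorphisms from the universal group.\<close>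

definition degree_map :: "'v set set \<Rightarrow> ('a, 'b) monoid_scheme \<Rightarrow> ('v set \<Rightarrow> 'a) \<Rightarrow> bool" where
  "degree_map \<Gamma> H f \<longleftrightarrow> f ` \<Gamma> \<subseteq> carrier H \<and>
     (\<forall>Xs X. (Xs, [X]) \<in> univ_relations \<Gamma> \<longrightarrow> foldr (\<lambda>X y. f X \<otimes>\<^bsub>H\<^esub> y) Xs \<one>\<^bsub>H\<^esub> = f X)"

lemma degree_map_relation:
  "degree_map \<Gamma> H f \<Longrightarrow> (Xs, [X]) \<in> univ_relations \<Gamma> \<Longrightarrow> foldr (\<lambda>X y. f X \<otimes>\<^bsub>H\<^esub> y) Xs \<one>\<^bsub>H\<^esub> = f X"
  by (simp add: degree_map_def)

lemma univ_relations_mem: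
  "(Xs, Ys) \<in> univ_relations \<Gamma> \<Longrightarrow> \<exists>X. Ys = [X] \<and> set Xs \<subseteq> \<Gamma> \<and> X \<in> \<Gamma>"
  unfolding univ_relations_def by blast

lemma group_univ_group: "group (univ_group \<Gamma>)"
  by (simp add: univ_group_def group_presented_group)

lemma comm_group_univ_ab_group: "comm_group (univ_ab_group \<Gamma>)"
  unfolding univ_ab_group_def abelianization_def
  by (rule group.derived_quot_is_comm_group[OF group_univ_group])

definition ab_class :: "'v set set \<Rightarrow> 'v set word set \<Rightarrow> 'v set word set set" where
  "ab_class \<Gamma> x = derived (univ_group \<Gamma>) (carrier (univ_group \<Gamma>)) #>\<^bsub>univ_group \<Gamma>\<^esub> x"

lemma ab_class_hom: "ab_class \<Gamma> \<in> hom (univ_group \<Gamma>) (univ_ab_group \<Gamma>)"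
proof -
  interpret G: group "univ_group \<Gamma>" by (rule group_univ_group)
  interpret N: normal "derived (univ_group \<Gamma>) (carrier (univ_group \<Gamma>))" "univ_group \<Gamma>"
    by (rule G.derived_self_is_normal)
  show ?thesis
    unfolding univ_ab_group_def abelianization_def ab_class_def[abs_def] by (rule N.r_coset_hom_Mod)
qed

lemma univ_ab_map_eq: "univ_ab_map \<Gamma> X = ab_class \<Gamma> (univ_map \<Gamma> X)"
  by (simp add: univ_ab_map_def ab_class_def)

lemma univ_map_carrier: "X \<in> \<Gamma> \<Longrightarrow> univ_map \<Gamma> X \<in> carrier (univ_group \<Gamma>)"
  by (auto simp: univ_map_def univ_group_def presented_group_def)

lemma univ_ab_map_carrier: "X \<in> \<Gamma> \<Longrightarrow> univ_ab_map \<Gamma> X \<in> carrier (univ_ab_group \<Gamma>)"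
  unfolding univ_ab_map_eq by (rule hom_in_carrier[OF ab_class_hom univ_map_carrier])

lemma degree_map_hom:
  assumes "group G" "group H" "h \<in> hom G H" "degree_map \<Gamma> G f"
  shows "degree_map \<Gamma> H (\<lambda>X. h (f X))"
proof -
  interpret h: group_hom G H h by (intro group_hom.intro group_hom_axioms.intro assms)
  have f: "f X \<in> carrier G" if "X \<in> \<Gamma>" for X using assms(4) that by (auto simp: degree_map_def)
  have fold: "foldr (\<lambda>X y. h (f X) \<otimes>\<^bsub>H\<^esub> y) Xs \<one>\<^bsub>H\<^esub> = h (foldr (\<lambda>X y. f X \<otimes>\<^bsub>G\<^esub> y) Xs \<one>\<^bsub>G\<^esub>) \<and>
      foldr (\<lambda>X y. f X \<otimes>\<^bsub>G\<^esub> y) Xs \<one>\<^bsub>G\<^esub> \<in> carrier G"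
    if "set Xs \<subseteq> \<Gamma>" for Xs
    using that by (induction Xs) (simp_all add: f)
  show ?thesis
    unfolding degree_map_def
  proof (intro conjI allI impI)
    show "(\<lambda>X. h (f X)) ` \<Gamma> \<subseteq> carrier H" using f by auto
    fix Xs X assume rel: "(Xs, [X]) \<in> univ_relations \<Gamma>"
    then have "set Xs \<subseteq> \<Gamma>" using univ_relations_mem by blast
    then show "foldr (\<lambda>X y. h (f X) \<otimes>\<^bsub>H\<^esub> y) Xs \<one>\<^bsub>H\<^esub> = h (f X)"
      using fold degree_map_relation[OF assms(4) rel] by simp
  qed
qed

lemma degree_map_univ_map: "degree_map \<Gamma> (univ_group \<Gamma>) (univ_map \<Gamma>)"
  unfolding degree_map_def
proof (intro conjI allI impI)
  let ?W = "word_class \<Gamma> (univ_relations \<Gamma>)"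
  show "univ_map \<Gamma> ` \<Gamma> \<subseteq> carrier (univ_group \<Gamma>)" using univ_map_carrier by blast
  have letters: "pos_word l \<in> lists (UNIV \<times> \<Gamma>)" if "set l \<subseteq> \<Gamma>" for l
    using that by auto
  have word: "foldr (\<lambda>X y. univ_map \<Gamma> X \<otimes>\<^bsub>univ_group \<Gamma>\<^esub> y) l \<one>\<^bsub>univ_group \<Gamma>\<^esub> = ?W (pos_word l)"
    if "set l \<subseteq> \<Gamma>" for l
    using that
  proof (induction l)
    case Nil
    then show ?case by (simp add: univ_group_def presented_group_def)
  next
    case (Cons X l)
    have "[(True, X)] \<in> lists (UNIV \<times> \<Gamma>)" "pos_word l \<in> lists (UNIV \<times> \<Gamma>)"
      using Cons.prems by auto
    from presented_group_mult[OF this] Cons show ?case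
      by (simp add: univ_map_def univ_group_def)
  qed
  fix Xs X assume rel: "(Xs, [X]) \<in> univ_relations \<Gamma>"
  then have sub: "set Xs \<subseteq> \<Gamma>" "set [X] \<subseteq> \<Gamma>" using univ_relations_mem[OF rel] by auto
  have "word_eq \<Gamma> (univ_relations \<Gamma>) (pos_word Xs) (pos_word [X])"
    by (rule word_eq.word_relator[OF rel sub])
  then have "?W (pos_word Xs) = ?W (pos_word [X])"
    using word_class_eq_iff[OF letters[OF sub(1)]] by blast
  then show "foldr (\<lambda>X y. univ_map \<Gamma> X \<otimes>\<^bsub>univ_group \<Gamma>\<^esub> y) Xs \<one>\<^bsub>univ_group \<Gamma>\<^esub> = univ_map \<Gamma> X"
    using word[OF sub(1)] by (simp add: univ_map_def)
qed

lemma degree_map_univ_ab_map: "degree_map \<Gamma> (univ_ab_group \<Gamma>) (univ_ab_map \<Gamma>)"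
proof -
  interpret A: comm_group "univ_ab_group \<Gamma>" by (rule comm_group_univ_ab_group)
  show ?thesis
    unfolding univ_ab_map_eq[abs_def]
    by (rule degree_map_hom[OF group_univ_group A.is_group ab_class_hom degree_map_univ_map])
qed

lemma univ_group_lift:
  assumes "group H" "degree_map \<Gamma> H f"
  obtains h where "h \<in> hom (univ_group \<Gamma>) H" "\<And>X. X \<in> \<Gamma> \<Longrightarrow> h (univ_map \<Gamma> X) = f X"
proof -
  have f: "f ` \<Gamma> \<subseteq> carrier H" using assms(2) by (simp add: degree_map_def)
  show thesis
  proof (rule presented_group_universal[OF assms(1) f, of "univ_relations \<Gamma>"])
    fix l r assume lr: "(l, r) \<in> univ_relations \<Gamma>"
    then obtain X where X: "r = [X]" "X \<in> \<Gamma>" using univ_relations_mem by blast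
    interpret H: group H by fact
    have "f X \<in> carrier H" using f X by blast
    then show "foldr (\<lambda>x y. f x \<otimes>\<^bsub>H\<^esub> y) l \<one>\<^bsub>H\<^esub> = foldr (\<lambda>x y. f x \<otimes>\<^bsub>H\<^esub> y) r \<one>\<^bsub>H\<^esub>"
      using degree_map_relation[OF assms(2)] lr X by simp
  next
    fix h assume "h \<in> hom (presented_group \<Gamma> (univ_relations \<Gamma>)) H"
      "\<And>x. x \<in> \<Gamma> \<Longrightarrow> h (word_class \<Gamma> (univ_relations \<Gamma>) (pos_word [x])) = f x"
    then show thesis using that[of h] by (simp add: univ_group_def univ_map_def)
  qed
qed

lemma univ_ab_group_lift:
  assumes H: "comm_group H" "degree_map \<Gamma> H f"
  obtains h where "h \<in> hom (univ_ab_group \<Gamma>) H" "\<And>X. X \<in> \<Gamma> \<Longrightarrow> h (univ_ab_map \<Gamma> X) = f X"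
proof -
  interpret H: comm_group H by fact
  obtain h where h: "h \<in> hom (univ_group \<Gamma>) H" "\<And>X. X \<in> \<Gamma> \<Longrightarrow> h (univ_map \<Gamma> X) = f X"
    using univ_group_lift[OF H.is_group H(2)] by blast
  obtain g where g: "g \<in> hom (abelianization (univ_group \<Gamma>)) H"
    "\<And>x. x \<in> carrier (univ_group \<Gamma>) \<Longrightarrow>
      g (derived (univ_group \<Gamma>) (carrier (univ_group \<Gamma>)) #>\<^bsub>univ_group \<Gamma>\<^esub> x) = h x"
    using abelianization_universal[OF group_univ_group H(1) h(1)] by blast
  show thesis
  proof (rule that)
    show "g \<in> hom (univ_ab_group \<Gamma>) H" using g(1) by (simp add: univ_ab_group_def)
    show "g (univ_ab_map \<Gamma> X) = f X" if "X \<in> \<Gamma>" for X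
      unfolding univ_ab_map_def using g(2)[OF univ_map_carrier[OF that]] h(2)[OF that] by simp
  qed
qed

lemma inj_on_univ_map:
  assumes "group H" "degree_map \<Gamma> H f" "inj_on f \<Gamma>"
  shows "inj_on (univ_map \<Gamma>) \<Gamma>"
proof -
  obtain h where "\<And>X. X \<in> \<Gamma> \<Longrightarrow> h (univ_map \<Gamma> X) = f X"
    using univ_group_lift[OF assms(1,2)] by blast
  then show ?thesis using assms(3) by (metis inj_on_def)
qed

lemma inj_on_univ_ab_map:
  assumes "comm_group H" "degree_map \<Gamma> H f" "inj_on f \<Gamma>"
  shows "inj_on (univ_ab_map \<Gamma>) \<Gamma>"
proof -
  obtain h where "\<And>X. X \<in> \<Gamma> \<Longrightarrow> h (univ_ab_map \<Gamma> X) = f X"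
    using univ_ab_group_lift[OF assms(1,2)] by blast
  then show ?thesis using assms(3) by (metis inj_on_def)
qed

lemma degree_map_refinement:
  assumes "refinement \<Delta> \<Gamma>" and p: "\<And>X. X \<in> \<Delta> \<Longrightarrow> p X \<in> \<Gamma> \<and> X \<subseteq> p X" and "degree_map \<Gamma> H f"
  shows "degree_map \<Delta> H (\<lambda>X. f (p X))"
  unfolding degree_map_def
proof (intro conjI allI impI)
  show "(\<lambda>X. f (p X)) ` \<Delta> \<subseteq> carrier H" using assms(3) p by (auto simp: degree_map_def)
  fix Xs X assume rel: "(Xs, [X]) \<in> univ_relations \<Delta>"
  have "(map p Xs, [p X]) \<in> univ_relations \<Gamma>"
    using refinement_relation[OF assms(1) p rel] by simp
  from degree_map_relation[OF assms(3) this]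
  show "foldr (\<lambda>X y. f (p X) \<otimes>\<^bsub>H\<^esub> y) Xs \<one>\<^bsub>H\<^esub> = f (p X)"
    by (simp add: foldr_map comp_def)
qed

lemma degree_map_DirProd:
  assumes "degree_map \<Gamma> G f" "degree_map \<Gamma> H f'"
  shows "degree_map \<Gamma> (G \<times>\<times> H) (\<lambda>X. (f X, f' X))"
  unfolding degree_map_def
proof (intro conjI allI impI)
  show "(\<lambda>X. (f X, f' X)) ` \<Gamma> \<subseteq> carrier (G \<times>\<times> H)" using assms by (auto simp: degree_map_def)
  fix Xs X assume rel: "(Xs, [X]) \<in> univ_relations \<Gamma>"
  have "foldr (\<lambda>X y. (f X, f' X) \<otimes>\<^bsub>G \<times>\<times> H\<^esub> y) Xs \<one>\<^bsub>G \<times>\<times> H\<^esub> =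
    (foldr (\<lambda>X y. f X \<otimes>\<^bsub>G\<^esub> y) Xs \<one>\<^bsub>G\<^esub>, foldr (\<lambda>X y. f' X \<otimes>\<^bsub>H\<^esub> y) Xs \<one>\<^bsub>H\<^esub>)"
    by (induction Xs) simp_all
  then show "foldr (\<lambda>X y. (f X, f' X) \<otimes>\<^bsub>G \<times>\<times> H\<^esub> y) Xs \<one>\<^bsub>G \<times>\<times> H\<^esub> = (f X, f' X)"
    using degree_map_relation[OF assms(1) rel] degree_map_relation[OF assms(2) rel] by simp
qed

lemma univ_ab_group_generated:
  assumes fin: "finite \<Gamma>" and u: "u \<in> carrier (univ_ab_group \<Gamma>)"
  shows "\<exists>c. u = comm_group.int_comb (univ_ab_group \<Gamma>) c (univ_ab_map \<Gamma>) \<Gamma>"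
proof -
  interpret G: group "univ_group \<Gamma>" by (rule group_univ_group)
  interpret A: comm_group "univ_ab_group \<Gamma>" by (rule comm_group_univ_ab_group)
  interpret q: group_hom "univ_group \<Gamma>" "univ_ab_group \<Gamma>" "ab_class \<Gamma>"
    by (intro group_hom.intro group_hom_axioms.intro G.is_group A.is_group ab_class_hom)
  let ?W = "word_class \<Gamma> (univ_relations \<Gamma>)"
  have im: "univ_ab_map \<Gamma> ` \<Gamma> \<subseteq> carrier (univ_ab_group \<Gamma>)" using univ_ab_map_carrier by blast
  have W: "?W w \<in> carrier (univ_group \<Gamma>)" if "w \<in> lists (UNIV \<times> \<Gamma>)" for w
    using that unfolding univ_group_def presented_group_def by simp
  have mult: "?W (v @ w) = ?W v \<otimes>\<^bsub>univ_group \<Gamma>\<^esub> ?W w"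
    if "v \<in> lists (UNIV \<times> \<Gamma>)" "w \<in> lists (UNIV \<times> \<Gamma>)" for v w
    unfolding univ_group_def by (rule presented_group_mult[OF that, symmetric])
  have one: "?W [] = \<one>\<^bsub>univ_group \<Gamma>\<^esub>" by (simp add: univ_group_def presented_group_def)
  have letter: "ab_class \<Gamma> (?W [(b, X)]) = univ_ab_map \<Gamma> X [^]\<^bsub>univ_ab_group \<Gamma>\<^esub> (if b then 1 else - 1 :: int)"
    if X: "X \<in> \<Gamma>" for b X
  proof (cases b)
    case True
    then show ?thesis using im X by (simp add: univ_ab_map_eq univ_map_def image_subset_iff)
  next
    case False
    have l: "[(False, X)] \<in> lists (UNIV \<times> \<Gamma>)" "[(True, X)] \<in> lists (UNIV \<times> \<Gamma>)" using X by auto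
    have "word_eq \<Gamma> (univ_relations \<Gamma>) [(False, X), (\<not> False, X)] []"
      by (rule word_eq.word_cancel[OF X])
    then have "?W ([(False, X)] @ [(True, X)]) = ?W []"
      using l by (subst word_class_eq_iff) auto
    then have "?W [(False, X)] \<otimes>\<^bsub>univ_group \<Gamma>\<^esub> ?W [(True, X)] = \<one>\<^bsub>univ_group \<Gamma>\<^esub>"
      using mult[OF l] one by simp
    then have "inv\<^bsub>univ_group \<Gamma>\<^esub> (?W [(True, X)]) = ?W [(False, X)]"
      using W l by (intro G.inv_equality) auto
    then have "ab_class \<Gamma> (?W [(False, X)]) = inv\<^bsub>univ_ab_group \<Gamma>\<^esub> (ab_class \<Gamma> (?W [(True, X)]))"
      using W[OF l(2)] by (metis q.hom_inv)
    then show ?thesis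
      using False im X by (simp add: univ_ab_map_eq univ_map_def A.int_pow_neg image_subset_iff)
  qed
  have gen: "\<exists>c. ab_class \<Gamma> (?W w) = A.int_comb c (univ_ab_map \<Gamma>) \<Gamma>" if "w \<in> lists (UNIV \<times> \<Gamma>)" for w
    using that
  proof (induction w)
    case Nil
    have "ab_class \<Gamma> (?W []) = A.int_comb (\<lambda>_. 0) (univ_ab_map \<Gamma>) \<Gamma>"
      by (simp add: one A.int_comb_zero)
    then show ?case by blast
  next
    case (Cons l w)
    obtain b X where l: "l = (b, X)" "X \<in> \<Gamma>" using Cons.hyps(1) by (cases l) auto
    obtain c where c: "ab_class \<Gamma> (?W w) = A.int_comb c (univ_ab_map \<Gamma>) \<Gamma>" using Cons.IH by blast
    let ?e = "\<lambda>Y. if Y = X then (if b then 1 else - 1) else (0 :: int)"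
    have ls: "[l] \<in> lists (UNIV \<times> \<Gamma>)" "w \<in> lists (UNIV \<times> \<Gamma>)" using Cons.hyps l by auto
    have "?W (l # w) = ?W [l] \<otimes>\<^bsub>univ_group \<Gamma>\<^esub> ?W w" using mult[OF ls] by simp
    then have "ab_class \<Gamma> (?W (l # w)) = ab_class \<Gamma> (?W [l]) \<otimes>\<^bsub>univ_ab_group \<Gamma>\<^esub> ab_class \<Gamma> (?W w)"
      using W ls by simp
    also have "\<dots> = A.int_comb ?e (univ_ab_map \<Gamma>) \<Gamma> \<otimes>\<^bsub>univ_ab_group \<Gamma>\<^esub> A.int_comb c (univ_ab_map \<Gamma>) \<Gamma>"
      unfolding c l(1) letter[OF l(2)] A.int_comb_delta[OF fin l(2) im] ..
    also have "\<dots> = A.int_comb (\<lambda>Y. ?e Y + c Y) (univ_ab_map \<Gamma>) \<Gamma>"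
      by (rule A.int_comb_add[OF im, symmetric])
    finally show ?case by blast
  qed
  obtain x where x: "x \<in> carrier (univ_group \<Gamma>)" "u = ab_class \<Gamma> x"
    using u unfolding univ_ab_group_def abelianization_def FactGroup_def RCOSETS_def ab_class_def by auto
  then obtain w where "w \<in> lists (UNIV \<times> \<Gamma>)" "x = ?W w"
    unfolding univ_group_def presented_group_def by auto
  then show ?thesis using gen x(2) by blast
qed

text \<open>The prefix \<open>ys\<close> collects the arguments whose scalars have already been pulled out.\<close>

lemma opn_scale:
  assumes i: "i \<in> I" and len: "length cs = length xs" "length ys + length xs = ar i"
  shows "opn i (ys @ map2 scale cs xs) = scale (prod_list cs) (opn i (ys @ xs))"
  using len
proof (induction cs xs arbitrary: ys rule: list_induct2)
  case (Cons c cs x xs)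
  interpret l: Vector_Spaces.linear scale scale "\<lambda>x. opn i (ys @ x # map2 scale cs xs)"
    by (rule multilinear[OF i]) (use Cons in simp)
  have "opn i (ys @ map2 scale (c # cs) (x # xs)) = scale c (opn i ((ys @ [x]) @ map2 scale cs xs))"
    using l.scale[of c x] by simp
  also have "\<dots> = scale c (scale (prod_list cs) (opn i ((ys @ [x]) @ xs)))"
    by (subst Cons.IH) (use Cons.prems in simp_all)
  finally show ?case by simp
qed simp

end

section \<open>Weight spaces of automorphisms\<close>

locale fd_algebra = multilinear_algebra scale I ar opn + alg_closed_fd_space scale Basis
  for scale :: "'f::alg_closed_field \<Rightarrow> 'v::ab_group_add \<Rightarrow> 'v"
    and I :: "'i set" and ar :: "'i \<Rightarrow> nat" and opn :: "'i \<Rightarrow> 'v list \<Rightarrow> 'v"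
    and Basis :: "'v set"
begin

lemma Aut_GL: "g \<in> Aut \<Longrightarrow> g \<in> carrier (GL scale)"
  by (simp add: Aut_def)

lemma Aut_linear: "g \<in> Aut \<Longrightarrow> endo g"
  by (rule GL_linear[OF Aut_GL])

lemma grading_finite_decomposition:
  assumes "grading \<Gamma>"
  shows "finite_decomposition scale Basis \<Gamma>"
  using assms by (intro finite_decomposition.intro finite_decomposition_axioms.intro alg_closed_fd_space_axioms)
    (auto simp: grading_def)

lemma opn_eigenvectors:
  assumes g: "g \<in> Aut" and i: "i \<in> I" and xs: "xs \<in> listset Xs" "length Xs = ar i"
    and w: "\<And>X v. X \<in> set Xs \<Longrightarrow> v \<in> X \<Longrightarrow> g v = scale (w X) v"
  shows "g (opn i xs) = scale (prod_list (map w Xs)) (opn i xs)"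
proof -
  have rel: "list_all2 (\<in>) xs Xs" using xs(1) by (simp add: listset_iff)
  then have len: "length xs = length Xs" by (rule list_all2_lengthD)
  have "map g xs = map2 scale (map w Xs) xs"
    using rel w by (induction xs Xs rule: list_all2_induct) auto
  then have "g (opn i xs) = opn i ([] @ map2 scale (map w Xs) xs)"
    using g i len xs(2) by (simp add: Aut_def)
  also have "\<dots> = scale (prod_list (map w Xs)) (opn i ([] @ xs))"
    by (rule opn_scale[OF i]) (use len xs(2) in simp_all)
  finally show ?thesis by simp
qed

text \<open>The value one outside \<open>T\<close> makes a weight, as a function on all operators, unique.\<close>

definition characters :: "('v \<Rightarrow> 'v) set \<Rightarrow> (('v \<Rightarrow> 'v) \<Rightarrow> 'f) set" where
  "characters T = {\<chi>. (\<forall>g. \<chi> g \<noteq> 0) \<and> (\<forall>g. g \<notin> T \<longrightarrow> \<chi> g = 1)}"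

definition eigenspace :: "('v \<Rightarrow> 'v) set \<Rightarrow> (('v \<Rightarrow> 'v) \<Rightarrow> 'f) \<Rightarrow> 'v set" where
  "eigenspace T \<chi> = {v. \<forall>g\<in>T. g v = scale (\<chi> g) v}"

lemma eigenspaceD: "v \<in> eigenspace T \<chi> \<Longrightarrow> g \<in> T \<Longrightarrow> g v = scale (\<chi> g) v"
  by (simp add: eigenspace_def)

lemma subspace_eigenspace:
  assumes "\<And>g. g \<in> T \<Longrightarrow> endo g"
  shows "subspace (eigenspace T \<chi>)"
  unfolding subspace_def eigenspace_def
  by (auto simp: linear_simps[OF assms] scale_right_distrib scale_left_commute)

lemma ex_character:
  assumes T: "T \<subseteq> carrier (GL scale)" and v: "v \<noteq> 0" "\<forall>g\<in>T. \<exists>c. g v = scale c v"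
  obtains \<chi> where "\<chi> \<in> characters T" "v \<in> eigenspace T \<chi>"
proof -
  obtain c where c: "\<And>g. g \<in> T \<Longrightarrow> g v = scale (c g) v" using v(2) by metis
  let ?c = "\<lambda>g. if g \<in> T then c g else 1"
  have "c g \<noteq> 0" if g: "g \<in> T" for g
  proof
    assume "c g = 0"
    then have "g v = g 0" using c[OF g] linear_simps(3)[OF GL_linear, of g] T g by auto
    moreover have "inj g" using T g by (auto simp: GL_def bij_def)
    ultimately show False using v(1) by (metis injD)
  qed
  then have "?c \<in> characters T" by (simp add: characters_def)
  moreover have "v \<in> eigenspace T ?c" using c by (simp add: eigenspace_def)
  ultimately show thesis by (rule that)
qed

lemma character_unique:
  assumes "\<chi> \<in> characters T" "\<psi> \<in> characters T" "v \<in> eigenspace T \<chi>" "v \<in> eigenspace T \<psi>" "v \<noteq> 0"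
  shows "\<chi> = \<psi>"
proof
  fix g
  show "\<chi> g = \<psi> g"
  proof (cases "g \<in> T")
    case True
    then have "scale (\<chi> g) v = scale (\<psi> g) v" using assms(3,4) eigenspaceD by metis
    then show ?thesis using assms(5) by simp
  next
    case False
    then show ?thesis using assms(1,2) by (simp add: characters_def)
  qed
qed

text \<open>Eigenvectors for distinct weights are linearly independent. For \<open>x\<close> in \<open>F\<close> some \<open>g\<close> separates the
  weights of \<open>x\<close> and \<open>y\<close>; subtracting from the image of the relation under \<open>g\<close> its multiple by the
  eigenvalue of \<open>y\<close> removes the summand of \<open>y\<close> and keeps that of \<open>x\<close> up to a nonzero factor.\<close>

lemma eigenvectors_independent:
  assumes T: "\<And>g. g \<in> T \<Longrightarrow> endo g"
    and F: "finite F" "inj_on \<chi> F" "\<And>z. z \<in> F \<Longrightarrow> \<chi> z \<in> characters T"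
    and f: "\<And>z. z \<in> F \<Longrightarrow> f z \<in> eigenspace T (\<chi> z)" "(\<Sum>z\<in>F. f z) = 0" and z: "z \<in> F"
  shows "f z = 0"
  using F f z
proof (induction F arbitrary: f z)
  case (insert y F)
  have zero: "f x = 0" if x: "x \<in> F" for x
  proof -
    have "\<chi> x \<noteq> \<chi> y" using insert.prems(1) insert.hyps(2) x by (auto simp: inj_on_def)
    then obtain g where g: "\<chi> x g \<noteq> \<chi> y g" by blast
    have gT: "g \<in> T"
    proof (rule ccontr)
      assume "g \<notin> T"
      then have "\<chi> x g = 1" "\<chi> y g = 1"
        using insert.prems(2)[of x] insert.prems(2)[of y] x by (simp_all add: characters_def)
      then show False using g by simp
    qed
    have "(\<Sum>z\<in>insert y F. scale (\<chi> z g) (f z)) = (\<Sum>z\<in>insert y F. g (f z))"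
      by (rule sum.cong[OF refl], rule eigenspaceD[OF insert.prems(3) gT, symmetric])
    also have "\<dots> = g 0" using insert.prems(4) linear_simps(4)[OF T[OF gT], of f "insert y F"] by simp
    also have "\<dots> = 0" by (rule linear_simps[OF T[OF gT]])
    finally have 1: "scale (\<chi> y g) (f y) + (\<Sum>z\<in>F. scale (\<chi> z g) (f z)) = 0"
      using insert.hyps by simp
    have "scale (\<chi> y g) (\<Sum>z\<in>insert y F. f z) = 0" using insert.prems(4) by simp
    then have 2: "scale (\<chi> y g) (f y) + (\<Sum>z\<in>F. scale (\<chi> y g) (f z)) = 0"
      using insert.hyps by (simp add: scale_right_distrib scale_sum_right)
    have "(\<Sum>z\<in>F. scale (\<chi> z g - \<chi> y g) (f z)) =
        (\<Sum>z\<in>F. scale (\<chi> z g) (f z)) - (\<Sum>z\<in>F. scale (\<chi> y g) (f z))"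
      by (simp add: scale_left_diff_distrib sum_subtractf)
    also have "\<dots> = 0" using trans[OF 1 2[symmetric]] by simp
    finally have sum0: "(\<Sum>z\<in>F. scale (\<chi> z g - \<chi> y g) (f z)) = 0" .
    have "scale (\<chi> x g - \<chi> y g) (f x) = 0"
    proof (rule insert.IH[of "\<lambda>z. scale (\<chi> z g - \<chi> y g) (f z)" x])
      show "inj_on \<chi> F" using insert.prems(1) by (rule inj_on_subset) blast
      show "\<chi> z \<in> characters T" if "z \<in> F" for z using insert.prems(2) that by blast
      show "scale (\<chi> z g - \<chi> y g) (f z) \<in> eigenspace T (\<chi> z)" if "z \<in> F" for z
        using insert.prems(3) that by (intro subspace_scale subspace_eigenspace T) blast+
    qed (rule sum0, rule x)
    then show ?thesis using g by simp
  qed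
  show ?case
  proof (cases "z = y")
    case True
    then show ?thesis using insert.prems(4) insert.hyps zero by simp
  next
    case False
    then show ?thesis using insert.prems(5) zero by simp
  qed
qed simp

end

section \<open>Refinement of a grading by weight spaces\<close>

text \<open>A family \<open>T\<close> of automorphisms that is simultaneously diagonalizable on each component of the grading.
  The intersections of the components with the weight spaces of \<open>T\<close> are called \<open>joint\<close>.\<close>

locale diagonalizable_stabilizer = fd_algebra scale I ar opn Basis
  for scale :: "'f::alg_closed_field \<Rightarrow> 'v::ab_group_add \<Rightarrow> 'v"
    and I :: "'i set" and ar :: "'i \<Rightarrow> nat" and opn :: "'i \<Rightarrow> 'v list \<Rightarrow> 'v"
    and Basis :: "'v set" +
  fixes \<Delta> :: "'v set set" and T :: "('v \<Rightarrow> 'v) set"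
  assumes grading: "grading \<Delta>" and T_Aut: "T \<subseteq> Aut"
    and eigenvectors_span: "\<And>X. X \<in> \<Delta> \<Longrightarrow> X \<subseteq> span {v \<in> X. \<forall>g\<in>T. \<exists>c. g v = scale c v}"
begin

sublocale \<Delta>: finite_decomposition scale Basis \<Delta>
  by (rule grading_finite_decomposition[OF grading])

definition joint :: "'v set set" where
  "joint = {X \<inter> eigenspace T \<chi> | X \<chi>. X \<in> \<Delta> \<and> \<chi> \<in> characters T} - {{0}}"

lemma T_linear: "g \<in> T \<Longrightarrow> endo g"
  using T_Aut Aut_linear by blast

lemma jointI: "X \<in> \<Delta> \<Longrightarrow> \<chi> \<in> characters T \<Longrightarrow> X \<inter> eigenspace T \<chi> \<noteq> {0} \<Longrightarrow> X \<inter> eigenspace T \<chi> \<in> joint"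
  unfolding joint_def by blast

lemma eigenvector_joint:
  assumes "X \<in> \<Delta>" "v \<in> X" "v \<noteq> 0" "\<forall>g\<in>T. \<exists>c. g v = scale c v"
  obtains \<chi> where "\<chi> \<in> characters T" "X \<inter> eigenspace T \<chi> \<in> joint" "v \<in> X \<inter> eigenspace T \<chi>"
proof -
  have "T \<subseteq> carrier (GL scale)" using T_Aut Aut_GL by blast
  then obtain \<chi> where \<chi>: "\<chi> \<in> characters T" "v \<in> eigenspace T \<chi>"
    using ex_character[OF _ assms(3,4)] by blast
  then have v: "v \<in> X \<inter> eigenspace T \<chi>" using assms(2) by blast
  then have "X \<inter> eigenspace T \<chi> \<in> joint" using assms(1,3) \<chi>(1) by (intro jointI) blast+
  then show thesis using that \<chi>(1) v by blast
qed

lemma ex_joint_below: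
  assumes X: "X \<in> \<Delta>"
  obtains \<chi> where "\<chi> \<in> characters T" "X \<inter> eigenspace T \<chi> \<in> joint"
proof -
  let ?E = "{v \<in> X. \<forall>g\<in>T. \<exists>c. g v = scale c v}"
  have "\<exists>v\<in>?E. v \<noteq> 0"
  proof (rule ccontr)
    assume "\<not> ?thesis"
    then have "?E \<subseteq> {0}" by blast
    then have "span ?E \<subseteq> {0}" using span_minimal[OF _ subspace_single_0] by blast
    then have "X \<subseteq> {0}" using eigenvectors_span[OF X] by blast
    then show False using \<Delta>.nonzero[OF X] subspace_0[OF \<Delta>.subspace_component[OF X]] by blast
  qed
  then show thesis using eigenvector_joint[OF X] that by blast
qed

definition parent :: "'v set \<Rightarrow> 'v set" where
  "parent Z = (SOME X. X \<in> \<Delta> \<and> (\<exists>\<chi>. \<chi> \<in> characters T \<and> Z = X \<inter> eigenspace T \<chi>))"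

definition weight_of :: "'v set \<Rightarrow> ('v \<Rightarrow> 'v) \<Rightarrow> 'f" where
  "weight_of Z = (SOME \<chi>. \<chi> \<in> characters T \<and> Z = parent Z \<inter> eigenspace T \<chi>)"

lemma joint:
  assumes "Z \<in> joint"
  shows "parent Z \<in> \<Delta>" "weight_of Z \<in> characters T" "Z = parent Z \<inter> eigenspace T (weight_of Z)" "Z \<noteq> {0}"
proof -
  have "\<exists>X. X \<in> \<Delta> \<and> (\<exists>\<chi>. \<chi> \<in> characters T \<and> Z = X \<inter> eigenspace T \<chi>)"
    using assms unfolding joint_def by blast
  from someI_ex[OF this] have 1: "parent Z \<in> \<Delta>" "\<exists>\<chi>. \<chi> \<in> characters T \<and> Z = parent Z \<inter> eigenspace T \<chi>"
    unfolding parent_def by simp_all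
  then show "parent Z \<in> \<Delta>" by simp
  from someI_ex[OF 1(2)] show "weight_of Z \<in> characters T" "Z = parent Z \<inter> eigenspace T (weight_of Z)"
    unfolding weight_of_def by simp_all
  show "Z \<noteq> {0}" using assms by (simp add: joint_def)
qed

lemma joint_subset: "Z \<in> joint \<Longrightarrow> Z \<subseteq> parent Z" "Z \<in> joint \<Longrightarrow> Z \<subseteq> eigenspace T (weight_of Z)"
  using joint(3) by blast+

lemma joint_inj:
  assumes "Z \<in> joint" "Z' \<in> joint" "parent Z = parent Z'" "weight_of Z = weight_of Z'"
  shows "Z = Z'"
  using joint(3)[OF assms(1)] joint(3)[OF assms(2)] assms(3,4) by simp

lemma subspace_joint:
  assumes "Z \<in> joint"
  shows "subspace Z"
proof -
  have "subspace (parent Z \<inter> eigenspace T (weight_of Z))"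
    using \<Delta>.subspace_component[OF joint(1)[OF assms]] subspace_eigenspace[OF T_linear] by (rule subspace_inter)
  then show ?thesis using joint(3)[OF assms] by simp
qed

text \<open>A vanishing sum is first sorted by the components of \<open>\<Delta>\<close>, which are independent, and then by
  weights.\<close>

lemma direct_sum_joint: "direct_sum_decomposition scale joint"
proof (rule direct_sum_decompositionI)
  show "subspace Z" if "Z \<in> joint" for Z using that by (rule subspace_joint)
  show "span (\<Union>joint) = UNIV"
  proof -
    have "X \<subseteq> span (\<Union>joint)" if X: "X \<in> \<Delta>" for X
    proof -
      have "{v \<in> X. \<forall>g\<in>T. \<exists>c. g v = scale c v} \<subseteq> span (\<Union>joint)"
      proof
        fix v assume v: "v \<in> {v \<in> X. \<forall>g\<in>T. \<exists>c. g v = scale c v}"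
        show "v \<in> span (\<Union>joint)"
        proof (cases "v = 0")
          case True
          then show ?thesis by (simp add: span_zero)
        next
          case False
          then obtain \<chi> where "X \<inter> eigenspace T \<chi> \<in> joint" "v \<in> X \<inter> eigenspace T \<chi>"
            using eigenvector_joint[OF X] v by blast
          then show ?thesis by (intro span_base) blast
        qed
      qed
      then show ?thesis using eigenvectors_span[OF X] span_minimal[OF _ subspace_span] by blast
    qed
    then have "v \<in> span (\<Union>joint)" for v
      using \<Delta>.component_sum[of v] \<Delta>.component_mem by (metis (no_types, lifting) span_sum subsetD)
    then show ?thesis by blast
  qed
  fix F :: "'v set set" and f Z
  assume F: "finite F" "F \<subseteq> joint" and f: "\<And>Z. Z \<in> F \<Longrightarrow> f Z \<in> Z" "(\<Sum>Z\<in>F. f Z) = 0" and Z: "Z \<in> F"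
  let ?S = "\<lambda>X. \<Sum>Y | Y \<in> F \<and> parent Y = X. f Y"
  have "?S (parent Z) = 0"
  proof (rule direct_sum_zero[OF \<Delta>.ds, of "parent ` F" ?S])
    show "finite (parent ` F)" using F by simp
    show "parent ` F \<subseteq> \<Delta>" using F joint(1) by blast
    show "?S X \<in> X" if "X \<in> parent ` F" for X
    proof (rule subspace_sum)
      show "subspace X" using that F joint(1) \<Delta>.subspace_component by blast
      show "f Y \<in> X" if "Y \<in> {Y \<in> F. parent Y = X}" for Y
        using that F f(1) joint_subset(1) by blast
    qed
    show "(\<Sum>X\<in>parent ` F. ?S X) = 0"
      using sum.image_gen[OF F(1), of f parent] f(2) by simp
    show "parent Z \<in> parent ` F" using Z by blast
  qed
  then show "f Z = 0"
  proof (rule eigenvectors_independent[OF T_linear, rotated 5])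
    show "finite {Y \<in> F. parent Y = parent Z}" using F by simp
    show "inj_on weight_of {Y \<in> F. parent Y = parent Z}"
      by (rule inj_onI) (use F joint_inj in blast)
    show "weight_of Y \<in> characters T" if "Y \<in> {Y \<in> F. parent Y = parent Z}" for Y using that F joint(2) by blast
    show "f Y \<in> eigenspace T (weight_of Y)" if "Y \<in> {Y \<in> F. parent Y = parent Z}" for Y
      using that F f(1) joint_subset(2) by blast
  qed (use Z in simp_all)
qed

lemma prod_list_characters:
  assumes "\<And>Z. Z \<in> set Zs \<Longrightarrow> \<chi> Z \<in> characters T"
  shows "(\<lambda>g. prod_list (map (\<lambda>Z. \<chi> Z g) Zs)) \<in> characters T"
  using assms by (induction Zs) (simp_all add: characters_def)

lemma opn_joint_eigenspace:
  assumes i: "i \<in> I" and Zs: "set Zs \<subseteq> joint" "length Zs = ar i"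
  shows "opn i ` listset Zs \<subseteq> eigenspace T (\<lambda>g. prod_list (map (\<lambda>Z. weight_of Z g) Zs))"
proof (rule image_subsetI)
  fix xs assume xs: "xs \<in> listset Zs"
  have "g (opn i xs) = scale (prod_list (map (\<lambda>Z. weight_of Z g) Zs)) (opn i xs)" if g: "g \<in> T" for g
  proof (rule opn_eigenvectors[OF _ i xs Zs(2)])
    show "g \<in> Aut" using g T_Aut by blast
    show "g v = scale (weight_of Z g) v" if "Z \<in> set Zs" "v \<in> Z" for Z v
      using that Zs(1) joint_subset(2) eigenspaceD g by blast
  qed
  then show "opn i xs \<in> eigenspace T (\<lambda>g. prod_list (map (\<lambda>Z. weight_of Z g) Zs))"
    by (simp add: eigenspace_def)
qed

text \<open>By \<open>opn_joint_eigenspace\<close> the weights multiply under the operations. A product that vanishes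
  identically still has to lie in some component, and then any one below \<open>X\<close> serves.\<close>

lemma grading_joint: "grading joint"
  unfolding grading_def
proof (intro conjI ballI allI impI direct_sum_joint)
  show "Z \<noteq> {0}" if "Z \<in> joint" for Z using that by (rule joint(4))
  fix i Zs assume i: "i \<in> I" and Zs: "set Zs \<subseteq> joint \<and> length Zs = ar i"
  let ?c = "\<lambda>g. prod_list (map (\<lambda>Z. weight_of Z g) Zs)"
  have c: "?c \<in> characters T" by (rule prod_list_characters) (use Zs joint(2) in blast)
  have "set (map parent Zs) \<subseteq> \<Delta> \<and> length (map parent Zs) = ar i" using Zs joint(1) by auto
  then obtain X where X: "X \<in> \<Delta>" "opn i ` listset (map parent Zs) \<subseteq> X"
  proof -
    have "\<forall>i\<in>I. \<forall>Xs. set Xs \<subseteq> \<Delta> \<and> length Xs = ar i \<longrightarrow> (\<exists>X\<in>\<Delta>. opn i ` listset Xs \<subseteq> X)"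
      using grading by (simp add: grading_def)
    then show thesis using i that \<open>set (map parent Zs) \<subseteq> \<Delta> \<and> length (map parent Zs) = ar i\<close> by blast
  qed
  have "listset Zs \<subseteq> listset (map parent Zs)"
  proof
    fix xs assume "xs \<in> listset Zs"
    then have "list_all2 (\<in>) xs Zs" by (simp add: listset_iff)
    then have "list_all2 (\<lambda>x Z. x \<in> parent Z) xs Zs"
      by (rule list.rel_mono_strong) (use Zs joint_subset(1) in blast)
    then show "xs \<in> listset (map parent Zs)" by (simp add: listset_iff list_all2_map2)
  qed
  then have sub: "opn i ` listset Zs \<subseteq> X \<inter> eigenspace T ?c"
    using X(2) opn_joint_eigenspace[OF i, of Zs] Zs by blast
  show "\<exists>Z\<in>joint. opn i ` listset Zs \<subseteq> Z"
  proof (cases "X \<inter> eigenspace T ?c = {0}")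
    case True
    obtain \<chi> where \<chi>: "X \<inter> eigenspace T \<chi> \<in> joint" using ex_joint_below[OF X(1)] by blast
    then have "{0} \<subseteq> X \<inter> eigenspace T \<chi>" using subspace_joint subspace_0 by blast
    then have "opn i ` listset Zs \<subseteq> X \<inter> eigenspace T \<chi>"
      using sub unfolding True by (rule order_trans[rotated])
    then show ?thesis using \<chi> by (rule bexI)
  next
    case False
    show ?thesis using sub jointI[OF X(1) c False] by (rule bexI)
  qed
qed

lemma refinement_joint: "refinement joint \<Delta>"
  unfolding refinement_def using grading_joint grading joint(1) joint_subset(1) by blast

text \<open>The weights of the factors of a nonzero product multiply to the weight of the product, since a
  nonzero vector has only one weight.\<close>

lemma degree_map_weight_of: "degree_map joint unit_functions weight_of"
  unfolding degree_map_def
proof (intro conjI allI impI)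
  show "weight_of ` joint \<subseteq> carrier unit_functions"
    using joint(2) by (auto simp: characters_def unit_functions_def)
  fix Zs Z assume "(Zs, [Z]) \<in> univ_relations joint"
  then obtain i where rel: "set Zs \<subseteq> joint" "Z \<in> joint" "i \<in> I" "length Zs = ar i"
    "\<not> opn i ` listset Zs \<subseteq> {0}" "opn i ` listset Zs \<subseteq> Z"
    unfolding univ_relations_def by blast
  let ?c = "\<lambda>g. prod_list (map (\<lambda>Z. weight_of Z g) Zs)"
  obtain v where v: "v \<in> opn i ` listset Zs" "v \<noteq> 0" using rel(5) by blast
  have "?c = weight_of Z"
  proof (rule character_unique[OF _ joint(2)[OF rel(2)] _ _ v(2)])
    show "?c \<in> characters T" by (rule prod_list_characters) (use rel(1) joint(2) in blast)
    show "v \<in> eigenspace T ?c" using opn_joint_eigenspace[OF rel(3,1,4)] v(1) by blast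
    show "v \<in> eigenspace T (weight_of Z)" using rel(2,6) v(1) joint_subset(2) by blast
  qed
  then show "foldr (\<lambda>Z y. weight_of Z \<otimes>\<^bsub>unit_functions\<^esub> y) Zs \<one>\<^bsub>unit_functions\<^esub> = weight_of Z"
    by (simp add: foldr_unit_functions)
qed

lemma inj_on_pair:
  assumes "inj_on f \<Delta>"
  shows "inj_on (\<lambda>Z. (f (parent Z), weight_of Z)) joint"
proof (rule inj_onI)
  fix Z Z' assume Z: "Z \<in> joint" "Z' \<in> joint" "(f (parent Z), weight_of Z) = (f (parent Z'), weight_of Z')"
  then have "parent Z = parent Z'" using assms joint(1) by (simp add: inj_on_def)
  then show "Z = Z'" using joint_inj Z by simp
qed

text \<open>The pairs of a degree in the universal group of \<open>\<Delta>\<close> and a weight form a degree map that separates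
  the joint components.\<close>

lemma group_grading_joint:
  assumes "group_grading \<Delta>"
  shows "group_grading joint"
proof -
  have "degree_map joint (univ_group \<Delta> \<times>\<times> unit_functions) (\<lambda>Z. (univ_map \<Delta> (parent Z), weight_of Z))"
    by (intro degree_map_DirProd degree_map_refinement[OF refinement_joint _ degree_map_univ_map]
        degree_map_weight_of)
      (simp add: joint(1) joint_subset(1))
  moreover have "group (univ_group \<Delta> \<times>\<times> (unit_functions :: (('v \<Rightarrow> 'v) \<Rightarrow> 'f) monoid))"
    by (intro DirProd_group group_univ_group comm_group.axioms(2) comm_group_unit_functions)
  moreover have "inj_on (\<lambda>Z. (univ_map \<Delta> (parent Z), weight_of Z)) joint"
    using assms by (intro inj_on_pair) (simp add: group_grading_def)
  ultimately show ?thesis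
    unfolding group_grading_def using inj_on_univ_map grading_joint by blast
qed

lemma abelian_group_grading_joint:
  assumes "abelian_group_grading \<Delta>"
  shows "abelian_group_grading joint"
proof -
  have "degree_map joint (univ_ab_group \<Delta> \<times>\<times> unit_functions) (\<lambda>Z. (univ_ab_map \<Delta> (parent Z), weight_of Z))"
    by (intro degree_map_DirProd degree_map_refinement[OF refinement_joint _ degree_map_univ_ab_map]
        degree_map_weight_of)
      (simp add: joint(1) joint_subset(1))
  moreover have "comm_group (univ_ab_group \<Delta> \<times>\<times> (unit_functions :: (('v \<Rightarrow> 'v) \<Rightarrow> 'f) monoid))"
  proof -
    interpret A: comm_group "univ_ab_group \<Delta>" by (rule comm_group_univ_ab_group)
    interpret U: comm_group "unit_functions :: (('v \<Rightarrow> 'v) \<Rightarrow> 'f) monoid" by (rule comm_group_unit_functions)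
    interpret P: group "univ_ab_group \<Delta> \<times>\<times> (unit_functions :: (('v \<Rightarrow> 'v) \<Rightarrow> 'f) monoid)"
      by (rule DirProd_group[OF A.is_group U.is_group])
    show ?thesis
      by (rule P.group_comm_groupI) (auto simp: A.m_comm U.m_comm)
  qed
  moreover have "inj_on (\<lambda>Z. (univ_ab_map \<Delta> (parent Z), weight_of Z)) joint"
    using assms by (intro inj_on_pair) (simp add: abelian_group_grading_def)
  ultimately show ?thesis
    unfolding abelian_group_grading_def using inj_on_univ_ab_map grading_joint by blast
qed

text \<open>The refinement by weight spaces is not proper, so each component is contained in one weight space.\<close>

theorem fine_imp_scalar:
  assumes fine: "fine_group_grading \<Delta> \<or> fine_abelian_group_grading \<Delta>" and X: "X \<in> \<Delta>"
  obtains \<chi> where "\<chi> \<in> characters T" "X \<subseteq> eigenspace T \<chi>"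
proof -
  have "\<not> proper_refinement joint \<Delta>"
    using fine group_grading_joint abelian_group_grading_joint
    unfolding fine_group_grading_def fine_abelian_group_grading_def by blast
  then have not_proper: "\<not> Z \<subset> X" if "Z \<in> joint" for Z
    using refinement_joint that X unfolding proper_refinement_def by blast
  obtain \<chi> where \<chi>: "\<chi> \<in> characters T" "X \<inter> eigenspace T \<chi> \<in> joint" using ex_joint_below[OF X] by blast
  then have "X \<inter> eigenspace T \<chi> = X" using not_proper by blast
  then show thesis using that \<chi>(1) by blast
qed

end

section \<open>Stabilizers and coarsenings\<close>

context fd_algebra
begin

lemma univ_ab_group_fin_gen:
  assumes "finite \<Gamma>"
  shows "comm_group.fin_gen (univ_ab_group \<Gamma>)"
proof -
  interpret A: comm_group "univ_ab_group \<Gamma>" by (rule comm_group_univ_ab_group)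
  show ?thesis
    by (rule A.fin_genI[OF assms]) (use univ_ab_map_carrier univ_ab_group_generated[OF assms] in blast)+
qed

text \<open>Grouping the \<open>\<Delta>\<close>-components of \<open>v\<close> by the components of \<open>\<Gamma>\<close> that contain them gives the
  \<open>\<Gamma>\<close>-components of \<open>v\<close>, and only that for \<open>Y\<close> can be nonzero.\<close>

lemma refinement_component:
  assumes ref: "refinement \<Delta> \<Gamma>" and Y: "Y \<in> \<Gamma>" and v: "v \<in> Y" and X: "X \<in> \<Delta>"
    and nz: "component \<Delta> v X \<noteq> 0"
  shows "X \<subseteq> Y"
proof -
  interpret \<Delta>: finite_decomposition scale Basis \<Delta>
    by (rule grading_finite_decomposition) (use ref in \<open>simp add: refinement_def\<close>)
  interpret \<Gamma>: finite_decomposition scale Basis \<Gamma>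
    by (rule grading_finite_decomposition) (use ref in \<open>simp add: refinement_def\<close>)
  have "\<forall>X\<in>\<Delta>. \<exists>Y\<in>\<Gamma>. X \<subseteq> Y" using ref by (simp add: refinement_def)
  then obtain p where p: "\<And>X. X \<in> \<Delta> \<Longrightarrow> p X \<in> \<Gamma>" "\<And>X. X \<in> \<Delta> \<Longrightarrow> X \<subseteq> p X" by metis
  let ?S = "\<lambda>Z. \<Sum>X | X \<in> \<Delta> \<and> p X = Z. component \<Delta> v X"
  have S_mem: "?S Z \<in> Z" if "Z \<in> \<Gamma>" for Z
    by (rule subspace_sum[OF \<Gamma>.subspace_component[OF that]]) (use p \<Delta>.component_mem in blast)
  have "(\<Sum>Z\<in>\<Gamma>. ?S Z) = (\<Sum>X\<in>\<Delta>. component \<Delta> v X)"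
    by (rule sum.group[OF \<Delta>.finite_components \<Gamma>.finite_components]) (use p in blast)
  then have sum_S: "(\<Sum>Z\<in>\<Gamma>. ?S Z) = v" by (simp add: \<Delta>.component_sum)
  have "p X = Y"
  proof (rule ccontr)
    assume "p X \<noteq> Y"
    have "?S (p X) = component \<Gamma> v (p X)"
      by (rule \<Gamma>.component_unique[symmetric, OF S_mem sum_S p(1)[OF X]])
    also have "\<dots> = 0" using \<Gamma>.component_of_member[OF v Y p(1)[OF X]] \<open>p X \<noteq> Y\<close> by simp
    finally have "component \<Delta> v X = 0"
    proof (rule direct_sum_zero[OF \<Delta>.ds, rotated 3])
      show "finite {X' \<in> \<Delta>. p X' = p X}" using \<Delta>.finite_components by simp
      show "component \<Delta> v X' \<in> X'" if "X' \<in> {X' \<in> \<Delta>. p X' = p X}" for X' using that \<Delta>.component_mem by blast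
    qed (use X in auto)
    then show False using nz by simp
  qed
  then show ?thesis using p(2)[OF X] by simp
qed

lemma Stab_mono_refinement:
  assumes ref: "refinement \<Delta> \<Gamma>"
  shows "Stab \<Delta> \<subseteq> Stab \<Gamma>"
proof
  fix g assume g: "g \<in> Stab \<Delta>"
  interpret \<Delta>: finite_decomposition scale Basis \<Delta>
    by (rule grading_finite_decomposition) (use ref in \<open>simp add: refinement_def\<close>)
  interpret \<Gamma>: finite_decomposition scale Basis \<Gamma>
    by (rule grading_finite_decomposition) (use ref in \<open>simp add: refinement_def\<close>)
  have gA: "g \<in> Aut" and gX: "\<And>X. X \<in> \<Delta> \<Longrightarrow> g ` X = X" using g by (auto simp: Stab_def)
  note lin = Aut_linear[OF gA]
  have "g ` Y = Y" if Y: "Y \<in> \<Gamma>" for Y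
  proof (intro equalityI subsetI)
    fix w assume "w \<in> g ` Y"
    then obtain v where v: "v \<in> Y" "w = g v" by blast
    have "w = g (\<Sum>X\<in>\<Delta>. component \<Delta> v X)" by (simp add: v(2) \<Delta>.component_sum)
    also have "\<dots> = (\<Sum>X\<in>\<Delta>. g (component \<Delta> v X))" by (rule linear_simps(4)[OF lin])
    also have "\<dots> \<in> Y"
    proof (rule subspace_sum[OF \<Gamma>.subspace_component[OF Y]])
      fix X assume X: "X \<in> \<Delta>"
      show "g (component \<Delta> v X) \<in> Y"
      proof (cases "component \<Delta> v X = 0")
        case True
        then show ?thesis using linear_simps(3)[OF lin] subspace_0[OF \<Gamma>.subspace_component[OF Y]] by simp
      next
        case False
        have "g (component \<Delta> v X) \<in> X" using gX[OF X] \<Delta>.component_mem[OF X] by blast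
        then show ?thesis using refinement_component[OF ref Y v(1) X False] by blast
      qed
    qed
    finally show "w \<in> Y" .
  next
    fix v assume v: "v \<in> Y"
    have "\<exists>u. u \<in> Y \<and> g u = component \<Delta> v X" if X: "X \<in> \<Delta>" for X
    proof (cases "component \<Delta> v X = 0")
      case True
      then show ?thesis
        using linear_simps(3)[OF lin] subspace_0[OF \<Gamma>.subspace_component[OF Y]] by (intro exI[of _ 0]) simp
    next
      case False
      obtain u where "u \<in> X" "component \<Delta> v X = g u" using gX[OF X] \<Delta>.component_mem[OF X] by blast
      then show ?thesis using refinement_component[OF ref Y v X False] by (intro exI[of _ u]) auto
    qed
    then obtain u where u: "\<And>X. X \<in> \<Delta> \<Longrightarrow> u X \<in> Y" "\<And>X. X \<in> \<Delta> \<Longrightarrow> g (u X) = component \<Delta> v X" by metis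
    have "g (\<Sum>X\<in>\<Delta>. u X) = (\<Sum>X\<in>\<Delta>. g (u X))" by (rule linear_simps(4)[OF lin])
    also have "\<dots> = v" using u(2) by (simp add: \<Delta>.component_sum)
    finally have "g (\<Sum>X\<in>\<Delta>. u X) = v" .
    moreover have "(\<Sum>X\<in>\<Delta>. u X) \<in> Y"
      by (rule subspace_sum[OF \<Gamma>.subspace_component[OF Y]]) (rule u(1))
    ultimately show "v \<in> g ` Y" by blast
  qed
  then show "g \<in> Stab \<Gamma>" using gA by (simp add: Stab_def)
qed

text \<open>Each component of \<open>\<Gamma>\<close> contains a component of \<open>\<Delta>\<close>, so the image contains all generators.\<close>

lemma surj_quotient_map:
  assumes ref: "refinement \<Delta> \<Gamma>"
  shows "quotient_map \<Delta> \<Gamma> \<in> hom (univ_ab_group \<Delta>) (univ_ab_group \<Gamma>)"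
    and "quotient_map \<Delta> \<Gamma> ` carrier (univ_ab_group \<Delta>) = carrier (univ_ab_group \<Gamma>)"
proof -
  interpret \<Delta>: finite_decomposition scale Basis \<Delta>
    by (rule grading_finite_decomposition) (use ref in \<open>simp add: refinement_def\<close>)
  interpret \<Gamma>: finite_decomposition scale Basis \<Gamma>
    by (rule grading_finite_decomposition) (use ref in \<open>simp add: refinement_def\<close>)
  interpret A: comm_group "univ_ab_group \<Delta>" by (rule comm_group_univ_ab_group)
  interpret B: comm_group "univ_ab_group \<Gamma>" by (rule comm_group_univ_ab_group)
  let ?h = "quotient_map \<Delta> \<Gamma>"
  have h: "?h \<in> hom (univ_ab_group \<Delta>) (univ_ab_group \<Gamma>)"
    and hX: "\<And>X Y. X \<in> \<Delta> \<Longrightarrow> Y \<in> \<Gamma> \<Longrightarrow> X \<subseteq> Y \<Longrightarrow> ?h (univ_ab_map \<Delta> X) = univ_ab_map \<Gamma> Y"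
    using is_quotient_map_quotient_map[OF ref] unfolding is_quotient_map_def by blast+
  show "?h \<in> hom (univ_ab_group \<Delta>) (univ_ab_group \<Gamma>)" by (rule h)
  have "\<exists>X\<in>\<Delta>. X \<subseteq> Y" if Y: "Y \<in> \<Gamma>" for Y
  proof -
    obtain v where v: "v \<in> Y" "v \<noteq> 0"
      using \<Gamma>.nonzero[OF Y] subspace_0[OF \<Gamma>.subspace_component[OF Y]] by blast
    have "\<exists>X\<in>\<Delta>. component \<Delta> v X \<noteq> 0"
    proof (rule ccontr)
      assume "\<not> ?thesis"
      then have "(\<Sum>X\<in>\<Delta>. component \<Delta> v X) = 0" by (intro sum.neutral) blast
      then show False using v(2) by (simp add: \<Delta>.component_sum)
    qed
    then show ?thesis using refinement_component[OF ref Y v(1)] by blast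
  qed
  then obtain q where q: "\<And>Y. Y \<in> \<Gamma> \<Longrightarrow> q Y \<in> \<Delta>" "\<And>Y. Y \<in> \<Gamma> \<Longrightarrow> q Y \<subseteq> Y" by metis
  show "?h ` carrier (univ_ab_group \<Delta>) = carrier (univ_ab_group \<Gamma>)"
  proof (intro equalityI subsetI)
    fix u assume "u \<in> ?h ` carrier (univ_ab_group \<Delta>)"
    then show "u \<in> carrier (univ_ab_group \<Gamma>)" using hom_in_carrier[OF h] by blast
  next
    fix u assume "u \<in> carrier (univ_ab_group \<Gamma>)"
    then obtain c where c: "u = B.int_comb c (univ_ab_map \<Gamma>) \<Gamma>"
      using univ_ab_group_generated[OF \<Gamma>.finite_components] by blast
    have im: "(\<lambda>Y. univ_ab_map \<Delta> (q Y)) ` \<Gamma> \<subseteq> carrier (univ_ab_group \<Delta>)"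
      using univ_ab_map_carrier q(1) by blast
    have "?h (A.int_comb c (\<lambda>Y. univ_ab_map \<Delta> (q Y)) \<Gamma>) =
        B.int_comb c (?h \<circ> (\<lambda>Y. univ_ab_map \<Delta> (q Y))) \<Gamma>"
      by (rule hom_int_comb[OF A.comm_group_axioms B.comm_group_axioms h im])
    also have "\<dots> = u"
      unfolding c
    proof (rule B.int_comb_cong)
      show "(?h \<circ> (\<lambda>Y. univ_ab_map \<Delta> (q Y))) ` \<Gamma> \<subseteq> carrier (univ_ab_group \<Gamma>)"
        using im hom_in_carrier[OF h] by auto
      show "(?h \<circ> (\<lambda>Y. univ_ab_map \<Delta> (q Y))) Y = univ_ab_map \<Gamma> Y" if "Y \<in> \<Gamma>" for Y
        using hX[OF q(1)[OF that] that q(2)[OF that]] by simp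
    qed simp
    finally show "u \<in> ?h ` carrier (univ_ab_group \<Delta>)" using A.int_comb_closed[OF im] by (metis imageI)
  qed
qed

text \<open>Two multilinear maps that agree on a spanning set agree: the arguments are released from \<open>H\<close> one
  at a time, the first \<open>k\<close> of them being arbitrary.\<close>

lemma multilinear_eq_on_spanning:
  assumes i: "i \<in> I" and g: "endo g" and H: "span H = UNIV"
    and eq: "\<And>xs. length xs = ar i \<Longrightarrow> set xs \<subseteq> H \<Longrightarrow> g (opn i xs) = opn i (map g xs)"
    and xs: "length xs = ar i"
  shows "g (opn i xs) = opn i (map g xs)"
proof -
  have "g (opn i xs) = opn i (map g xs)"
    if "k \<le> ar i" "length xs = ar i" "\<And>j. k \<le> j \<Longrightarrow> j < ar i \<Longrightarrow> xs ! j \<in> H" for k xs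
    using that
  proof (induction k arbitrary: xs)
    case 0
    then show ?case by (intro eq) (auto simp: in_set_conv_nth)
  next
    case (Suc k)
    interpret P: vector_space_pair scale scale
      by (intro vector_space_pair.intro vector_space_axioms)
    let ?f = "\<lambda>x. take k xs @ x # drop (Suc k) xs"
    have len: "length (take k xs) + 1 + length (drop (Suc k) xs) = ar i" using Suc.prems by simp
    have xs_eq: "?f (xs ! k) = xs" using Suc.prems by (simp add: id_take_nth_drop[symmetric])
    have "g (opn i (?f (xs ! k))) = opn i (map g (?f (xs ! k)))"
    proof (rule P.linear_eq_on[of "\<lambda>x. g (opn i (?f x))" "\<lambda>x. opn i (map g (?f x))" _ H])
      have l1: "endo (\<lambda>x. opn i (?f x))"
        by (rule multilinear[OF i len])
      show "endo (\<lambda>x. g (opn i (?f x)))"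
        using linear_comp[OF g l1] by (simp add: o_def)
      have l2: "endo (\<lambda>x. opn i (map g (take k xs) @ x # map g (drop (Suc k) xs)))"
        by (rule multilinear[OF i]) (use len in simp)
      show "endo (\<lambda>x. opn i (map g (?f x)))"
        using linear_comp[OF l2 g] by (simp add: o_def)
      show "xs ! k \<in> span H" using H by simp
      show "g (opn i (?f x)) = opn i (map g (?f x))" if "x \<in> H" for x
      proof (rule Suc.IH)
        show "k \<le> ar i" using Suc.prems by simp
        show "length (?f x) = ar i" using len by simp
        show "?f x ! j \<in> H" if "k \<le> j" "j < ar i" for j
        proof (cases "j = k")
          case True
          then show ?thesis using \<open>x \<in> H\<close> Suc.prems by (simp add: nth_append)
        next
          case False
          then have "?f x ! j = xs ! j" using that Suc.prems by (simp add: nth_append nth_Cons')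
          then show ?thesis using Suc.prems(3)[of j] that False by simp
        qed
      qed
    qed
    then show ?case unfolding xs_eq .
  qed
  from this[of "ar i" xs] xs show ?thesis by simp
qed

text \<open>Scalars that satisfy the relations of the universal group define an automorphism. This is checked on
  homogeneous arguments, where the relation applies unless the product is zero.\<close>

lemma graded_scaling_in_Stab:
  assumes gr: "grading \<Gamma>" and g: "g \<in> carrier (GL scale)"
    and w: "\<And>X v. X \<in> \<Gamma> \<Longrightarrow> v \<in> X \<Longrightarrow> g v = scale (w X) v" "\<And>X. X \<in> \<Gamma> \<Longrightarrow> w X \<noteq> 0"
    and rel: "\<And>Xs X. (Xs, [X]) \<in> univ_relations \<Gamma> \<Longrightarrow> prod_list (map w Xs) = w X"
  shows "g \<in> Stab \<Gamma>"
proof -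
  interpret \<Gamma>: finite_decomposition scale Basis \<Gamma>
    by (rule grading_finite_decomposition[OF gr])
  note lin = GL_linear[OF g]
  have span: "span (\<Union>\<Gamma>) = UNIV"
  proof -
    have "v \<in> span (\<Union>\<Gamma>)" for v
    proof -
      have "(\<Sum>X\<in>\<Gamma>. component \<Gamma> v X) \<in> span (\<Union>\<Gamma>)"
        by (rule span_sum) (use \<Gamma>.component_mem in \<open>auto intro: span_base\<close>)
      then show ?thesis by (simp add: \<Gamma>.component_sum)
    qed
    then show ?thesis by blast
  qed
  have "g (opn i xs) = opn i (map g xs)" if i: "i \<in> I" and len: "length xs = ar i" for i xs
  proof (rule multilinear_eq_on_spanning[OF i lin span _ len])
    fix xs assume xs: "length xs = ar i" "set xs \<subseteq> \<Union>\<Gamma>"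
    have "\<forall>x\<in>set xs. \<exists>X. X \<in> \<Gamma> \<and> x \<in> X" using xs(2) by blast
    then obtain p where p: "\<And>x. x \<in> set xs \<Longrightarrow> p x \<in> \<Gamma>" "\<And>x. x \<in> set xs \<Longrightarrow> x \<in> p x" by metis
    let ?Xs = "map p xs"
    have Xs: "set ?Xs \<subseteq> \<Gamma>" "length ?Xs = ar i" using p(1) xs(1) by auto
    have mem: "xs \<in> listset ?Xs"
      unfolding listset_iff list_all2_map2 by (rule list.rel_refl_strong) (rule p(2))
    have "map g xs = map2 scale (map w ?Xs) xs"
      using p w(1) by (induction xs) auto
    then have R: "opn i (map g xs) = scale (prod_list (map w ?Xs)) (opn i xs)"
      using opn_scale[OF i, of "map w ?Xs" xs "[]"] xs(1) by simp
    show "g (opn i xs) = opn i (map g xs)"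
    proof (cases "opn i xs = 0")
      case True
      then show ?thesis unfolding R by (simp add: linear_simps(3)[OF lin])
    next
      case False
      have "\<forall>i\<in>I. \<forall>Xs. set Xs \<subseteq> \<Gamma> \<and> length Xs = ar i \<longrightarrow> (\<exists>X\<in>\<Gamma>. opn i ` listset Xs \<subseteq> X)"
        using gr by (simp add: grading_def)
      then obtain X where X: "X \<in> \<Gamma>" "opn i ` listset ?Xs \<subseteq> X" using i Xs by blast
      have "\<not> opn i ` listset ?Xs \<subseteq> {0}" using False mem by blast
      then have "(?Xs, [X]) \<in> univ_relations \<Gamma>"
        using i Xs X unfolding univ_relations_def by blast
      then have "prod_list (map w ?Xs) = w X" by (rule rel)
      moreover have "opn i xs \<in> X" using X(2) mem by blast
      ultimately show ?thesis unfolding R using w(1)[OF X(1)] by simp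
    qed
  qed
  then have "g \<in> Aut" using g by (simp add: Aut_def)
  moreover have "g ` X = X" if X: "X \<in> \<Gamma>" for X
  proof (intro equalityI subsetI)
    fix y assume "y \<in> g ` X"
    then show "y \<in> X" using w(1)[OF X] subspace_scale[OF \<Gamma>.subspace_component[OF X]] by auto
  next
    fix v assume v: "v \<in> X"
    then have u: "scale (inverse (w X)) v \<in> X" by (rule subspace_scale[OF \<Gamma>.subspace_component[OF X]])
    then have "g (scale (inverse (w X)) v) = v" using w(1)[OF X u] w(2)[OF X] by simp
    then show "v \<in> g ` X" using u by (metis imageI)
  qed
  ultimately show ?thesis by (simp add: Stab_def)
qed

end

section \<open>Fine gradings are almost fine\<close>

lemma monomial_sum_list:
  assumes "t \<in> carrier (mult_torus r)"
  shows "prod_list (map (\<lambda>X. monomial r (a X) t) Xs) = monomial r (\<lambda>k. sum_list (map (\<lambda>X. a X k) Xs)) t"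
proof (induction Xs)
  case Nil
  show ?case by (simp add: monomial_def)
next
  case (Cons X Xs)
  then show ?case by (simp add: monomial_add[OF assms])
qed

lemma monomial_cong: "(\<And>k. k < r \<Longrightarrow> a k = b k) \<Longrightarrow> monomial r a t = monomial r b t"
  unfolding monomial_def by (rule prod.cong) simp_all

context fd_algebra
begin

text \<open>The exponents \<open>a X\<close> are the coordinates modulo torsion of the degree of \<open>X\<close>. They satisfy the
  relations of the universal group, so the monomial torus stabilizes the grading. Conversely, let \<open>g\<close>
  lie in a torus \<open>T\<close> that acts by scalars on every component. The scalars of any \<open>y\<close> in \<open>T\<close> extend to
  a homomorphism \<open>h\<close> on the abelian universal group. If \<open>e\<close> kills the torsion parts of all degrees
  and \<open>y ^^ e = g\<close>, the scalars of \<open>g\<close> are the \<open>e\<close>-th powers of those of \<open>y\<close>. So they depend on the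
  coordinates only, and \<open>g\<close> is the monomial action of the tuple \<open>h (x k) y ^ e\<close>.\<close>

theorem ex_diagonal_torus:
  assumes gr: "grading \<Delta>"
  obtains D where "torus_of_dim scale (free_rank (univ_ab_group \<Delta>)) D" "D \<subseteq> Stab \<Delta>"
    "\<And>n T. torus_of_dim scale n T \<Longrightarrow> T \<subseteq> Stab \<Delta> \<Longrightarrow>
       (\<And>X. X \<in> \<Delta> \<Longrightarrow> \<exists>\<chi>\<in>characters T. X \<subseteq> eigenspace T \<chi>) \<Longrightarrow> T \<subseteq> D"
proof -
  let ?A = "univ_ab_group \<Delta>" and ?u = "univ_ab_map \<Delta>"
  interpret \<Delta>: finite_decomposition scale Basis \<Delta>
    by (rule grading_finite_decomposition[OF gr])
  interpret A: comm_group ?A by (rule comm_group_univ_ab_group)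
  note fin = \<Delta>.finite_components
  define r where "r = free_rank ?A"
  obtain x where "basis_mod_torsion ?A x r"
    unfolding r_def by (rule A.ex_basis_free_rank[OF univ_ab_group_fin_gen[OF fin]])
  then interpret B: basis_mod_torsion ?A x r .
  define a where "a X = B.coord (?u X)" for X
  have uc: "?u ` \<Delta> \<subseteq> carrier ?A" using univ_ab_map_carrier by blast
  have "\<forall>k\<in>{..<r}. \<exists>n. x k = A.int_comb n ?u \<Delta>"
    using univ_ab_group_generated[OF fin] B.basis_carrier by blast
  then obtain n where n: "\<And>k. k < r \<Longrightarrow> x k = A.int_comb (n k) ?u \<Delta>" by (metis lessThan_iff)
  have dual: "(\<Sum>X\<in>\<Delta>. n k X * a X j) = (if j = k then 1 else 0)" if "j < r" "k < r" for j k
    using B.coord_int_comb[OF fin uc, of j "n k"] B.coord_basis[of k j] n[of k] that by (simp add: a_def)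
  interpret M: monomial_torus scale Basis \<Delta> r a n
    by (intro monomial_torus.intro \<Delta>.finite_decomposition_axioms monomial_torus_axioms.intro) (rule dual)
  have rel: "sum_list (map (\<lambda>X. a X k) Xs) = a X k"
    if R: "(Xs, [X]) \<in> univ_relations \<Delta>" and k: "k < r" for Xs X k
  proof -
    let ?f = "\<lambda>Xs. foldr (\<lambda>X y. ?u X \<otimes>\<^bsub>?A\<^esub> y) Xs \<one>\<^bsub>?A\<^esub>"
    have fold: "?f Xs \<in> carrier ?A \<and> B.coord (?f Xs) k = sum_list (map (\<lambda>X. a X k) Xs)" if "set Xs \<subseteq> \<Delta>" for Xs
      using that
    proof (induction Xs)
      case Nil
      show ?case using B.coord_torsion[OF A.torsion_one k] by simp
    next
      case (Cons X Xs)
      then have "?u X \<in> carrier ?A" using uc by auto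
      then show ?case using Cons k by (simp add: B.coord_mult a_def)
    qed
    then show ?thesis
      using fold[of Xs] degree_map_relation[OF degree_map_univ_ab_map R] univ_relations_mem[OF R]
      by (auto simp: a_def)
  qed
  show thesis
  proof (rule that[of M.diag_torus])
    show "torus_of_dim scale (free_rank ?A) M.diag_torus" using M.torus_diag_torus by (simp add: r_def)
    show "M.diag_torus \<subseteq> Stab \<Delta>"
    proof
      fix g assume "g \<in> M.diag_torus"
      then obtain t where t: "t \<in> carrier (mult_torus r)" "g = M.act t" unfolding M.diag_torus_def by blast
      show "g \<in> Stab \<Delta>"
      proof (rule graded_scaling_in_Stab[OF gr])
        show "g \<in> carrier (GL scale)" unfolding t(2) by (rule M.act_GL[OF t(1)])
        show "g v = scale (monomial r (a X) t) v" if "X \<in> \<Delta>" "v \<in> X" for X v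
          unfolding t(2) M.act_def by (rule \<Delta>.diag_component[OF that(2,1)])
        show "monomial r (a X) t \<noteq> 0" for X by (rule monomial_nonzero[OF t(1)])
        show "prod_list (map (\<lambda>X. monomial r (a X) t) Xs) = monomial r (a X) t"
          if "(Xs, [X]) \<in> univ_relations \<Delta>" for Xs X
          unfolding monomial_sum_list[OF t(1)] by (rule monomial_cong) (rule rel[OF that])
      qed
    qed
    fix m T assume T: "torus_of_dim scale m T" "T \<subseteq> Stab \<Delta>"
      and scalar: "\<And>X. X \<in> \<Delta> \<Longrightarrow> \<exists>\<chi>\<in>characters T. X \<subseteq> eigenspace T \<chi>"
    obtain \<chi> where \<chi>: "\<And>X. X \<in> \<Delta> \<Longrightarrow> \<chi> X \<in> characters T" "\<And>X. X \<in> \<Delta> \<Longrightarrow> X \<subseteq> eigenspace T (\<chi> X)"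
      using scalar by metis
    have T_Aut: "T \<subseteq> Aut" using T(2) by (auto simp: Stab_def)
    let ?U = "unit_functions :: (('v \<Rightarrow> 'v) \<Rightarrow> 'f) monoid"
    interpret U: comm_group ?U by (rule comm_group_unit_functions)
    have \<chi>_mult: "prod_list (map (\<lambda>X. \<chi> X g) Xs) = \<chi> X g"
      if R: "(Xs, [X]) \<in> univ_relations \<Delta>" for Xs X g
    proof (cases "g \<in> T")
      case True
      obtain i where i: "set Xs \<subseteq> \<Delta>" "X \<in> \<Delta>" "i \<in> I" "length Xs = ar i"
        "\<not> opn i ` listset Xs \<subseteq> {0}" "opn i ` listset Xs \<subseteq> X"
        using R unfolding univ_relations_def by blast
      obtain xs where xs: "xs \<in> listset Xs" "opn i xs \<noteq> 0" using i(5) by blast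
      have "g (opn i xs) = scale (prod_list (map (\<lambda>X. \<chi> X g) Xs)) (opn i xs)"
      proof (rule opn_eigenvectors[OF _ i(3) xs(1) i(4)])
        show "g \<in> Aut" using True T_Aut by blast
        show "g v = scale (\<chi> Y g) v" if "Y \<in> set Xs" "v \<in> Y" for Y v
          using that i(1) \<chi>(2)[of Y] eigenspaceD[OF _ True, of v "\<chi> Y"] by blast
      qed
      moreover have "g (opn i xs) = scale (\<chi> X g) (opn i xs)"
        using i(2,6) xs(1) \<chi>(2)[of X] eigenspaceD[OF _ True, of "opn i xs" "\<chi> X"] by blast
      ultimately show ?thesis using xs(2) by simp
    next
      case False
      have sub: "set Xs \<subseteq> \<Delta>" "X \<in> \<Delta>" using univ_relations_mem[OF R] by auto
      have one: "\<chi> Y g = 1" if "Y \<in> \<Delta>" for Y using \<chi>(1)[OF that] False by (simp add: characters_def)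
      have "prod_list (map (\<lambda>X. \<chi> X g) Xs) = 1" using sub(1) by (induction Xs) (simp_all add: one)
      then show ?thesis using one[OF sub(2)] by simp
    qed
    have "degree_map \<Delta> ?U \<chi>"
      unfolding degree_map_def
    proof (intro conjI allI impI)
      show "\<chi> ` \<Delta> \<subseteq> carrier ?U" using \<chi>(1) by (auto simp: characters_def unit_functions_def)
      show "foldr (\<lambda>X y. \<chi> X \<otimes>\<^bsub>?U\<^esub> y) Xs \<one>\<^bsub>?U\<^esub> = \<chi> X" if "(Xs, [X]) \<in> univ_relations \<Delta>" for Xs X
        unfolding foldr_unit_functions by (rule ext) (rule \<chi>_mult[OF that])
    qed
    then obtain h where h: "h \<in> hom ?A ?U" "\<And>X. X \<in> \<Delta> \<Longrightarrow> h (?u X) = \<chi> X"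
      using univ_ab_group_lift[OF comm_group_unit_functions] by blast
    interpret h: group_hom ?A ?U h by (intro group_hom.intro group_hom_axioms.intro A.is_group U.is_group h(1))
    let ?p = "\<lambda>X. A.int_comb (a X) x {..<r}" and ?\<tau> = "\<lambda>X. B.torsion_part (?u X)"
    have pc: "?p X \<in> carrier ?A" for X by (rule B.basis_comb_carrier)
    have u_eq: "?u X = ?p X \<otimes>\<^bsub>?A\<^esub> ?\<tau> X" if "X \<in> \<Delta>" for X
      unfolding a_def using uc that by (intro B.coord_decomposition) blast
    have \<tau>: "?\<tau> X \<in> A.torsion" "?\<tau> X \<in> carrier ?A" if "X \<in> \<Delta>" for X
      using B.torsion_part_torsion[of "?u X"] uc that A.torsion_carrier by blast+
    have "\<forall>X\<in>\<Delta>. \<exists>N::int. N \<noteq> 0 \<and> ?\<tau> X [^]\<^bsub>?A\<^esub> N = \<one>\<^bsub>?A\<^esub>" using \<tau>(1) unfolding A.torsion_def by blast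
    then obtain N :: "'v set \<Rightarrow> int" where N: "\<And>X. X \<in> \<Delta> \<Longrightarrow> N X \<noteq> 0"
      "\<And>X. X \<in> \<Delta> \<Longrightarrow> ?\<tau> X [^]\<^bsub>?A\<^esub> N X = \<one>\<^bsub>?A\<^esub>" by metis
    define e where "e = nat \<bar>\<Prod>X\<in>\<Delta>. N X\<bar>"
    have e0: "e > 0" unfolding e_def using N(1) fin by simp
    have \<tau>e: "?\<tau> X [^]\<^bsub>?A\<^esub> int e = \<one>\<^bsub>?A\<^esub>" if X: "X \<in> \<Delta>" for X
    proof -
      have "N X dvd (\<Prod>X\<in>\<Delta>. N X)" using fin X by (rule dvd_prodI)
      then have "N X dvd int e" by (simp add: e_def)
      then obtain q where "int e = N X * q" by (elim dvdE)
      then show ?thesis using N(2)[OF X] \<tau>(2)[OF X] by (simp add: A.int_pow_pow[symmetric])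
    qed
    show "T \<subseteq> M.diag_torus"
    proof
      fix g assume g: "g \<in> T"
      obtain y where y: "y \<in> T" "y ^^ e = g" using torus_divisible[OF T(1) g e0] by blast
      note ylin = Aut_linear[OF subsetD[OF T_Aut y(1)]] and glin = Aut_linear[OF subsetD[OF T_Aut g]]
      define t where "t = (\<lambda>k\<in>{..<r}. h (x k) y ^ e)"
      have hx: "(\<lambda>k. h (x k)) ` {..<r} \<subseteq> carrier ?U" using B.basis_carrier by auto
      have t: "t \<in> carrier (mult_torus r)"
        unfolding mult_torus_carrier
      proof (rule PiE_I)
        fix k assume k: "k \<in> {..<r}"
        then have "h (x k) \<in> carrier ?U" using hx by blast
        then have "h (x k) y \<noteq> 0" by (simp add: unit_functions_def)
        then show "t k \<in> UNIV - {0}" using k by (simp add: t_def)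
      qed (simp add: t_def)
      have weight: "\<chi> X y ^ e = monomial r (a X) t" if X: "X \<in> \<Delta>" for X
      proof -
        have "\<chi> X y ^ e = (h (?u X) [^]\<^bsub>?U\<^esub> int e) y"
          unfolding unit_functions_int_pow[OF h.hom_closed[OF subsetD[OF uc imageI[OF X]]]]
          by (simp add: h(2)[OF X])
        also have "h (?u X) [^]\<^bsub>?U\<^esub> int e = h (?u X [^]\<^bsub>?A\<^esub> int e)"
          using uc X by (intro h.hom_int_pow[symmetric]) blast
        also have "?u X [^]\<^bsub>?A\<^esub> int e = ?p X [^]\<^bsub>?A\<^esub> int e"
          using arg_cong[OF u_eq[OF X], of "\<lambda>z. z [^]\<^bsub>?A\<^esub> int e"] pc[of X] \<tau>(2)[OF X] \<tau>e[OF X]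
          by (simp add: A.int_pow_distrib)
        also have "h (?p X [^]\<^bsub>?A\<^esub> int e) = h (?p X) [^]\<^bsub>?U\<^esub> int e"
          by (rule h.hom_int_pow[OF pc])
        also have "(h (?p X) [^]\<^bsub>?U\<^esub> int e) y = h (?p X) y ^ e"
          using unit_functions_int_pow[OF h.hom_closed[OF pc], of X "int e" y] by simp
        also have "h (?p X) y = (\<Prod>k<r. h (x k) y powi a X k)"
        proof -
          have "h (?p X) = U.int_comb (a X) (h \<circ> x) {..<r}"
            by (rule hom_int_comb[OF A.comm_group_axioms U.comm_group_axioms h(1) B.basis_carrier])
          then show ?thesis using unit_functions_int_comb[of "{..<r}" "h \<circ> x" "a X" y] hx by auto
        qed
        also have "(\<Prod>k<r. h (x k) y powi a X k) ^ e = (\<Prod>k<r. (h (x k) y ^ e) powi a X k)"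
          by (simp add: prod_power_distrib power_int_power power_int_power' mult.commute)
        also have "\<dots> = monomial r (a X) t"
          unfolding monomial_def by (rule prod.cong) (simp_all add: t_def)
        finally show ?thesis .
      qed
      have "g v = scale (monomial r (a X) t) v" if X: "X \<in> \<Delta>" and v: "v \<in> X" for X v
      proof -
        have yv: "y v = scale (\<chi> X y) v" using \<chi>(2)[OF X] v y(1) eigenspaceD by blast
        have "(y ^^ j) v = scale (\<chi> X y ^ j) v" for j
          by (induction j) (simp_all add: linear_simps(2)[OF ylin] yv mult.commute)
        then show ?thesis using y(2) weight[OF X] by metis
      qed
      then have "g = M.act t" unfolding M.act_def by (rule \<Delta>.linear_eq_diag[OF glin])
      then show "g \<in> M.diag_torus" unfolding M.diag_torus_def using t by blast
    qed
  qed
qed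

theorem fine_imp_unique_maximal_torus:
  assumes fine: "fine_group_grading \<Delta> \<or> fine_abelian_group_grading \<Delta>"
  obtains D where "torus_of_dim scale (free_rank (univ_ab_group \<Delta>)) D" "D \<subseteq> Stab \<Delta>"
    "\<And>n T. torus_of_dim scale n T \<Longrightarrow> T \<subseteq> Stab \<Delta> \<Longrightarrow> T \<subseteq> D"
proof -
  have gr: "grading \<Delta>"
    using fine unfolding fine_group_grading_def fine_abelian_group_grading_def
      group_grading_def abelian_group_grading_def by blast
  obtain D where D: "torus_of_dim scale (free_rank (univ_ab_group \<Delta>)) D" "D \<subseteq> Stab \<Delta>"
    "\<And>n T. torus_of_dim scale n T \<Longrightarrow> T \<subseteq> Stab \<Delta> \<Longrightarrow>
       (\<And>X. X \<in> \<Delta> \<Longrightarrow> \<exists>\<chi>\<in>characters T. X \<subseteq> eigenspace T \<chi>) \<Longrightarrow> T \<subseteq> D"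
    using ex_diagonal_torus[OF gr] by metis
  show thesis
  proof (rule that[OF D(1,2)])
    fix n T assume T: "torus_of_dim scale n T" "T \<subseteq> Stab \<Delta>"
    have sub: "subspace X" if "X \<in> \<Delta>" for X
      using gr that by (simp add: grading_def direct_sum_decomposition_def)
    interpret S: diagonalizable_stabilizer scale I ar opn Basis \<Delta> T
    proof (intro diagonalizable_stabilizer.intro fd_algebra_axioms diagonalizable_stabilizer_axioms.intro gr)
      show "T \<subseteq> Aut" using T(2) by (auto simp: Stab_def)
      show "X \<subseteq> span {v \<in> X. \<forall>g\<in>T. \<exists>c. g v = scale c v}" if X: "X \<in> \<Delta>" for X
      proof (rule torus_eigenvectors_span[OF T(1) sub[OF X]])
        show "g ` X \<subseteq> X" if "g \<in> T" for g using T(2) that X by (auto simp: Stab_def)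
      qed
    qed
    show "T \<subseteq> D"
      by (rule D(3)[OF T]) (use S.fine_imp_scalar[OF fine] in metis)
  qed
qed

text \<open>The unique maximal torus \<open>D\<close> contains all tori in the stabilizer. Its dimension is well defined by
  \<open>torus_dim_mono\<close>.\<close>

lemma fine_tor_rank:
  assumes fine: "fine_group_grading \<Delta> \<or> fine_abelian_group_grading \<Delta>"
  shows "tor_rank \<Delta> = free_rank (univ_ab_group \<Delta>)"
proof -
  let ?r = "free_rank (univ_ab_group \<Delta>)"
  obtain D where D: "torus_of_dim scale ?r D" "D \<subseteq> Stab \<Delta>"
    "\<And>n T. torus_of_dim scale n T \<Longrightarrow> T \<subseteq> Stab \<Delta> \<Longrightarrow> T \<subseteq> D"
    using fine_imp_unique_maximal_torus[OF fine] by metis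
  have torus_D: "torus scale D" unfolding torus_def using D(1) by (rule exI)
  have max_D: "maximal_torus scale (Stab \<Delta>) D"
    unfolding maximal_torus_def
  proof (intro conjI torus_D D(2) allI impI)
    fix T' assume T': "torus scale T' \<and> T' \<subseteq> Stab \<Delta> \<and> D \<subseteq> T'"
    then obtain n where "torus_of_dim scale n T'" unfolding torus_def by (elim conjE exE)
    then have "T' \<subseteq> D" by (rule D(3)) (use T' in simp)
    then show "T' = D" using T' by simp
  qed
  have "n = ?r" if T: "maximal_torus scale (Stab \<Delta>) T" "torus_of_dim scale n T" for n T
  proof -
    have "T \<subseteq> Stab \<Delta>" using T(1) by (simp add: maximal_torus_def)
    then have "T \<subseteq> D" by (rule D(3)[OF T(2)])
    then have "D = T" using T(1) torus_D D(2) by (simp add: maximal_torus_def)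
    then show ?thesis using torus_dim_mono[OF T(2) D(1)] torus_dim_mono[OF D(1) T(2)] by simp
  qed
  then have "{n. \<exists>T. maximal_torus scale (Stab \<Delta>) T \<and> torus_of_dim scale n T} = {?r}"
    using max_D D(1) by (intro equalityI subsetI) blast+
  then show ?thesis by (simp add: tor_rank_def max_torus_dim_def)
qed

lemma tor_rank_ge:
  assumes T: "torus_of_dim scale n T" "T \<subseteq> Stab \<Gamma>"
  shows "n \<le> tor_rank \<Gamma>"
proof -
  let ?N = "{n. \<exists>T. maximal_torus scale (Stab \<Gamma>) T \<and> torus_of_dim scale n T}"
  obtain n' T' where T': "maximal_torus scale (Stab \<Gamma>) T'" "torus_of_dim scale n' T'" "n \<le> n'"
  proof (rule maximal_torus_above[OF T])
    show "k \<le> dimension" if "torus_of_dim scale k S" for k S using that by (rule torus_dim_le_dimension)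
  qed (rule that)
  have "?N \<subseteq> {..dimension}"
  proof
    fix k assume "k \<in> ?N"
    then obtain S where "torus_of_dim scale k S" by blast
    then show "k \<in> {..dimension}" using torus_dim_le_dimension by simp
  qed
  then have fin: "finite ?N" by (rule finite_subset) simp
  have "n' \<in> ?N" using T'(1,2) by (intro CollectI exI[of _ T'] conjI)
  then have "n' \<le> Max ?N" by (rule Max_ge[OF fin])
  then show ?thesis using T'(3) by (simp add: tor_rank_def max_torus_dim_def)
qed

text \<open>The chain \<open>free_rank (univ_ab_group \<Gamma>) \<le> free_rank (univ_ab_group \<Delta>) = tor_rank \<Delta> \<le> tor_rank \<Gamma>\<close>
  collapses exactly when both inequalities are equalities.\<close>

theorem almost_fine_coarsening_iff:
  assumes fine: "fine_group_grading \<Delta> \<or> fine_abelian_group_grading \<Delta>" and ref: "coarsening \<Gamma> \<Delta>"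
  shows "almost_fine \<Gamma> \<longleftrightarrow>
    finite (kernel (univ_ab_group \<Delta>) (univ_ab_group \<Gamma>) (quotient_map \<Delta> \<Gamma>)) \<and> tor_rank \<Gamma> = tor_rank \<Delta>"
proof -
  have r: "refinement \<Delta> \<Gamma>" using ref by (simp add: coarsening_def)
  then have gr: "grading \<Delta>" by (simp add: refinement_def)
  have fin: "finite \<Delta>"
    by (rule finite_decomposition.finite_components[OF grading_finite_decomposition[OF gr]])
  note surj = free_rank_surjective_hom[OF comm_group_univ_ab_group comm_group_univ_ab_group
      surj_quotient_map[OF r] univ_ab_group_fin_gen[OF fin]]
  obtain D where D: "torus_of_dim scale (free_rank (univ_ab_group \<Delta>)) D" "D \<subseteq> Stab \<Delta>"
    using fine_imp_unique_maximal_torus[OF fine] by metis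
  have "free_rank (univ_ab_group \<Delta>) \<le> tor_rank \<Gamma>"
    by (rule tor_rank_ge[OF D(1)]) (use D(2) Stab_mono_refinement[OF r] in blast)
  then show ?thesis
    unfolding almost_fine_def surj(2)[symmetric] fine_tor_rank[OF fine] using surj(1) by linarith
qed

end

theorem proposition5p1:
  fixes scale :: "'f::alg_closed_field \<Rightarrow> 'v::ab_group_add \<Rightarrow> 'v"
    and Basis :: "'v set"
    and I :: "'i set"
    and ar :: "'i \<Rightarrow> nat"
    and opn :: "'i \<Rightarrow> 'v list \<Rightarrow> 'v"
    and \<Delta> \<Gamma> :: "'v set set"
  assumes "finite_dimensional_vector_space scale Basis"
    and "multilinear_algebra scale I ar opn"
    and "multilinear_algebra.fine_group_grading scale I ar opn \<Delta> \<or>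
         multilinear_algebra.fine_abelian_group_grading scale I ar opn \<Delta>"
    and "multilinear_algebra.coarsening scale I ar opn \<Gamma> \<Delta>"
  shows "multilinear_algebra.almost_fine scale I ar opn \<Gamma> \<longleftrightarrow>
         finite (kernel (multilinear_algebra.univ_ab_group I ar opn \<Delta>)
                        (multilinear_algebra.univ_ab_group I ar opn \<Gamma>)
                        (multilinear_algebra.quotient_map I ar opn \<Delta> \<Gamma>)) \<and>
         multilinear_algebra.tor_rank scale I ar opn \<Gamma> =
         multilinear_algebra.tor_rank scale I ar opn \<Delta>"
proof -
  interpret fd_algebra scale I ar opn Basis
    by (intro fd_algebra.intro alg_closed_fd_space.intro assms(1,2))
  show ?thesis by (rule almost_fine_coarsening_iff[OF assms(3,4)])
qed

end
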